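(* Let $k\ge2$, $r\ge0$, and let $f_h\in\mathcal G_h^k$, $\mathbf E_h,\mathbf B_h\in\mathcal U_h^r$ be a solution of the semi-discrete discontinuous Galerkin scheme for the Vlasov–Maxwell system described in the context, with the upwind numerical flux for the Vlasov part and with either the central or the alternating flux for the Maxwell part. Then $$\frac{d}{dt}\left(\int_{\mathcal T_h}f_h|\xi|^2\,d\mathbf x\,d\xi+\int_{\mathcal T_h^x}\big(|\mathbf E_h|^2+|\mathbf B_h|^2\big)\,d\mathbf x\right)+\Theta_{h,3}(t)=0,$$ where $$\Theta_{h,3}(t)=\int_{\mathcal T_h^x}\int_{\mathcal E_\xi^b}f_h|\xi|^2\max\big((\mathbf E_h+\xi\times\mathbf B_h)\cdot\mathbf n_\xi,\,0\big)\,ds_\xi\,d\mathbf x .$$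
   Context: Domain and mesh. $d_x=d_\xi=3$, $\Omega_x=(-L_x,L_x]^{3}$ with periodic boundary conditions in $\mathbf x$, $\Omega_\xi=[-L_\xi,L_\xi]^{3}$, $\Omega=\Omega_x\times\Omega_\xi$. $\mathcal T_h^x=\{K_x\}$ and $\mathcal T_h^\xi=\{K_\xi\}$ are partitions of $\Omega_x$ and $\Omega_\xi$ into (rotated) Cartesian elements or simplices, and $\mathcal T_h=\{K_x\times K_\xi\}$ is the product partition of $\Omega$. $\mathcal E_x$, $\mathcal E_\xi$ are the sets of edges (faces) of $\mathcal T_h^x$, $\mathcal T_h^\xi$; periodicity is taken into account in $\mathcal E_x$ (so every edge of $\mathcal E_x$ is shared by two elements), and $\mathcal E_\xi=\mathcal E_\xi^i\cup\mathcal E_\xi^b$ with $\mathcal E_\xi^i$ interior and $\mathcal E_\xi^b$ boundary edges. Integrals over $\mathcal T_h,\mathcal T_h^x,\mathcal T_h^\xi,\mathcal E_x,\mathcal E_\xi,\mathcal E_\xi^b$ are sums of integrals over the elements/edges in the set. $\mathbf n_x$, $\mathbf n_\xi$ are unit normals (outward on element boundaries and on $\mathcal E_\xi^b$). Discrete spaces ($P^m(D)$: polynomials of total degree at most $m$ on $D$). $\mathcal G_h^k=\{g\in L^2(\Omega): g|_K\in P^k(K)\ \forall K\in\mathcal T_h\}$, $\mathcal U_h^r=\{\mathbf U\in[L^2(\Omega_x)]^3: \mathbf U|_{K_x}\in[P^r(K_x)]^3\ \forall K_x\in\mathcal T_h^x\}$, with integers $k,r\ge0$. Jumps and averages. For an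 edge $e=K_x^+\cap K_x^-\in\mathcal E_x$ with outward unit normals $\mathbf n_x^\pm$ to $\partial K_x^\pm$, and traces $g^\pm,\mathbf U^\pm$ from $K_x^\pm$: $[g]_x=g^+\mathbf n_x^++g^-\mathbf n_x^-$, $[\mathbf U]_x=\mathbf U^+\cdot\mathbf n_x^++\mathbf U^-\cdot\mathbf n_x^-$, $[\mathbf U]_\tau=\mathbf U^+\times\mathbf n_x^++\mathbf U^-\times\mathbf n_x^-$, $\{g\}_x=\frac12(g^++g^-)$, $\{\mathbf U\}_x=\frac12(\mathbf U^++\mathbf U^-)$. The quantities $[\cdot]_\xi,\{\cdot\}_\xi$ on $\mathcal E_\xi^i$ are defined analogously; on $\mathcal E_\xi^b$ with outward unit normal $\mathbf n_\xi$: $[g]_\xi=g\,\mathbf n_\xi$, $\{g\}_\xi=\frac12 g$, $\{\mathbf U\}_\xi=\frac12\mathbf U$. Scheme. Find time-dependent $f_h\in\mathcal G_h^k$, $\mathbf E_h,\mathbf B_h\in\mathcal U_h^r$ such that for all $g\in\mathcal G_h^k$, $\mathbf U,\mathbf V\in\mathcal U_h^r$: $a_h(f_h,\mathbf E_h,\mathbf B_h;g)=0$ and $b_h(\mathbf E_h,\mathbf B_h;\mathbf U,\mathbf V)=l_h(\mathbf J_h;\mathbf U)$, where $\mathbf J_h(\mathbf x,t)=\int_{\mathcal T_h^\xi} f_h\,\xi\,d\xi$, $l_h(\mathbf J_h;\mathbf U)=-\int_{\mathcal T_h^x}\mathbf J_h\cdot\mathbf U\,d\mathbf x$, $$a_h=\int_{\mathcal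 T_h}\partial_tf_h\,g\,d\mathbf xd\xi-\int_{\mathcal T_h}f_h\,\xi\cdot\nabla_{\mathbf x}g\,d\mathbf xd\xi+\int_{\mathcal T_h^\xi}\int_{\mathcal E_x}\widetilde{f_h\xi}\cdot[g]_x\,ds_xd\xi-\int_{\mathcal T_h}f_h(\mathbf E_h+\xi\times\mathbf B_h)\cdot\nabla_\xi g\,d\mathbf xd\xi+\int_{\mathcal T_h^x}\int_{\mathcal E_\xi}\widetilde{f_h(\mathbf E_h+\xi\times\mathbf B_h)}\cdot[g]_\xi\,ds_\xi d\mathbf x,$$ $$b_h=\int_{\mathcal T_h^x}\partial_t\mathbf E_h\cdot\mathbf U\,d\mathbf x-\int_{\mathcal T_h^x}\mathbf B_h\cdot\nabla\times\mathbf U\,d\mathbf x-\int_{\mathcal E_x}\widetilde{\mathbf B_h}\cdot[\mathbf U]_\tau ds_x+\int_{\mathcal T_h^x}\partial_t\mathbf B_h\cdot\mathbf V\,d\mathbf x+\int_{\mathcal T_h^x}\mathbf E_h\cdot\nabla\times\mathbf V\,d\mathbf x+\int_{\mathcal E_x}\widetilde{\mathbf E_h}\cdot[\mathbf V]_\tau ds_x.$$ Upwind flux for the Vlasov part: $\widetilde{f_h\xi}=\{f_h\xi\}_x+\frac{|\xi\cdot\mathbf n_x|}{2}[f_h]_x$, $\ \widetilde{f_h(\mathbf E_h+\xi\times\mathbf B_h)}=\{f_h(\mathbf E_h+\xi\times\mathbf B_h)\}_\xi+\frac{|(\mathbf E_h+\xi\times\mathbf B_h)\cdot\mathbf n_\xi|}{2}[f_h]_\xi$.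 Maxwell part: the central flux is $\widetilde{\mathbf E_h}=\{\mathbf E_h\}_x$, $\widetilde{\mathbf B_h}=\{\mathbf B_h\}_x$; the alternating flux is $\widetilde{\mathbf E_h}=\mathbf E_h^+$, $\widetilde{\mathbf B_h}=\mathbf B_h^-$, or $\widetilde{\mathbf E_h}=\mathbf E_h^-$, $\widetilde{\mathbf B_h}=\mathbf B_h^+$. *)

theory Defs
  imports "HOL-Analysis.Analysis"
begin

section \<open>Domains and meshes\<close>

definition Omega_x :: "real \<Rightarrow> (real^3) set" where
  "Omega_x L = {x. \<forall>i. - L < x $ i \<and> x $ i \<le> L}"

definition Omega_xi :: "real \<Rightarrow> (real^3) set" where
  "Omega_xi L = cbox (vec (- L)) (vec L)"

definition rotated_box :: "(real^3) set \<Rightarrow> bool" where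
  "rotated_box K \<longleftrightarrow>
    (\<exists>R (a::real^3) b. orthogonal_transformation R \<and> box a b \<noteq> {} \<and> K = R ` cbox a b)"

definition mesh_element :: "(real^3) set \<Rightarrow> bool" where
  "mesh_element K \<longleftrightarrow> rotated_box K \<or> 3 simplex K"

text \<open>Elements are closed sets, so they cover the closure of the half-open periodic box.
  Hanging nodes are not excluded.\<close>

definition mesh :: "(real^3) set set \<Rightarrow> (real^3) set \<Rightarrow> bool" where
  "mesh T \<Omega> \<longleftrightarrow> finite T \<and> (\<forall>K\<in>T. mesh_element K) \<and>
    pairwise (\<lambda>K K'. interior K \<inter> interior K' = {}) T \<and> \<Union>T = closure \<Omega>"

definition product_mesh ::
    "(real^3) set set \<Rightarrow> (real^3) set set \<Rightarrow> ((real^3) \<times> (real^3)) set set" where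
  "product_mesh Tx T\<xi> = {Kx \<times> K\<xi> | Kx K\<xi>. Kx \<in> Tx \<and> K\<xi> \<in> T\<xi>}"


section \<open>Edges\<close>

definition period_lattice :: "real \<Rightarrow> (real^3) set" where
  "period_lattice L = {s. \<forall>i. \<exists>m::int. s $ i = 2 * L * of_int m}"

text \<open>
  A triple \<open>(K, K', s)\<close> stands for the edge \<open>K \<inter> (K' + s)\<close>, with \<open>K\<close> in the role of
  \<open>K\<^sup>+\<close> and \<open>K'\<close> in the role of \<open>K\<^sup>-\<close>. The shift \<open>s\<close> expresses the periodic identification:
  it ranges over the period lattice in the \<open>x\<close>-space and is 0 in the \<open>\<xi>\<close>-space. An element may
  be its own periodic neighbour (\<open>K = K'\<close>, \<open>s \<noteq> 0\<close>). The triples \<open>(K, K', s)\<close> and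
  \<open>(K', K, -s)\<close> are the same edge with the signs exchanged; an edge set contains exactly one of
  them, i.e. it fixes (arbitrarily) the \<open>\<plusminus>\<close> labelling of each edge.
\<close>

type_synonym edge = "(real^3) set \<times> (real^3) set \<times> (real^3)"

fun edge_face :: "edge \<Rightarrow> (real^3) set" where
  "edge_face (K, K', s) = K \<inter> ((+) s ` K')"

definition labelled_edges :: "(real^3) set set \<Rightarrow> (real^3) set \<Rightarrow> edge set" where
  "labelled_edges T \<Lambda> =
    {(K, K', s). K \<in> T \<and> K' \<in> T \<and> s \<in> \<Lambda> \<and> (K \<noteq> K' \<or> s \<noteq> 0) \<and> aff_dim (edge_face (K, K', s)) = 2}"

definition edge_set :: "(real^3) set set \<Rightarrow> (real^3) set \<Rightarrow> edge set \<Rightarrow> bool" where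
  "edge_set T \<Lambda> \<E> \<longleftrightarrow> \<E> \<subseteq> labelled_edges T \<Lambda> \<and>
    (\<forall>(K, K', s) \<in> labelled_edges T \<Lambda>. ((K, K', s) \<in> \<E>) \<noteq> ((K', K, - s) \<in> \<E>))"

definition boundary_edges ::
    "(real^3) set set \<Rightarrow> (real^3) set \<Rightarrow> ((real^3) set \<times> (real^3) set) set" where
  "boundary_edges T \<Omega> = {(K, F). K \<in> T \<and> F facet_of K \<and> F \<subseteq> frontier \<Omega>}"

text \<open>Outward unit normal of a convex body \<open>K\<close> on a two-dimensional flat part \<open>F\<close> of its boundary.\<close>

definition outward_normal :: "(real^3) set \<Rightarrow> (real^3) set \<Rightarrow> real^3" where
  "outward_normal K F = (THE n. norm n = 1 \<and> (\<forall>x\<in>F. \<forall>y\<in>K. n \<bullet> y \<le> n \<bullet> x))"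

fun normal_plus :: "edge \<Rightarrow> real^3" where
  "normal_plus (K, K', s) = outward_normal K (edge_face (K, K', s))"

fun normal_minus :: "edge \<Rightarrow> real^3" where
  "normal_minus (K, K', s) = outward_normal ((+) s ` K') (edge_face (K, K', s))"


section \<open>Integrals over elements and edges\<close>

definition mesh_integral :: "'a::euclidean_space set set \<Rightarrow> ('a \<Rightarrow> 'b::{banach, second_countable_topology}) \<Rightarrow> 'b"
  where "mesh_integral T h = (\<Sum>K\<in>T. set_lebesgue_integral lebesgue K h)"

text \<open>Surface integral over a flat face: two-dimensional Lebesgue integral in an isometric
  parametrisation of the plane of the face.\<close>

definition flat_chart :: "(real^3) set \<Rightarrow> real^2 \<Rightarrow> real^3" where
  "flat_chart F = (SOME \<phi>. (\<forall>u v. dist (\<phi> u) (\<phi> v) = dist u v) \<and> F \<subseteq> range \<phi>)"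

definition face_integral :: "(real^3) set \<Rightarrow> (real^3 \<Rightarrow> real) \<Rightarrow> real" where
  "face_integral F h =
    set_lebesgue_integral lebesgue (flat_chart F -` F) (\<lambda>y. h (flat_chart F y))"


section \<open>Discrete spaces\<close>

definition poly_space :: "nat \<Rightarrow> ('a::euclidean_space \<Rightarrow> real) set" where
  "poly_space m = {p. \<exists>c. \<forall>x. p x =
     (\<Sum>a | a \<in> Basis \<rightarrow>\<^sub>E {..m} \<and> (\<Sum>b\<in>Basis. a b) \<le> m. c a * (\<Prod>b\<in>Basis. (x \<bullet> b) ^ a b))}"

definition square_integrable_on :: "'a::euclidean_space set \<Rightarrow> ('a \<Rightarrow> real) \<Rightarrow> bool" where
  "square_integrable_on \<Omega> g \<longleftrightarrow>
    g \<in> borel_measurable (lebesgue_on \<Omega>) \<and> integrable (lebesgue_on \<Omega>) (\<lambda>z. (g z)\<^sup>2)"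

text \<open>Discrete functions are represented by functions that are polynomial in the interior of each
  element; their values on the (null) skeleton of the mesh are immaterial.\<close>

definition dg_space :: "'a::euclidean_space set \<Rightarrow> 'a set set \<Rightarrow> nat \<Rightarrow> ('a \<Rightarrow> real) set" where
  "dg_space \<Omega> T m = {g. square_integrable_on \<Omega> g \<and>
     (\<forall>K\<in>T. \<exists>p\<in>poly_space m. \<forall>z\<in>interior K. g z = p z)}"

definition G_h :: "real \<Rightarrow> real \<Rightarrow> (real^3) set set \<Rightarrow> (real^3) set set \<Rightarrow> nat
    \<Rightarrow> ((real^3) \<times> (real^3) \<Rightarrow> real) set" where
  "G_h Lx L\<xi> Tx T\<xi> k = dg_space (Omega_x Lx \<times> Omega_xi L\<xi>) (product_mesh Tx T\<xi>) k"

definition U_h :: "real \<Rightarrow> (real^3) set set \<Rightarrow> nat \<Rightarrow> (real^3 \<Rightarrow> real^3) set" where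
  "U_h Lx Tx r = {U. \<forall>i. (\<lambda>x. U x $ i) \<in> dg_space (Omega_x Lx) Tx r}"


section \<open>Traces, jumps and averages\<close>

definition elem_trace :: "(real^3) set \<Rightarrow> (real^3 \<Rightarrow> 'b::t2_space) \<Rightarrow> real^3 \<Rightarrow> 'b" where
  "elem_trace K g x = Lim (at x within interior K) g"

fun trace_plus :: "edge \<Rightarrow> (real^3 \<Rightarrow> 'b::t2_space) \<Rightarrow> real^3 \<Rightarrow> 'b" where
  "trace_plus (K, K', s) g x = elem_trace K g x"

fun trace_minus :: "edge \<Rightarrow> (real^3 \<Rightarrow> 'b::t2_space) \<Rightarrow> real^3 \<Rightarrow> 'b" where
  "trace_minus (K, K', s) g x = elem_trace K' g (x - s)"

definition jump :: "edge \<Rightarrow> (real^3 \<Rightarrow> real) \<Rightarrow> real^3 \<Rightarrow> real^3" where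
  "jump e g x = trace_plus e g x *\<^sub>R normal_plus e + trace_minus e g x *\<^sub>R normal_minus e"

definition tangential_jump :: "edge \<Rightarrow> (real^3 \<Rightarrow> real^3) \<Rightarrow> real^3 \<Rightarrow> real^3" where
  "tangential_jump e U x =
    cross3 (trace_plus e U x) (normal_plus e) + cross3 (trace_minus e U x) (normal_minus e)"

definition average :: "edge \<Rightarrow> (real^3 \<Rightarrow> 'b::real_normed_vector) \<Rightarrow> real^3 \<Rightarrow> 'b" where
  "average e g x = (1/2) *\<^sub>R (trace_plus e g x + trace_minus e g x)"

fun boundary_jump :: "(real^3) set \<times> (real^3) set \<Rightarrow> (real^3 \<Rightarrow> real) \<Rightarrow> real^3 \<Rightarrow> real^3" where
  "boundary_jump (K, F) g \<xi> = elem_trace K g \<xi> *\<^sub>R outward_normal K F"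

fun boundary_average :: "(real^3) set \<times> (real^3) set \<Rightarrow> (real^3 \<Rightarrow> 'b::real_normed_vector) \<Rightarrow> real^3 \<Rightarrow> 'b"
  where "boundary_average (K, F) g \<xi> = (1/2) *\<^sub>R elem_trace K g \<xi>"


section \<open>The semi-discrete scheme\<close>

definition grad :: "(real^3 \<Rightarrow> real) \<Rightarrow> real^3 \<Rightarrow> real^3" where
  "grad g x = (THE D. GDERIV g x :> D)"

definition curl :: "(real^3 \<Rightarrow> real^3) \<Rightarrow> real^3 \<Rightarrow> real^3" where
  "curl U x = (let J = jacobian U (at x) in
     vector [J $ 3 $ 2 - J $ 2 $ 3, J $ 1 $ 3 - J $ 3 $ 1, J $ 2 $ 1 - J $ 1 $ 2])"

definition lorentz :: "(real^3 \<Rightarrow> real^3) \<Rightarrow> (real^3 \<Rightarrow> real^3) \<Rightarrow> real^3 \<Rightarrow> real^3 \<Rightarrow> real^3" where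
  "lorentz E B x \<xi> = E x + cross3 \<xi> (B x)"

definition flux_x ::
    "edge \<Rightarrow> ((real^3) \<times> (real^3) \<Rightarrow> real) \<Rightarrow> real^3 \<Rightarrow> real^3 \<Rightarrow> real^3" where
  "flux_x e f x \<xi> = average e (\<lambda>y. f (y, \<xi>) *\<^sub>R \<xi>) x
     + (\<bar>\<xi> \<bullet> normal_plus e\<bar> / 2) *\<^sub>R jump e (\<lambda>y. f (y, \<xi>)) x"

definition flux_xi ::
    "edge \<Rightarrow> ((real^3) \<times> (real^3) \<Rightarrow> real) \<Rightarrow> (real^3 \<Rightarrow> real^3) \<Rightarrow> (real^3 \<Rightarrow> real^3)
      \<Rightarrow> real^3 \<Rightarrow> real^3 \<Rightarrow> real^3" where
  "flux_xi e f E B x \<xi> = average e (\<lambda>\<eta>. f (x, \<eta>) *\<^sub>R lorentz E B x \<eta>) \<xi>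
     + (\<bar>lorentz E B x \<xi> \<bullet> normal_plus e\<bar> / 2) *\<^sub>R jump e (\<lambda>\<eta>. f (x, \<eta>)) \<xi>"

fun boundary_flux_xi ::
    "(real^3) set \<times> (real^3) set \<Rightarrow> ((real^3) \<times> (real^3) \<Rightarrow> real) \<Rightarrow> (real^3 \<Rightarrow> real^3)
      \<Rightarrow> (real^3 \<Rightarrow> real^3) \<Rightarrow> real^3 \<Rightarrow> real^3 \<Rightarrow> real^3" where
  "boundary_flux_xi (K, F) f E B x \<xi> =
     boundary_average (K, F) (\<lambda>\<eta>. f (x, \<eta>) *\<^sub>R lorentz E B x \<eta>) \<xi>
     + (\<bar>lorentz E B x \<xi> \<bullet> outward_normal K F\<bar> / 2) *\<^sub>R boundary_jump (K, F) (\<lambda>\<eta>. f (x, \<eta>)) \<xi>"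

text \<open>\<open>ft\<close> is the time derivative of \<open>f\<close>.\<close>

definition a_h ::
    "real \<Rightarrow> (real^3) set set \<Rightarrow> (real^3) set set \<Rightarrow> edge set \<Rightarrow> edge set
      \<Rightarrow> ((real^3) \<times> (real^3) \<Rightarrow> real) \<Rightarrow> ((real^3) \<times> (real^3) \<Rightarrow> real)
      \<Rightarrow> (real^3 \<Rightarrow> real^3) \<Rightarrow> (real^3 \<Rightarrow> real^3) \<Rightarrow> ((real^3) \<times> (real^3) \<Rightarrow> real) \<Rightarrow> real" where
  "a_h L\<xi> Tx T\<xi> \<E>x \<E>\<xi> ft f E B g =
     mesh_integral (product_mesh Tx T\<xi>) (\<lambda>z. ft z * g z)
     - mesh_integral (product_mesh Tx T\<xi>)
         (\<lambda>(x, \<xi>). f (x, \<xi>) * (\<xi> \<bullet> grad (\<lambda>y. g (y, \<xi>)) x))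
     + mesh_integral T\<xi> (\<lambda>\<xi>. \<Sum>e\<in>\<E>x. face_integral (edge_face e)
         (\<lambda>x. flux_x e f x \<xi> \<bullet> jump e (\<lambda>y. g (y, \<xi>)) x))
     - mesh_integral (product_mesh Tx T\<xi>)
         (\<lambda>(x, \<xi>). f (x, \<xi>) * (lorentz E B x \<xi> \<bullet> grad (\<lambda>\<eta>. g (x, \<eta>)) \<xi>))
     + mesh_integral Tx (\<lambda>x.
         (\<Sum>e\<in>\<E>\<xi>. face_integral (edge_face e)
           (\<lambda>\<xi>. flux_xi e f E B x \<xi> \<bullet> jump e (\<lambda>\<eta>. g (x, \<eta>)) \<xi>))
         + (\<Sum>e\<in>boundary_edges T\<xi> (Omega_xi L\<xi>). face_integral (snd e)
           (\<lambda>\<xi>. boundary_flux_xi e f E B x \<xi> \<bullet> boundary_jump e (\<lambda>\<eta>. g (x, \<eta>)) \<xi>)))"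

datatype maxwell_flux = Central | Alternating_Eplus_Bminus | Alternating_Eminus_Bplus

fun flux_E :: "maxwell_flux \<Rightarrow> edge \<Rightarrow> (real^3 \<Rightarrow> real^3) \<Rightarrow> real^3 \<Rightarrow> real^3" where
  "flux_E Central e E x = average e E x"
| "flux_E Alternating_Eplus_Bminus e E x = trace_plus e E x"
| "flux_E Alternating_Eminus_Bplus e E x = trace_minus e E x"

fun flux_B :: "maxwell_flux \<Rightarrow> edge \<Rightarrow> (real^3 \<Rightarrow> real^3) \<Rightarrow> real^3 \<Rightarrow> real^3" where
  "flux_B Central e B x = average e B x"
| "flux_B Alternating_Eplus_Bminus e B x = trace_minus e B x"
| "flux_B Alternating_Eminus_Bplus e B x = trace_plus e B x"

definition b_h ::
    "maxwell_flux \<Rightarrow> (real^3) set set \<Rightarrow> edge set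
      \<Rightarrow> (real^3 \<Rightarrow> real^3) \<Rightarrow> (real^3 \<Rightarrow> real^3) \<Rightarrow> (real^3 \<Rightarrow> real^3) \<Rightarrow> (real^3 \<Rightarrow> real^3)
      \<Rightarrow> (real^3 \<Rightarrow> real^3) \<Rightarrow> (real^3 \<Rightarrow> real^3) \<Rightarrow> real" where
  "b_h flux Tx \<E>x Et Bt E B U V =
     mesh_integral Tx (\<lambda>x. Et x \<bullet> U x)
     - mesh_integral Tx (\<lambda>x. B x \<bullet> curl U x)
     - (\<Sum>e\<in>\<E>x. face_integral (edge_face e) (\<lambda>x. flux_B flux e B x \<bullet> tangential_jump e U x))
     + mesh_integral Tx (\<lambda>x. Bt x \<bullet> V x)
     + mesh_integral Tx (\<lambda>x. E x \<bullet> curl V x)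
     + (\<Sum>e\<in>\<E>x. face_integral (edge_face e) (\<lambda>x. flux_E flux e E x \<bullet> tangential_jump e V x))"

definition current :: "(real^3) set set \<Rightarrow> ((real^3) \<times> (real^3) \<Rightarrow> real) \<Rightarrow> real^3 \<Rightarrow> real^3" where
  "current T\<xi> f x = mesh_integral T\<xi> (\<lambda>\<xi>. f (x, \<xi>) *\<^sub>R \<xi>)"

definition l_h :: "(real^3) set set \<Rightarrow> (real^3 \<Rightarrow> real^3) \<Rightarrow> (real^3 \<Rightarrow> real^3) \<Rightarrow> real" where
  "l_h Tx J U = - mesh_integral Tx (\<lambda>x. J x \<bullet> U x)"

text \<open>Time derivatives are taken pointwise within the time interval \<open>I\<close> (one-sided at its end
  points); since the discrete spaces are finite-dimensional, pointwise differentiability inside the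
  elements is differentiability as a curve in the discrete space.\<close>

definition time_deriv :: "real set \<Rightarrow> (real \<Rightarrow> 'a \<Rightarrow> 'b::real_normed_vector) \<Rightarrow> real \<Rightarrow> 'a \<Rightarrow> 'b" where
  "time_deriv I u t z = vector_derivative (\<lambda>s. u s z) (at t within I)"

definition time_differentiable ::
    "real set \<Rightarrow> 'a::topological_space set set \<Rightarrow> (real \<Rightarrow> 'a \<Rightarrow> 'b::real_normed_vector) \<Rightarrow> bool" where
  "time_differentiable I T u \<longleftrightarrow>
    (\<forall>K\<in>T. \<forall>z\<in>interior K. \<forall>t\<in>I. (\<lambda>s. u s z) differentiable (at t within I))"

definition dg_solution ::
    "real \<Rightarrow> real \<Rightarrow> (real^3) set set \<Rightarrow> (real^3) set set \<Rightarrow> edge set \<Rightarrow> edge set \<Rightarrow> nat \<Rightarrow> nat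
      \<Rightarrow> maxwell_flux \<Rightarrow> real set \<Rightarrow> (real \<Rightarrow> (real^3) \<times> (real^3) \<Rightarrow> real)
      \<Rightarrow> (real \<Rightarrow> real^3 \<Rightarrow> real^3) \<Rightarrow> (real \<Rightarrow> real^3 \<Rightarrow> real^3) \<Rightarrow> bool" where
  "dg_solution Lx L\<xi> Tx T\<xi> \<E>x \<E>\<xi> k r flux I f E B \<longleftrightarrow>
     time_differentiable I (product_mesh Tx T\<xi>) f \<and>
     time_differentiable I Tx E \<and> time_differentiable I Tx B \<and>
     (\<forall>t\<in>I. f t \<in> G_h Lx L\<xi> Tx T\<xi> k \<and> E t \<in> U_h Lx Tx r \<and> B t \<in> U_h Lx Tx r \<and>
        (\<forall>g\<in>G_h Lx L\<xi> Tx T\<xi> k.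
           a_h L\<xi> Tx T\<xi> \<E>x \<E>\<xi> (time_deriv I f t) (f t) (E t) (B t) g = 0) \<and>
        (\<forall>U\<in>U_h Lx Tx r. \<forall>V\<in>U_h Lx Tx r.
           b_h flux Tx \<E>x (time_deriv I E t) (time_deriv I B t) (E t) (B t) U V
           = l_h Tx (current T\<xi> (f t)) U))"


section \<open>Energy and boundary term\<close>

definition energy ::
    "(real^3) set set \<Rightarrow> (real^3) set set \<Rightarrow> ((real^3) \<times> (real^3) \<Rightarrow> real)
      \<Rightarrow> (real^3 \<Rightarrow> real^3) \<Rightarrow> (real^3 \<Rightarrow> real^3) \<Rightarrow> real" where
  "energy Tx T\<xi> f E B =
     mesh_integral (product_mesh Tx T\<xi>) (\<lambda>(x, \<xi>). f (x, \<xi>) * (norm \<xi>)\<^sup>2)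
     + mesh_integral Tx (\<lambda>x. (norm (E x))\<^sup>2 + (norm (B x))\<^sup>2)"

definition Theta_h3 ::
    "real \<Rightarrow> (real^3) set set \<Rightarrow> (real^3) set set \<Rightarrow> ((real^3) \<times> (real^3) \<Rightarrow> real)
      \<Rightarrow> (real^3 \<Rightarrow> real^3) \<Rightarrow> (real^3 \<Rightarrow> real^3) \<Rightarrow> real" where
  "Theta_h3 L\<xi> Tx T\<xi> f E B =
     mesh_integral Tx (\<lambda>x. \<Sum>(K, F)\<in>boundary_edges T\<xi> (Omega_xi L\<xi>). face_integral F
       (\<lambda>\<xi>. elem_trace K (\<lambda>\<eta>. f (x, \<eta>)) \<xi> * (norm \<xi>)\<^sup>2
            * max (lorentz E B x \<xi> \<bullet> outward_normal K F) 0))"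

end

theory Submission
  imports Defs
begin

text \<open>
  Since \<open>k \<ge> 2\<close>, the function \<open>|\<xi>|\<^sup>2\<close> is an admissible test function in the Vlasov part; it has no
  jumps and no \<open>x\<close>-gradient, and \<open>(\<xi> \<times> B) \<bullet> \<xi> = 0\<close>, so what remains is the work term
  \<open>2 \<integral> J \<bullet> E\<close> and the outflow \<open>\<Theta>\<close>. Testing the Maxwell part with the solution itself yields
  \<open>- \<integral> J \<bullet> E\<close>, because the curl terms and the flux terms cancel by the divergence theorem for
  \<open>E \<times> B\<close>, summed over the elements.

  The divergence theorem is not proved element by element, which would require matching the facets of
  the elements (with hanging nodes) to edges. Instead all elements \<open>K\<close> are translated by \<open>h v\<close>, and
  the change of the sum of the integrals of \<open>p K\<close> over \<open>K\<close> is written, by tiling twice, as a sum of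
  integrals of \<open>p K - p K'\<close> over the overlaps \<open>(K + h v) \<inter> K'\<close>. Divided by \<open>h\<close>, an overlap integral
  tends to \<open>max (n \<bullet> v) 0\<close> times the integral over the face \<open>K \<inter> K'\<close>, and to 0 if that face is
  degenerate.
\<close>

section \<open>Convex bodies and integrals over them\<close>

text \<open>The discrete functions are prescribed only in the interiors of the elements, and their
  time derivatives only pointwise there. Integrands are therefore exchanged for continuous ones
  built from polynomials, and differentiation under the integral sign is replaced by interpolation:
  on an element a polynomial of bounded degree is a fixed combination of its values at finitely many
  interior nodes, so the energy becomes a finite sum in these node values with constant weights. The
  translation argument is confined to physical space. There periodicity leaves no outer boundary,
  and steps no longer than the period keep all translates within the 27 neighbouring copies of the
  mesh. In the velocity variable nothing is integrated by parts, since the gradient 2 \<xi> of the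
  test function is inserted explicitly. The limit factor max (n . v) 0 is one-sided because a moving
  element enters its neighbour only when it moves towards it. Each edge is met in both orientations;
  normal and difference change sign together, and max a 0 - max (- a) 0 = a restores the full
  flux.\<close>

definition body :: "'a::euclidean_space set \<Rightarrow> bool" where
  "body K \<longleftrightarrow> convex K \<and> compact K \<and> interior K \<noteq> {}"

lemma body_closed: "body K \<Longrightarrow> closed K"
  by (simp add: body_def compact_imp_closed)

lemma body_translation: "body K \<Longrightarrow> body ((+) s ` K)"
  by (auto simp: body_def convex_translation compact_translation interior_translation)

lemma body_Times: "body K \<Longrightarrow> body K' \<Longrightarrow> body (K \<times> K')"
  by (simp add: body_def convex_Times compact_Times interior_Times)

lemma body_closure_interior: "body K \<Longrightarrow> closure (interior K) = K"
  by (simp add: body_def convex_closure_interior compact_imp_closed)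

lemma mesh_element_body:
  assumes "mesh_element K" shows "body K"
  using assms unfolding mesh_element_def
proof
  assume "rotated_box K"
  then obtain R and a b :: "real^3" where R: "orthogonal_transformation R"
    and ab: "box a b \<noteq> {}" and K: "K = R ` cbox a b"
    unfolding rotated_box_def by blast
  have "linear R" "bij R"
    using R by (auto simp: orthogonal_transformation_linear orthogonal_transformation_bij)
  then show ?thesis
    using ab unfolding body_def K
    by (simp add: convex_linear_image interior_bijective_linear_image compact_continuous_image
        linear_continuous_on linear_conv_bounded_linear)
next
  assume s: "3 simplex K"
  \<comment> \<open>A nonempty convex set has nonempty relative interior, and full affine dimension
    makes this the interior.\<close>
  then have "aff_dim K = int (DIM(real^3))"
    by (simp add: aff_dim_simplex)
  moreover have "K \<noteq> {}"
    using s by auto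
  ultimately have "interior K \<noteq> {}"
    using convex_simplex[OF s] rel_interior_eq_empty[of K] rel_interior_interior[of K]
      aff_dim_eq_full[of K] by simp
  then show ?thesis
    using s by (simp add: body_def convex_simplex compact_simplex)
qed

lemma body_negligible_frontier: "body K \<Longrightarrow> negligible (frontier K)"
  by (simp add: body_def negligible_convex_frontier)

text \<open>By completeness of Lebesgue measure \<open>f\<close> and \<open>g\<close> are measurable together, and the Bochner
  integral of a non-measurable function is 0.\<close>

lemma integral_lebesgue_cong_AE:
  fixes f g :: "'a::euclidean_space \<Rightarrow> 'b::euclidean_space"
  assumes "AE x in lebesgue. f x = g x"
  shows "integral\<^sup>L lebesgue f = integral\<^sup>L lebesgue g"
proof (cases "f \<in> borel_measurable lebesgue")
  case True
  then have "g \<in> borel_measurable lebesgue"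
    using assms borel_measurable_AE by blast
  with True show ?thesis by (rule integral_cong_AE[OF _ _ assms])
next
  case False
  have "AE x in lebesgue. g x = f x"
    using assms by eventually_elim simp
  then have "g \<notin> borel_measurable lebesgue"
    using False borel_measurable_AE by blast
  with False show ?thesis
    using borel_measurable_integrable[of lebesgue f] borel_measurable_integrable[of lebesgue g]
      not_integrable_integral_eq[of lebesgue f] not_integrable_integral_eq[of lebesgue g] by argo
qed

text \<open>The integrands can differ only on the frontier, which is null for a convex set.
  Measurability is not assumed, so integrands with arbitrary values on the mesh skeleton can be
  replaced by polynomial expressions.\<close>

lemma body_integral_cong:
  fixes f g :: "'a::euclidean_space \<Rightarrow> 'b::euclidean_space"
  assumes K: "body K" and eq: "\<And>x. x \<in> interior K \<Longrightarrow> f x = g x"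
  shows "set_lebesgue_integral lebesgue K f = set_lebesgue_integral lebesgue K g"
  unfolding set_lebesgue_integral_def
proof (rule integral_lebesgue_cong_AE)
  have "{x. indicator K x *\<^sub>R f x \<noteq> indicator K x *\<^sub>R g x} \<subseteq> frontier K"
    using eq body_closed[OF K] by (auto simp: frontier_def indicator_def split: if_splits)
  then show "AE x in lebesgue. indicator K x *\<^sub>R f x = indicator K x *\<^sub>R g x"
    using body_negligible_frontier[OF K] eventually_ae_filter_negligible by blast
qed

lemma mesh_integral_cong:
  fixes f g :: "'a::euclidean_space \<Rightarrow> 'b::euclidean_space"
  assumes "\<And>K. K \<in> T \<Longrightarrow> body K" and "\<And>K x. K \<in> T \<Longrightarrow> x \<in> interior K \<Longrightarrow> f x = g x"
  shows "mesh_integral T f = mesh_integral T g"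
  unfolding mesh_integral_def by (intro sum.cong refl body_integral_cong) (use assms in auto)

text \<open>The scheme integrates with \<open>lebesgue\<close>, whereas Fubini and the changes of
  variables are carried out for \<open>lborel\<close>; this is the passage between them.\<close>

lemma set_integral_lebesgue_eq_lborel:
  fixes f :: "'a::euclidean_space \<Rightarrow> 'b::euclidean_space"
  assumes "compact K" "continuous_on K f"
  shows "set_lebesgue_integral lebesgue K f = set_lebesgue_integral lborel K f"
  unfolding set_lebesgue_integral_def
  using borel_integrable_compact[OF assms] by (intro integral_completion) auto

lemma compact_set_integrable:
  fixes f :: "'a::euclidean_space \<Rightarrow> 'b::euclidean_space"
  assumes "compact K" "continuous_on K f"
  shows "set_integrable lebesgue K f" "set_integrable lborel K f"
  using borel_integrable_compact[OF assms] unfolding set_integrable_def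
  by (auto simp: integrable_completion)

lemma set_integrable_body_cong:
  fixes f g :: "'a::euclidean_space \<Rightarrow> 'b::euclidean_space"
  assumes K: "body K" and eq: "\<And>x. x \<in> interior K \<Longrightarrow> f x = g x"
    and g: "continuous_on UNIV g"
  shows "set_integrable lebesgue K f"
proof -
  have g': "integrable lebesgue (\<lambda>x. indicator K x *\<^sub>R g x)"
    using compact_set_integrable(1)[of K g] K continuous_on_subset[OF g]
    by (auto simp: set_integrable_def body_def)
  have "{x. indicator K x *\<^sub>R g x \<noteq> indicator K x *\<^sub>R f x} \<subseteq> frontier K"
    using eq body_closed[OF K] by (auto simp: frontier_def indicator_def split: if_splits)
  then have ae: "AE x in lebesgue. indicator K x *\<^sub>R g x = indicator K x *\<^sub>R f x"
    using body_negligible_frontier[OF K] eventually_ae_filter_negligible by blast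
  then have "(\<lambda>x. indicator K x *\<^sub>R f x) \<in> borel_measurable lebesgue"
    by (rule borel_measurable_AE[OF borel_measurable_integrable[OF g']])
  with g' show ?thesis
    unfolding set_integrable_def by (rule integrable_cong_AE_imp) (use ae in eventually_elim, simp)
qed

lemma elem_trace_eq:
  fixes g :: "real^3 \<Rightarrow> 'b::t2_space"
  assumes K: "body K" and x: "x \<in> K" and eq: "\<And>y. y \<in> interior K \<Longrightarrow> g y = p y"
    and p: "continuous_on UNIV p"
  shows "elem_trace K g x = p x"
  unfolding elem_trace_def
proof (rule tendsto_Lim)
  \<comment> \<open>The limit in \<open>elem_trace\<close> ignores the value at x itself, so it is
    unique only at limit points of the interior. A boundary point is one because a body is the
    closure of its interior.\<close>
  have "x islimpt interior K"
  proof (cases "x \<in> interior K")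
    case True
    then show ?thesis by (simp add: interior_limit_point interior_interior open_interior)
  next
    case False
    then show ?thesis
      using x body_closure_interior[OF K] by (auto simp: closure_def)
  qed
  then show "\<not> trivial_limit (at x within interior K)"
    by (simp add: trivial_limit_within)
  have "(p \<longlongrightarrow> p x) (at x within interior K)"
    using p by (auto simp: continuous_on_def intro: tendsto_within_subset)
  then show "(g \<longlongrightarrow> p x) (at x within interior K)"
    by (rule tendsto_cong[THEN iffD1, rotated]) (auto simp: eventually_at_filter eq)
qed

lemma mesh_body: "mesh T \<Omega> \<Longrightarrow> K \<in> T \<Longrightarrow> body K"
  by (simp add: mesh_def mesh_element_body)

section \<open>Polynomials\<close>

text \<open>The second conjunct supplies the continuity of directional derivatives that the
  divergence theorem requires.\<close>

lemma real_polynomial_function_derivative: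
  assumes "real_polynomial_function (p :: 'a::real_normed_vector \<Rightarrow> real)"
  shows "\<exists>p'. (\<forall>x. (p has_derivative p' x) (at x)) \<and>
           (\<forall>v. real_polynomial_function (\<lambda>x. p' x v))"
  using assms
proof (induction p rule: real_polynomial_function.induct)
  case (linear f)
  then show ?case
    by (intro exI[of _ "\<lambda>x. f"]) (auto simp: bounded_linear_imp_has_derivative)
next
  case (const c)
  then show ?case by (intro exI[of _ "\<lambda>x v. 0"]) auto
next
  case (add f g)
  then obtain f' g' where f': "\<forall>x. (f has_derivative f' x) (at x)"
      "\<forall>v. real_polynomial_function (\<lambda>x. f' x v)"
    and g': "\<forall>x. (g has_derivative g' x) (at x)" "\<forall>v. real_polynomial_function (\<lambda>x. g' x v)"
    by blast
  show ?case
    by (intro exI[of _ "\<lambda>x v. f' x v + g' x v"] conjI allI has_derivative_add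
        real_polynomial_function.intros(3)) (use f' g' in auto)
next
  case (mult f g)
  then obtain f' g' where f': "\<forall>x. (f has_derivative f' x) (at x)"
      "\<forall>v. real_polynomial_function (\<lambda>x. f' x v)"
    and g': "\<forall>x. (g has_derivative g' x) (at x)" "\<forall>v. real_polynomial_function (\<lambda>x. g' x v)"
    by blast
  show ?case
    by (intro exI[of _ "\<lambda>x v. f x * g' x v + f' x v * g x"] conjI allI has_derivative_mult
        real_polynomial_function.intros(3,4)) (use f' g' mult.hyps in auto)
qed

lemma continuous_on_real_polynomial_function:
  "real_polynomial_function p \<Longrightarrow> continuous_on S p"
  by (simp add: continuous_at_imp_continuous_on continuous_real_polymonial_function)

lemma real_polynomial_function_inner_left: "real_polynomial_function (\<lambda>x. x \<bullet> b)"
  by (simp add: bounded_linear_inner_left real_polynomial_function.intros(1))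

section \<open>Polynomials of bounded total degree and their monomials\<close>

definition mult_indices :: "nat \<Rightarrow> ('a::euclidean_space \<Rightarrow> nat) set" where
  "mult_indices m = {a. a \<in> Basis \<rightarrow>\<^sub>E {..m} \<and> (\<Sum>b\<in>Basis. a b) \<le> m}"

definition monom_fun :: "('a::euclidean_space \<Rightarrow> nat) \<Rightarrow> 'a \<Rightarrow> real" where
  "monom_fun a x = (\<Prod>b\<in>Basis. (x \<bullet> b) ^ a b)"

lemma finite_mult_indices: "finite (mult_indices m)"
proof (rule finite_subset)
  show "mult_indices m \<subseteq> (Basis \<rightarrow>\<^sub>E {..m})" by (auto simp: mult_indices_def)
qed (simp add: finite_PiE)

lemma poly_space_eq: "poly_space m = {p. \<exists>c. \<forall>x. p x = (\<Sum>a\<in>mult_indices m. c a * monom_fun a x)}"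
  by (simp add: poly_space_def mult_indices_def monom_fun_def)

lemma real_polynomial_function_monom_fun: "real_polynomial_function (monom_fun a)"
  unfolding monom_fun_def[abs_def]
  by (intro real_polynomial_function_prod real_polynomial_function_power
      real_polynomial_function_inner_left) auto

lemma poly_space_real_polynomial_function:
  assumes "p \<in> poly_space m" shows "real_polynomial_function p"
proof -
  obtain c where "p = (\<lambda>x. \<Sum>a\<in>mult_indices m. c a * monom_fun a x)"
    using assms by (auto simp: poly_space_eq)
  then show ?thesis
    by (simp add: finite_mult_indices real_polynomial_function.intros real_polynomial_function_monom_fun
        real_polynomial_function_sum)
qed

lemma poly_space_add:
  assumes "p \<in> poly_space m" "q \<in> poly_space m"
  shows "(\<lambda>x. p x + q x) \<in> poly_space m"
proof -
  obtain c d where "\<forall>x. p x = (\<Sum>a\<in>mult_indices m. c a * monom_fun a x)"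
    "\<forall>x. q x = (\<Sum>a\<in>mult_indices m. d a * monom_fun a x)"
    using assms by (auto simp: poly_space_eq)
  then show ?thesis
    unfolding poly_space_eq
    by (intro CollectI exI[of _ "\<lambda>a. c a + d a"]) (simp add: distrib_right sum.distrib)
qed

lemma monom_fun_in_poly_space:
  assumes "a \<in> mult_indices m" shows "monom_fun a \<in> poly_space m"
  unfolding poly_space_eq
  by (intro CollectI exI[of _ "\<lambda>a'. if a' = a then 1 else 0"])
    (simp add: if_distrib[of "\<lambda>r. r * _"] assms finite_mult_indices cong: if_cong)

lemma poly_space_sum:
  assumes "finite A" "\<And>i. i \<in> A \<Longrightarrow> p i \<in> poly_space m"
  shows "(\<lambda>x. \<Sum>i\<in>A. p i x) \<in> poly_space m"
  using assms
proof (induction A rule: finite_induct)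
  case empty
  then show ?case by (auto simp: poly_space_eq intro: exI[of _ "\<lambda>_. 0"])
next
  case (insert i A)
  then show ?case by (simp add: poly_space_add)
qed

lemma inner_Basis_square_in_poly_space:
  assumes b: "b \<in> Basis" and m: "2 \<le> m"
  shows "(\<lambda>x. (x \<bullet> b)\<^sup>2) \<in> poly_space m"
proof -
  \<comment> \<open>Exponent 2 at \<open>b\<close> and 0 at the other basis vectors. Outside
    \<open>Basis\<close> the value has to be \<open>undefined\<close>, since
    \<open>mult_indices\<close> consists of extensional functions.\<close>
  define a where "a = (\<lambda>b'. if b' \<in> Basis then if b' = b then 2 else 0 else undefined :: nat)"
  have "(\<Sum>b'\<in>Basis. a b') = (\<Sum>b'\<in>Basis. if b' = b then 2 else 0)"
    by (intro sum.cong) (auto simp: a_def)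
  then have "a \<in> mult_indices m"
    using m b by (auto simp: mult_indices_def a_def PiE_def extensional_def)
  moreover have "monom_fun a = (\<lambda>x. (x \<bullet> b)\<^sup>2)"
  proof
    fix x :: 'a
    have "monom_fun a x = (\<Prod>b'\<in>Basis. if b' = b then (x \<bullet> b)\<^sup>2 else 1)"
      unfolding monom_fun_def by (intro prod.cong) (auto simp: a_def)
    then show "monom_fun a x = (x \<bullet> b)\<^sup>2" using b by simp
  qed
  ultimately show ?thesis using monom_fun_in_poly_space by metis
qed

text \<open>The requirement that k be at least 2 originates here: as a function on the product
  space, the squared velocity is a sum of squares of coordinates and has total degree two.\<close>

lemma norm_snd_square_in_poly_space:
  assumes "2 \<le> m"
  shows "(\<lambda>z :: 'a::euclidean_space \<times> 'b::euclidean_space. (norm (snd z))\<^sup>2) \<in> poly_space m"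
proof -
  have "(\<lambda>z :: 'a \<times> 'b. (norm (snd z))\<^sup>2) = (\<lambda>z. \<Sum>b\<in>Basis. (z \<bullet> (0, b))\<^sup>2)"
  proof
    fix z :: "'a \<times> 'b"
    have "(norm (snd z))\<^sup>2 = (\<Sum>b\<in>Basis. (snd z \<bullet> b) * (snd z \<bullet> b))"
      unfolding power2_norm_eq_inner by (rule euclidean_inner)
    then show "(norm (snd z))\<^sup>2 = (\<Sum>b\<in>Basis. (z \<bullet> (0, b))\<^sup>2)"
      by (simp add: inner_prod_def power2_eq_square)
  qed
  moreover have "(\<lambda>z :: 'a \<times> 'b. \<Sum>b\<in>Basis. (z \<bullet> (0, b))\<^sup>2) \<in> poly_space m"
    by (intro poly_space_sum inner_Basis_square_in_poly_space) (auto simp: assms Basis_prod_def)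
  ultimately show ?thesis by simp
qed

text \<open>Lagrange interpolation: adjoining one basis function \<open>\<phi> a\<close> either leaves the span unchanged
  on \<open>S\<close>, or the part of \<open>\<phi> a\<close> not reproduced by the old nodes is nonzero at a new node.\<close>

lemma finite_dim_interpolation:
  assumes "finite A" and "\<And>a. a \<in> A \<Longrightarrow> real_polynomial_function (\<phi> a)"
  shows "\<exists>n (z :: nat \<Rightarrow> 'a::euclidean_space) \<psi>.
    (\<forall>i<n. z i \<in> S \<and> real_polynomial_function (\<psi> i)) \<and>
    (\<forall>c. \<forall>x\<in>S. (\<Sum>a\<in>A. c a * \<phi> a x) = (\<Sum>i<n. (\<Sum>a\<in>A. c a * \<phi> a (z i)) * \<psi> i x))"
  using assms
proof (induction A rule: finite_induct)
  case empty
  then show ?case by (intro exI[of _ 0]) simp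
next
  case (insert a A)
  have "\<And>b. b \<in> A \<Longrightarrow> real_polynomial_function (\<phi> b)"
    using insert.prems by blast
  from insert.IH[OF this] obtain n and z :: "nat \<Rightarrow> 'a" and \<psi>
    where z: "\<And>i. i < n \<Longrightarrow> z i \<in> S" and \<psi>: "\<And>i. i < n \<Longrightarrow> real_polynomial_function (\<psi> i)"
    and eq: "\<And>c x. x \<in> S \<Longrightarrow>
      (\<Sum>a\<in>A. c a * \<phi> a x) = (\<Sum>i<n. (\<Sum>a\<in>A. c a * \<phi> a (z i)) * \<psi> i x)"
    by blast
  define F where "F c x = (\<Sum>a\<in>insert a A. c a * \<phi> a x)" for c :: "'b \<Rightarrow> real" and x
  \<comment> \<open>The part of \<open>\<phi> a\<close> that the old nodes fail to
    reproduce.\<close>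
  define r where "r x = \<phi> a x - (\<Sum>i<n. \<phi> a (z i) * \<psi> i x)" for x
  have r: "real_polynomial_function r"
    unfolding r_def[abs_def] using insert.prems \<psi>
    by (intro real_polynomial_function_diff real_polynomial_function_sum
        real_polynomial_function.intros(2,4)) auto
  have F: "F c x = c a * r x + (\<Sum>i<n. F c (z i) * \<psi> i x)" if "x \<in> S" for c x
  proof -
    have "F c y = c a * \<phi> a y + (\<Sum>a\<in>A. c a * \<phi> a y)" for y
      using insert.hyps by (simp add: F_def)
    then show ?thesis
      using eq[OF that, of c]
      by (simp add: r_def algebra_simps sum.distrib sum_distrib_left)
  qed
  show ?case
  proof (cases "\<exists>w\<in>S. r w \<noteq> 0")
    case False
    then show ?thesis
      using F z \<psi> unfolding F_def[symmetric]
      by (intro exI[of _ n] exI[of _ z] exI[of _ \<psi>]) simp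
  next
    case True
    then obtain w where w: "w \<in> S" "r w \<noteq> 0" by blast
    define z' where "z' = z(n := w)"
    \<comment> \<open>The new function \<open>r x / r w\<close> equals 1 at the new node, and the
      old ones are corrected by a multiple of it so that they vanish there.\<close>
    define \<psi>' where "\<psi>' i x = (if i = n then r x / r w else \<psi> i x - \<psi> i w * (r x / r w))" for i x
    have "F c x = (\<Sum>i<Suc n. F c (z' i) * \<psi>' i x)" if x: "x \<in> S" for c x
    proof -
      have "(\<Sum>i<Suc n. F c (z' i) * \<psi>' i x)
          = (\<Sum>i<n. F c (z i) * (\<psi> i x - \<psi> i w * (r x / r w))) + F c w * (r x / r w)"
        by (simp add: z'_def \<psi>'_def)
      also have "\<dots> = (\<Sum>i<n. F c (z i) * \<psi> i x)
          + (F c w - (\<Sum>i<n. F c (z i) * \<psi> i w)) * (r x / r w)"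
        by (simp add: algebra_simps sum_subtractf sum_distrib_left sum_distrib_right sum_divide_distrib)
      also have "F c w - (\<Sum>i<n. F c (z i) * \<psi> i w) = c a * r w"
        using F[OF w(1), of c] by simp
      finally show ?thesis
        using F[OF x, of c] w(2) by simp
    qed
    moreover have "real_polynomial_function (\<psi>' i)" if "i < Suc n" for i
    proof -
      have q: "real_polynomial_function (\<lambda>x. r x / r w)"
        by (rule real_polynomial_function_divide[OF r])
      moreover have "real_polynomial_function (\<lambda>x. \<psi> i x - \<psi> i w * (r x / r w))" if "i < n"
        by (intro real_polynomial_function_diff \<psi> that real_polynomial_function.intros(2,4) q)
      ultimately show ?thesis
        using that unfolding \<psi>'_def[abs_def] by (cases "i = n") (simp_all del: times_divide_eq_right)
    qed
    moreover have "z' i \<in> S" if "i < Suc n" for i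
      using that z w by (simp add: z'_def)
    ultimately show ?thesis
      unfolding F_def[symmetric] by (intro exI[of _ "Suc n"] exI[of _ z'] exI[of _ \<psi>']) blast
  qed
qed

text \<open>Neither the nodes nor the functions \<open>\<psi> i\<close> depend on p. A polynomial
  that varies in time is thus a fixed combination of its values at fixed points of S, and knowledge
  at finitely many points controls it on all of S.\<close>

lemma poly_space_interpolation:
  fixes S :: "'a::euclidean_space set"
  obtains n and z :: "nat \<Rightarrow> 'a" and \<psi>
  where "\<And>i. i < n \<Longrightarrow> z i \<in> S" and "\<And>i. i < n \<Longrightarrow> real_polynomial_function (\<psi> i)"
    and "\<And>p x. p \<in> poly_space m \<Longrightarrow> x \<in> S \<Longrightarrow> p x = (\<Sum>i<n. p (z i) * \<psi> i x)"
proof -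
  obtain n and z :: "nat \<Rightarrow> 'a" and \<psi>
    where *: "\<forall>i<n. z i \<in> S \<and> real_polynomial_function (\<psi> i)"
      "\<forall>c. \<forall>x\<in>S. (\<Sum>a\<in>mult_indices m. c a * monom_fun a x)
        = (\<Sum>i<n. (\<Sum>a\<in>mult_indices m. c a * monom_fun a (z i)) * \<psi> i x)"
    using finite_dim_interpolation[of "mult_indices m" monom_fun S]
    by (auto simp: finite_mult_indices real_polynomial_function_monom_fun)
  show ?thesis
  proof (rule that[of n z \<psi>])
    show "p x = (\<Sum>i<n. p (z i) * \<psi> i x)" if p: "p \<in> poly_space m" and x: "x \<in> S" for p x
    proof -
      obtain c where "\<forall>x. p x = (\<Sum>a\<in>mult_indices m. c a * monom_fun a x)"
        using p by (auto simp: poly_space_eq)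
      then show ?thesis using *(2) x by simp
    qed
  qed (use *(1) in auto)
qed

section \<open>Charts and normals of planes\<close>

text \<open>\<open>flat_chart\<close> is an arbitrary choice, so the limits are proved for every
  isometric chart of the separating plane. This also covers contacts of lower dimension, where the
  range of \<open>flat_chart\<close> may be a different plane.\<close>

definition plane_chart :: "(real^2 \<Rightarrow> real^3) \<Rightarrow> real^3 \<Rightarrow> real \<Rightarrow> bool" where
  "plane_chart \<rho> n b \<longleftrightarrow> (\<forall>u v. dist (\<rho> u) (\<rho> v) = dist u v) \<and> range \<rho> = {x. n \<bullet> x = b}"

text \<open>An isometry that fixes the origin preserves inner products by polarisation. Expanding
  the squared norm of the defect of additivity or homogeneity then gives zero.\<close>

lemma isometry_linear_part:
  fixes \<rho> :: "'a::real_inner \<Rightarrow> 'b::real_inner"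
  assumes "\<And>u v. dist (\<rho> u) (\<rho> v) = dist u v"
  shows "linear (\<lambda>y. \<rho> y - \<rho> 0)"
proof -
  define L where "L y = \<rho> y - \<rho> 0" for y
  have n: "norm (L y - L z) = norm (y - z)" for y z
    using assms[of y z] by (simp add: L_def dist_norm)
  have L0: "L 0 = 0" by (simp add: L_def)
  have n1: "L y \<bullet> L y = y \<bullet> y" for y
    using n[of y 0] by (simp add: L0 norm_eq)
  have i: "L y \<bullet> L z = y \<bullet> z" for y z
  proof -
    have "(L y - L z) \<bullet> (L y - L z) = (y - z) \<bullet> (y - z)"
      using n[of y z] by (simp add: norm_eq)
    then show ?thesis
      using n1[of y] n1[of z] by (simp add: inner_diff_left inner_diff_right inner_commute)
  qed
  have "linear L"
  proof (rule linearI)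
    fix y z
    have "(L (y + z) - L y - L z) \<bullet> (L (y + z) - L y - L z) = 0"
      by (simp add: inner_diff_left inner_diff_right i inner_add_left inner_add_right)
    then have "L (y + z) - L y - L z = 0" by (simp only: inner_eq_zero_iff)
    then show "L (y + z) = L y + L z" by (simp add: algebra_simps)
  next
    fix c y
    have "(L (c *\<^sub>R y) - c *\<^sub>R L y) \<bullet> (L (c *\<^sub>R y) - c *\<^sub>R L y) = 0"
      by (simp add: inner_diff_left inner_diff_right i)
    then have "L (c *\<^sub>R y) - c *\<^sub>R L y = 0" by (simp only: inner_eq_zero_iff)
    then show "L (c *\<^sub>R y) = c *\<^sub>R L y" by simp
  qed
  then show ?thesis unfolding L_def .
qed

lemma plane_chart_exists:
  fixes n :: "real^3"
  assumes "norm n = 1"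
  shows "\<exists>\<rho>. plane_chart \<rho> n b"
proof -
  \<comment> \<open>A rotation taking the third axis to n carries the coordinate plane to the
    direction of the required plane; the offset is b n.\<close>
  obtain Q where Q: "orthogonal_transformation Q" and Qn: "Q (axis 3 1 :: real^3) = n"
    by (rule orthogonal_transformation_exists[of "axis 3 1 :: real^3" n]) (use assms in auto)
  have lin: "linear Q" using Q by (rule orthogonal_transformation_linear)
  have surj: "surj Q" using Q by (rule orthogonal_transformation_surj)
  have inner: "Q x \<bullet> Q y = x \<bullet> y" for x y
    using Q by (simp add: orthogonal_transformation_def)
  have nn: "n \<bullet> n = 1" using assms by (simp add: norm_eq_1)
  define \<rho> where "\<rho> y = b *\<^sub>R n + Q (vector [y$1, y$2, 0])" for y :: "real^2"
  have "dist (\<rho> u) (\<rho> v) = dist u v" for u v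
  proof -
    have "dist (\<rho> u) (\<rho> v) = norm (Q (vector [u$1, u$2, 0] - vector [v$1, v$2, 0]))"
      by (simp add: \<rho>_def dist_norm linear_diff[OF lin])
    also have "\<dots> = norm (vector [u$1, u$2, 0] - vector [v$1, v$2, 0] :: real^3)"
      by (simp add: orthogonal_transformation_norm[OF Q])
    also have "\<dots> = dist u v"
      by (simp add: dist_norm norm_eq inner_vec_def sum_3 sum_2 vector_3)
    finally show ?thesis .
  qed
  moreover have "range \<rho> = {x. n \<bullet> x = b}"
  proof (intro set_eqI iffI)
    fix x assume "x \<in> range \<rho>"
    then obtain y where "x = \<rho> y" by blast
    then have "n \<bullet> x = b + axis 3 1 \<bullet> (vector [y$1, y$2, 0] :: real^3)"
      by (simp add: \<rho>_def inner_add_right nn inner flip: Qn)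
    then show "x \<in> {x. n \<bullet> x = b}" by (simp add: inner_axis' vector_3)
  next
    fix x assume x: "x \<in> {x. n \<bullet> x = b}"
    obtain w where w: "x - b *\<^sub>R n = Q w" using surj by (metis surjD)
    have "n \<bullet> Q w = 0" using x nn by (simp flip: w add: inner_diff_right)
    then have "w $ 3 = 0" by (simp flip: Qn add: inner inner_axis')
    then have "w = vector [w$1, w$2, 0]" by (simp add: vec_eq_iff forall_3 vector_3)
    then have "x = \<rho> (vector [w$1, w$2])" using w by (simp add: \<rho>_def vector_2 algebra_simps)
    then show "x \<in> range \<rho>" by blast
  qed
  ultimately show ?thesis unfolding plane_chart_def by blast
qed

text \<open>The isometric image of a plane is an affine plane, and a two-dimensional set spans
  exactly one. So the choice made in \<open>flat_chart\<close> cannot affect its range.\<close>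

lemma flat_chart_plane:
  assumes n: "norm n = 1" and F: "F \<subseteq> {x. n \<bullet> x = b}" and dim: "aff_dim F = 2"
  shows "plane_chart (flat_chart F) n b"
proof -
  define \<rho> where "\<rho> = flat_chart F"
  obtain \<sigma> where \<sigma>: "plane_chart \<sigma> n b"
    using plane_chart_exists[OF n] by blast
  have \<rho>: "(\<forall>u v. dist (\<rho> u) (\<rho> v) = dist u v) \<and> F \<subseteq> range \<rho>"
    unfolding \<rho>_def flat_chart_def
    by (rule someI[of _ \<sigma>]) (use \<sigma> F in \<open>auto simp: plane_chart_def\<close>)
  define L where "L y = \<rho> y - \<rho> 0" for y
  have L: "linear L" unfolding L_def by (rule isometry_linear_part) (use \<rho> in auto)
  have "inj \<rho>" using \<rho> by (metis dist_eq_0_iff injI)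
  then have "inj L" by (auto simp: L_def inj_on_def)
  have r: "range \<rho> = (+) (\<rho> 0) ` range L" by (auto simp: L_def image_image)
  have aff: "affine (range \<rho>)"
    unfolding r using subspace_imp_affine[OF linear_subspace_image[OF L subspace_UNIV]]
    by (simp add: affine_translation[symmetric])
  have "aff_dim (range \<rho>) = 2"
    unfolding r using \<open>inj L\<close> L by (simp add: aff_dim_translation_eq)
  moreover have ne: "affine hull F \<noteq> {}" using dim by auto
  moreover have "affine hull F \<subseteq> range \<rho>" using \<rho> aff by (simp add: hull_minimal)
  ultimately have 1: "affine hull F = range \<rho>"
    using affine_dim_equal[of "affine hull F" "range \<rho>"] aff dim by simp
  have "n \<noteq> 0" using n by auto
  then have "aff_dim {x. n \<bullet> x = b} = 2" by simp
  moreover have "affine hull F \<subseteq> {x. n \<bullet> x = b}"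
    using F by (simp add: hull_minimal affine_hyperplane)
  ultimately have "affine hull F = {x. n \<bullet> x = b}"
    using affine_dim_equal[of "affine hull F" "{x. n \<bullet> x = b}"] affine_hyperplane[of n b] ne dim by simp
  with 1 \<rho> show ?thesis by (simp add: plane_chart_def flip: \<rho>_def)
qed

text \<open>Any two candidates are constant on F and have its affine hull as their common plane,
  hence are parallel. Opposite signs would squeeze K into that plane, against its nonempty
  interior.\<close>

lemma outward_normal_eq:
  assumes K: "interior K \<noteq> {}" and F: "F \<subseteq> K" "aff_dim F = 2" and n: "norm n = 1"
    and le: "\<And>x y. x \<in> F \<Longrightarrow> y \<in> K \<Longrightarrow> n \<bullet> y \<le> n \<bullet> x"
  shows "outward_normal K F = n"
  unfolding outward_normal_def
proof (rule the_equality)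
  fix m assume "norm m = 1 \<and> (\<forall>x\<in>F. \<forall>y\<in>K. m \<bullet> y \<le> m \<bullet> x)"
  then have m: "norm m = 1" and mle: "\<And>x y. x \<in> F \<Longrightarrow> y \<in> K \<Longrightarrow> m \<bullet> y \<le> m \<bullet> x" by auto
  have "F \<noteq> {}" using F(2) by auto
  then obtain p where p: "p \<in> F" by blast
  have hull: "affine hull F = {x. q \<bullet> x = q \<bullet> p}"
    if "norm q = 1" "\<And>x y. x \<in> F \<Longrightarrow> y \<in> K \<Longrightarrow> q \<bullet> y \<le> q \<bullet> x" for q
  proof (rule affine_dim_equal)
    show "affine hull F \<subseteq> {x. q \<bullet> x = q \<bullet> p}"
    proof (rule hull_minimal)
      show "F \<subseteq> {x. q \<bullet> x = q \<bullet> p}" using that F(1) p by (auto intro: antisym)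
    qed (rule affine_hyperplane)
    have "q \<noteq> 0" using that(1) by auto
    then show "aff_dim (affine hull F) = aff_dim {x. q \<bullet> x = q \<bullet> p}" using F(2) by simp
  qed (use p in \<open>auto simp: affine_hyperplane hull_inc\<close>)
  have H: "{x. n \<bullet> x = n \<bullet> p} = {x. m \<bullet> x = m \<bullet> p}"
    using hull[OF n le] hull[OF m mle] by simp
  \<comment> \<open>The component of m orthogonal to n. It is a direction of the common plane, so m
    annihilates it as well.\<close>
  define w where "w = m - (m \<bullet> n) *\<^sub>R n"
  have nn: "n \<bullet> n = 1" using n by (simp add: norm_eq_1)
  have "n \<bullet> w = 0" by (simp add: w_def inner_diff_right nn inner_commute)
  then have "p + w \<in> {x. n \<bullet> x = n \<bullet> p}" by (simp add: inner_add_right)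
  then have "m \<bullet> w = 0" unfolding H by (simp add: inner_add_right)
  then have "w \<bullet> w = 0" using \<open>n \<bullet> w = 0\<close> by (simp add: w_def inner_diff_left)
  then have mw: "m = (m \<bullet> n) *\<^sub>R n" by (simp add: w_def)
  then have "\<bar>m \<bullet> n\<bar> = 1" using n m by (metis norm_scaleR mult.right_neutral)
  moreover have "m \<bullet> n \<noteq> - 1"
  proof
    assume "m \<bullet> n = - 1"
    then have mn: "m = - n" using mw by simp
    have "K \<subseteq> {x. n \<bullet> x = n \<bullet> p}"
      using le[OF p] mle[OF p] unfolding mn by (auto intro: antisym)
    then have "interior K \<subseteq> interior {x. n \<bullet> x = n \<bullet> p}" by (rule interior_mono)
    moreover have "n \<noteq> 0" using n by auto
    ultimately show False using K by (simp add: interior_hyperplane)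
  qed
  ultimately show "m = n" using mw by (smt (verit) scaleR_one)
qed (use n le in auto)

section \<open>Lebesgue integration in coordinates adapted to a plane\<close>

lemma prod_Basis_vec:
  fixes f :: "real^'n \<Rightarrow> 'b::comm_monoid_mult"
  shows "(\<Prod>b\<in>Basis. f b) = (\<Prod>i\<in>UNIV. f (axis i 1))"
proof -
  have B: "(Basis :: (real^'n) set) = range (\<lambda>i. axis i 1)"
    by (auto simp: Basis_vec_def)
  have "inj (\<lambda>i. axis i 1 :: real^'n)"
    by (auto simp: inj_on_def axis_eq_axis)
  then show ?thesis unfolding B by (subst prod.reindex) (simp_all add: comp_def)
qed

lemma prod_3: "prod f (UNIV :: 3 set) = f 1 * f 2 * f 3"
  unfolding UNIV_3 by (simp add: ac_simps)

lemma emeasure_lborel_box_vec: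
  fixes l u :: "real^'n"
  assumes "\<And>i. l $ i \<le> u $ i"
  shows "emeasure lborel (box l u) = ennreal (\<Prod>i\<in>UNIV. u $ i - l $ i)"
proof -
  have "emeasure lborel (box l u) = ennreal (\<Prod>b\<in>Basis. (u - l) \<bullet> b)"
    by (rule emeasure_lborel_box) (use assms in \<open>auto simp: Basis_vec_def inner_axis\<close>)
  then show ?thesis by (simp add: prod_Basis_vec inner_axis)
qed

definition join3 :: "(real^2) \<times> real \<Rightarrow> real^3" where
  "join3 z = vector [fst z $ 1, fst z $ 2, snd z]"

lemma continuous_on_join3: "continuous_on S join3"
  unfolding join3_def[abs_def] continuous_on_componentwise[where 'b="real^3"]
  by (auto simp: Basis_vec_def inner_axis forall_3 vector_3 intro!: continuous_intros)

text \<open>The density compensates for stretching the third coordinate by h. The rescaling is there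
  for the sweep: a layer with thickness of order h becomes a region of bounded height, on which the
  limit of vanishing h can be taken.\<close>

lemma lborel_join3:
  assumes h: "h > (0::real)"
  shows "lborel = density (distr lborel borel (\<lambda>z. join3 (fst z, h * snd z))) (\<lambda>_. ennreal h)"
proof (rule lborel_eqI)
  have [measurable]: "(\<lambda>z. join3 (fst z, h * snd z)) \<in> borel \<rightarrow>\<^sub>M borel"
    by (intro borel_measurable_continuous_onI continuous_on_compose2[OF continuous_on_join3]
        continuous_intros) auto
  fix l u :: "real^3" assume "\<And>b. b \<in> Basis \<Longrightarrow> l \<bullet> b \<le> u \<bullet> b"
  then have le: "l $ i \<le> u $ i" for i
    by (metis axis_in_Basis_iff cart_eq_inner_axis Basis_real_def singletonI)
  define l2 u2 :: "real^2" where "l2 = vector [l$1, l$2]" and "u2 = vector [u$1, u$2]"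
  have eq: "(\<lambda>z. join3 (fst z, h * snd z)) -` box l u = box l2 u2 \<times> box (l$3 / h) (u$3 / h)"
    using h by (auto simp: mem_box_cart forall_3 forall_2 join3_def vector_3 vector_2 l2_def u2_def
        box_real field_simps)
  have 2: "emeasure lborel (box l2 u2) = ennreal ((u$1 - l$1) * (u$2 - l$2))"
    by (subst emeasure_lborel_box_vec) (auto simp: l2_def u2_def le vector_2 prod_2 exhaust_2
        forall_2[of "\<lambda>i. _ $ i \<le> _ $ i", THEN iffD2, rule_format] UNIV_2)
  have "emeasure lborel (box l2 u2 \<times> box (l$3 / h) (u$3 / h))
      = ennreal ((u$1 - l$1) * (u$2 - l$2)) * ennreal (u$3 / h - l$3 / h)"
    unfolding lborel_prod[symmetric]
    by (subst lborel.emeasure_pair_measure_Times)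
      (use le h 2 in \<open>auto simp: box_real emeasure_lborel_Ioo divide_right_mono\<close>)
  moreover have "ennreal h * (ennreal a * ennreal (u$3 / h - l$3 / h)) = ennreal (a * (u$3 - l$3))" for a
  proof -
    have "0 \<le> u$3 / h - l$3 / h" using h le by (simp add: divide_right_mono)
    then have "ennreal h * (ennreal a * ennreal (u$3 / h - l$3 / h)) = ennreal (h * (a * (u$3 / h - l$3 / h)))"
      using h by (metis ennreal_mult' ennreal_mult'' less_imp_le)
    also have "h * (a * (u$3 / h - l$3 / h)) = a * (u$3 - l$3)"
      using h by (simp add: field_simps)
    finally show ?thesis .
  qed
  ultimately have "ennreal h * emeasure lborel (box l2 u2 \<times> box (l$3 / h) (u$3 / h))
      = ennreal ((u$1 - l$1) * (u$2 - l$2) * (u$3 - l$3))"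
    by simp
  then show "emeasure (density (distr lborel borel (\<lambda>z. join3 (fst z, h * snd z))) (\<lambda>_. ennreal h)) (box l u)
      = (\<Prod>b\<in>Basis. (u - l) \<bullet> b)"
    by (simp add: emeasure_density_const emeasure_distr eq prod_Basis_vec inner_axis prod_3)
qed simp

text \<open>The preimage of a box is a rotated box, whose volume is that of the box itself, and
  values on boxes determine the measure.\<close>

lemma lborel_distr_orthogonal:
  fixes f :: "real^3 \<Rightarrow> real^3"
  assumes f: "orthogonal_transformation f"
  shows "distr lborel borel f = lborel"
proof (rule lborel_eqI[symmetric])
  obtain g where g: "orthogonal_transformation g" "\<And>x. f (g x) = x" "\<And>x. g (f x) = x"
    using orthogonal_transformation_inv[OF f] orthogonal_transformation_bij[OF f]
    by (metis bij_inv_eq_iff)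
  have [measurable]: "f \<in> borel \<rightarrow>\<^sub>M borel"
    using orthogonal_transformation_linear[OF f]
    by (intro borel_measurable_continuous_onI) (simp add: linear_continuous_on linear_conv_bounded_linear)
  fix l u :: "real^3" assume le: "\<And>b. b \<in> Basis \<Longrightarrow> l \<bullet> b \<le> u \<bullet> b"
  have eq: "f -` box l u = g ` box l u"
    using g(2,3) by (auto intro: rev_image_eqI)
  have b: "box l u \<in> lmeasurable" by simp
  have "open (f -` box l u)"
    using orthogonal_transformation_linear[OF f]
    by (intro open_vimage) (auto simp: linear_continuous_on linear_conv_bounded_linear)
  then have "emeasure lborel (g ` box l u) = emeasure lebesgue (g ` box l u)"
    by (simp add: eq)
  also have "\<dots> = emeasure lebesgue (box l u)"
    using measurable_orthogonal_image[OF g(1) b] measure_orthogonal_image[OF g(1) b] b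
    by (metis emeasure_eq_measure2)
  finally show "emeasure (distr lborel borel f) (box l u) = (\<Prod>b\<in>Basis. (u - l) \<bullet> b)"
    using le by (simp add: emeasure_distr eq)
qed simp

lemma plane_chart_isometry: "plane_chart \<rho> n b \<Longrightarrow> dist (\<rho> u) (\<rho> v) = dist u v"
  by (simp add: plane_chart_def)

lemma plane_chart_inner: "plane_chart \<rho> n b \<Longrightarrow> n \<bullet> \<rho> y = b"
  by (auto simp: plane_chart_def)

lemma plane_chart_continuous: "plane_chart \<rho> n b \<Longrightarrow> continuous_on S \<rho>"
  by (auto simp: continuous_on_iff plane_chart_def)

lemma plane_chart_integral:
  fixes G :: "real^3 \<Rightarrow> real"
  assumes \<rho>: "plane_chart \<rho> n b" and n: "norm n = 1" and h: "h > 0"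
    and G[measurable]: "G \<in> borel_measurable borel"
  shows "integral\<^sup>L lborel G = h * (\<integral>z. G (\<rho> (fst z) + (h * snd z) *\<^sub>R n) \<partial>lborel)"
proof -
  \<comment> \<open>The linear part of the chart in the first two coordinates, completed by the unit
    normal in the third. As n is orthogonal to the plane, Pythagoras makes this an isometry of
    space.\<close>
  define Q where "Q w = \<rho> (vector [w$1, w$2]) - \<rho> 0 + w$3 *\<^sub>R n" for w :: "real^3"
  have "orthogonal_transformation Q"
    unfolding orthogonal_transformation_isometry
  proof (intro conjI allI)
    have "(vector [0, 0] :: real^2) = 0" by (simp add: vec_eq_iff forall_2 vector_2)
    then show "Q 0 = 0" by (simp add: Q_def)
    fix w w' :: "real^3"
    define y y' :: "real^2" where "y = vector [w$1, w$2]" and "y' = vector [w'$1, w'$2]"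
    have "orthogonal (\<rho> y - \<rho> y') ((w$3 - w'$3) *\<^sub>R n)"
      using plane_chart_inner[OF \<rho>]
      by (simp add: orthogonal_def inner_diff_left inner_diff_right inner_commute)
    then have "(norm (\<rho> y - \<rho> y' + (w$3 - w'$3) *\<^sub>R n))\<^sup>2 = (norm (\<rho> y - \<rho> y'))\<^sup>2 + (w$3 - w'$3)\<^sup>2"
      using n by (simp add: norm_add_Pythagorean)
    also have "norm (\<rho> y - \<rho> y') = norm (y - y')"
      using plane_chart_isometry[OF \<rho>, of y y'] by (simp add: dist_norm)
    also have "(norm (y - y'))\<^sup>2 + (w$3 - w'$3)\<^sup>2 = (norm (w - w'))\<^sup>2"
      by (simp add: power2_norm_eq_inner inner_vec_def sum_2 sum_3 y_def y'_def vector_2)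
        (simp add: power2_eq_square)
    finally have "norm (\<rho> y - \<rho> y' + (w$3 - w'$3) *\<^sub>R n) = norm (w - w')"
      by (rule power2_eq_imp_eq) auto
    then show "dist (Q w) (Q w') = dist w w'"
      by (simp add: dist_norm Q_def algebra_simps flip: y_def y'_def)
  qed
  note dQ = lborel_distr_orthogonal[OF this]
  have cont: "continuous_on UNIV Q"
    using orthogonal_transformation_linear[OF \<open>orthogonal_transformation Q\<close>]
    by (simp add: linear_continuous_on linear_conv_bounded_linear)
  have [measurable]: "Q \<in> borel \<rightarrow>\<^sub>M borel"
    using cont by (rule borel_measurable_continuous_onI)
  have [measurable]: "(\<lambda>z. join3 (fst z, h * snd z)) \<in> borel \<rightarrow>\<^sub>M borel"
    by (intro borel_measurable_continuous_onI continuous_on_compose2[OF continuous_on_join3]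
        continuous_intros) auto
  have "integral\<^sup>L lborel G = integral\<^sup>L (distr lborel borel ((+) (\<rho> 0))) G"
    by (simp add: lborel_distr_plus)
  also have "\<dots> = (\<integral>x. G (\<rho> 0 + x) \<partial>lborel)"
    by (subst integral_distr) auto
  also have "\<dots> = (\<integral>x. G (\<rho> 0 + x) \<partial>distr lborel borel Q)"
    by (simp add: dQ)
  also have "\<dots> = (\<integral>x. G (\<rho> 0 + Q x) \<partial>lborel)"
    by (subst integral_distr) auto
  also have "\<dots> = (\<integral>x. G (\<rho> 0 + Q x)
      \<partial>density (distr lborel borel (\<lambda>z. join3 (fst z, h * snd z))) (\<lambda>_. ennreal h))"
    by (rule arg_cong[where f="\<lambda>M. integral\<^sup>L M (\<lambda>x. G (\<rho> 0 + Q x))", OF lborel_join3[OF h]])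
  also have "\<dots> = (\<integral>x. h * G (\<rho> 0 + Q x) \<partial>distr lborel borel (\<lambda>z. join3 (fst z, h * snd z)))"
    using h by (subst integral_density) auto
  also have "\<dots> = (\<integral>z. h * G (\<rho> 0 + Q (join3 (fst z, h * snd z))) \<partial>lborel)"
    by (subst integral_distr) auto
  also have "(\<lambda>z. \<rho> 0 + Q (join3 (fst z, h * snd z))) = (\<lambda>z. \<rho> (fst z) + (h * snd z) *\<^sub>R n)"
  proof
    fix z :: "(real^2) \<times> real"
    have "vector [fst z $ 1, fst z $ 2] = fst z"
      by (simp add: vec_eq_iff forall_2 vector_2)
    then show "\<rho> 0 + Q (join3 (fst z, h * snd z)) = \<rho> (fst z) + (h * snd z) *\<^sub>R n"
      by (simp add: Q_def join3_def vector_3)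
  qed
  then have "(\<lambda>z. h * G (\<rho> 0 + Q (join3 (fst z, h * snd z))))
      = (\<lambda>z. h * G (\<rho> (fst z) + (h * snd z) *\<^sub>R n))"
    by metis
  finally show ?thesis by simp
qed

section \<open>Sweeping a body across a separating plane\<close>

lemma AE_lborel_negligible:
  assumes "negligible N" shows "AE x in lborel. x \<notin> N"
proof -
  have "AE x in lebesgue. x \<notin> N"
    unfolding eventually_ae_filter_negligible using assms by auto
  then show ?thesis by (simp add: AE_completion_iff)
qed

text \<open>C contains a disc around p in the plane and a point q strictly beyond the plane, hence
  their convex hull. Near its apex p every direction pointing beyond the plane starts inside this
  hull.\<close>

lemma eventually_in_convex:
  fixes C :: "'a::euclidean_space set"
  assumes C: "convex C" and q: "q \<in> C" "b < n \<bullet> q" and p: "n \<bullet> p = b" and r: "r > 0"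
    and disc: "\<And>w. n \<bullet> w = 0 \<Longrightarrow> norm w < r \<Longrightarrow> p + w \<in> C"
    and d: "n \<bullet> d > 0" and h: "\<And>k. h k > 0" "h \<longlonglongrightarrow> (0::real)"
  shows "\<forall>\<^sub>F k in sequentially. p + h k *\<^sub>R d \<in> C"
proof -
  \<comment> \<open>Chosen so that \<open>w\<close> is parallel to the plane. With h =
    \<open>h k\<close>, the point p + h d is then the combination, with weights 1 - h \<alpha> and h
    \<alpha>, of a point of the plane at distance of order h from p and of q.\<close>
  define \<alpha> where "\<alpha> = (n \<bullet> d) / (n \<bullet> q - b)"
  define w where "w = d - \<alpha> *\<^sub>R (q - p)"
  have \<alpha>: "\<alpha> > 0" using d q by (simp add: \<alpha>_def)
  have w: "n \<bullet> w = 0" using q p by (simp add: w_def inner_diff_right \<alpha>_def)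
  have "(\<lambda>k. h k * \<alpha>) \<longlonglongrightarrow> 0 * \<alpha>" by (intro tendsto_intros h)
  then have 1: "\<forall>\<^sub>F k in sequentially. h k * \<alpha> < 1" by (simp add: order_tendstoD(2))
  have "(\<lambda>k. norm ((h k / (1 - h k * \<alpha>)) *\<^sub>R w)) \<longlonglongrightarrow> norm ((0 / (1 - 0 * \<alpha>)) *\<^sub>R w)"
    by (intro tendsto_intros h) simp
  then have 2: "\<forall>\<^sub>F k in sequentially. norm ((h k / (1 - h k * \<alpha>)) *\<^sub>R w) < r"
    using r by (simp add: order_tendstoD(2))
  show ?thesis using 1 2
  proof eventually_elim
    case (elim k)
    have "p + (h k / (1 - h k * \<alpha>)) *\<^sub>R w \<in> C"
      by (rule disc) (use w elim in auto)
    then have "(1 - h k * \<alpha>) *\<^sub>R (p + (h k / (1 - h k * \<alpha>)) *\<^sub>R w) + (h k * \<alpha>) *\<^sub>R q \<in> C"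
      by (intro convexD[OF C]) (use q elim h(1)[of k] \<alpha> in auto)
    moreover have "(1 - h k * \<alpha>) *\<^sub>R (p + (h k / (1 - h k * \<alpha>)) *\<^sub>R w) + (h k * \<alpha>) *\<^sub>R q
        = (1 - h k * \<alpha>) *\<^sub>R p + h k *\<^sub>R w + (h k * \<alpha>) *\<^sub>R q"
      using elim by (simp add: scaleR_add_right)
    moreover have "\<dots> = p + h k *\<^sub>R d"
      by (simp add: w_def algebra_simps)
    ultimately show ?case by simp
  qed
qed

lemma compact_plane_chart_vimage:
  assumes \<rho>: "plane_chart \<rho> n b" and F: "compact F"
  shows "compact (\<rho> -` F)"
proof -
  have "closed (\<rho> -` F)"
    using F plane_chart_continuous[OF \<rho>] by (simp add: closed_vimage compact_imp_closed)
  moreover have "bounded (\<rho> -` F)"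
  proof -
    obtain R where R: "\<And>x. x \<in> F \<Longrightarrow> dist (\<rho> 0) x \<le> R"
      using compact_imp_bounded[OF F] bounded_any_center by metis
    have "dist 0 y \<le> R" if "y \<in> \<rho> -` F" for y
      using R[of "\<rho> y"] that plane_chart_isometry[OF \<rho>, of 0 y] by simp
    then show ?thesis unfolding bounded_def by blast
  qed
  ultimately show ?thesis by (simp add: compact_eq_bounded_closed)
qed

lemma convex_plane_chart_vimage:
  assumes \<rho>: "plane_chart \<rho> n b" and F: "convex F"
  shows "convex (\<rho> -` F)"
proof -
  have "linear (\<lambda>y. \<rho> y - \<rho> 0)"
    by (rule isometry_linear_part) (rule plane_chart_isometry[OF \<rho>])
  then have "convex ((\<lambda>y. \<rho> y - \<rho> 0) -` ((+) (- \<rho> 0) ` F))"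
    using F by (intro convex_linear_vimage convex_translation)
  moreover have "(\<lambda>y. \<rho> y - \<rho> 0) -` ((+) (- \<rho> 0) ` F) = \<rho> -` F"
    by (auto simp: image_iff algebra_simps)
  ultimately show ?thesis by simp
qed

lemma body_beyond_plane:
  assumes C: "body C" and n: "n \<noteq> 0" and le: "\<And>x. x \<in> C \<Longrightarrow> b \<le> n \<bullet> x"
  shows "\<exists>q\<in>C. b < n \<bullet> q"
proof (rule ccontr)
  assume "\<not> ?thesis"
  then have "C \<subseteq> {x. n \<bullet> x = b}" using le by force
  then have "interior C \<subseteq> interior {x. n \<bullet> x = b}" by (rule interior_mono)
  then show False using C n by (simp add: body_def interior_hyperplane)
qed

text \<open>In coordinates \<open>x = \<rho> y + h \<tau> n\<close> adapted to the separating plane, the region swept into \<open>C\<close>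
  by moving \<open>A\<close> along \<open>h v\<close> tends to the cylinder over \<open>A \<inter> C\<close> of height \<open>0 \<le> \<tau> \<le> n \<bullet> v\<close>.\<close>

lemma sweep_limit_pos:
  fixes A C :: "(real^3) set" and \<phi> :: "real^3 \<Rightarrow> real"
  assumes A: "body A" and C: "body C" and n: "norm n = 1"
    and sepA: "\<And>x. x \<in> A \<Longrightarrow> n \<bullet> x \<le> b" and sepC: "\<And>x. x \<in> C \<Longrightarrow> b \<le> n \<bullet> x"
    and \<rho>: "plane_chart \<rho> n b" and \<phi>: "continuous_on UNIV \<phi>"
    and h: "\<And>k. h k > 0" "h \<longlonglongrightarrow> 0" and c: "n \<bullet> v > 0"
  shows "(\<lambda>k. (LINT x : ((+) (h k *\<^sub>R v) ` A) \<inter> C | lborel. \<phi> x) / h k)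
    \<longlonglongrightarrow> (n \<bullet> v) * (LINT y : \<rho> -` (A \<inter> C) | lborel. \<phi> (\<rho> y))"
proof -
  define c where "c = n \<bullet> v"
  define D where "D = \<rho> -` (A \<inter> C)"
  define X where "X k = ((+) (h k *\<^sub>R v) ` A) \<inter> C" for k
  define \<xi> where "\<xi> k z = \<rho> (fst z) + (h k * snd z) *\<^sub>R n" for k and z :: "(real^2) \<times> real"
  define G where "G k z = indicat_real (X k) (\<xi> k z) * \<phi> (\<xi> k z)" for k z
  define g where "g z = indicat_real (D \<times> {0..c}) z * \<phi> (\<rho> (fst z))" for z
  have nn: "n \<bullet> n = 1" using n by (simp add: norm_eq_1)
  have D: "compact D" "convex D"
    using A C unfolding D_def
    by (auto simp: body_def intro!: compact_plane_chart_vimage[OF \<rho>] compact_Int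
        convex_plane_chart_vimage[OF \<rho>] convex_Int)
  have X: "compact (X k)" for k
    using A C by (auto simp: X_def body_def intro!: compact_Int compact_translation)
  have memX: "x \<in> X k \<longleftrightarrow> x - h k *\<^sub>R v \<in> A \<and> x \<in> C" for x k
    by (auto simp: X_def image_iff algebra_simps) (metis add.commute diff_add_cancel)
  have \<phi>m[measurable]: "\<phi> \<in> borel_measurable borel"
    using \<phi> by (rule borel_measurable_continuous_onI)
  have \<rho>m[measurable]: "\<rho> \<in> borel \<rightarrow>\<^sub>M borel"
    using plane_chart_continuous[OF \<rho>] by (rule borel_measurable_continuous_onI)
  have [measurable]: "X k \<in> sets borel" for k using X by (simp add: borel_compact)
  have [measurable]: "D \<in> sets borel" using D by (simp add: borel_compact)
  have \<xi>c: "continuous_on UNIV (\<xi> k)" for k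
    unfolding \<xi>_def[abs_def]
    by (intro continuous_intros continuous_on_compose2[OF plane_chart_continuous[OF \<rho>, of UNIV]]) auto
  have [measurable]: "\<xi> k \<in> borel \<rightarrow>\<^sub>M borel" for k
    using \<xi>c by (rule borel_measurable_continuous_onI)
  have Gm: "G k \<in> borel_measurable lborel" for k
    unfolding G_def[abs_def] by measurable
  have D0c: "D \<times> {0..c} \<in> sets borel" using D by (intro borel_compact compact_Times) auto
  have gm: "g \<in> borel_measurable lborel"
  proof -
    have [measurable]: "(\<lambda>z. \<rho> (fst z)) \<in> borel_measurable (borel :: ((real^2) \<times> real) measure)"
      by (intro borel_measurable_continuous_onI continuous_on_compose2[OF plane_chart_continuous[OF \<rho>, of UNIV]]
          continuous_intros) auto
    show ?thesis unfolding g_def[abs_def] using D0c by measurable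
  qed
  have n\<xi>: "n \<bullet> \<xi> k z = b + h k * snd z" for k z
    using plane_chart_inner[OF \<rho>] by (simp add: \<xi>_def inner_add_right nn)
  have GX: "(LINT x : X k | lborel. \<phi> x) / h k = integral\<^sup>L lborel (G k)" for k
  proof -
    have "(\<lambda>x. indicat_real (X k) x *\<^sub>R \<phi> x) \<in> borel_measurable borel" by measurable
    from plane_chart_integral[OF \<rho> n h(1)[of k] this] show ?thesis
      using h(1)[of k] by (simp add: set_lebesgue_integral_def G_def[abs_def] \<xi>_def)
  qed
  have "(\<lambda>k. integral\<^sup>L lborel (G k)) \<longlonglongrightarrow> integral\<^sup>L lborel g"
  proof -
    obtain R where R: "\<And>x. x \<in> C \<Longrightarrow> norm x \<le> R"
      using C compact_imp_bounded[of C] by (auto simp: body_def bounded_iff)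
    have "compact (\<phi> ` C)"
      using C continuous_on_subset[OF \<phi>] by (auto simp: body_def intro!: compact_continuous_image)
    then obtain M where M: "\<And>x. x \<in> C \<Longrightarrow> \<bar>\<phi> x\<bar> \<le> M"
      using compact_imp_bounded[of "\<phi> ` C"] by (auto simp: bounded_iff)
    obtain H where H: "\<And>k. h k \<le> H"
      using convergent_imp_Bseq[OF convergentI[OF h(2)]] unfolding Bseq_def
      by (metis abs_le_D1 real_norm_def)
    \<comment> \<open>A bounded region outside of which every \<open>G k\<close> vanishes. The two
      separation inequalities force the height into \<open>{0..c}\<close>; the radius comes from the
      bound R on C, the greatest normal offset \<open>H * c\<close> and the base point of the
      chart.\<close>
    define W where "W = cball (0 :: real^2) (R + H * c + norm (\<rho> 0)) \<times> {0..c}"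
    have W: "compact W" unfolding W_def by (intro compact_Times) auto
    have supp: "z \<in> W" if "\<xi> k z \<in> X k" for k z
    proof -
      have m: "\<xi> k z - h k *\<^sub>R v \<in> A" "\<xi> k z \<in> C" using that memX by auto
      have "0 \<le> h k * snd z" using sepC[OF m(2)] by (simp add: n\<xi>)
      then have t0: "0 \<le> snd z" using h(1)[of k] by (simp add: zero_le_mult_iff)
      have "h k * snd z \<le> h k * c" using sepA[OF m(1)] by (simp add: inner_diff_right n\<xi> c_def)
      then have tc: "snd z \<le> c" using h(1)[of k] by simp
      have "norm (fst z) = norm (\<rho> (fst z) - \<rho> 0)"
        using plane_chart_isometry[OF \<rho>, of "fst z" 0] by (simp add: dist_norm)
      also have "\<rho> (fst z) - \<rho> 0 = \<xi> k z - (h k * snd z) *\<^sub>R n - \<rho> 0" by (simp add: \<xi>_def)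
      also have "norm \<dots> \<le> norm (\<xi> k z) + norm ((h k * snd z) *\<^sub>R n) + norm (\<rho> 0)"
        by (meson norm_triangle_ineq4 order_trans add_right_mono)
      also have "norm ((h k * snd z) *\<^sub>R n) \<le> H * c"
        using t0 tc h(1)[of k] H[of k] n by (simp add: abs_mult mult_mono)
      also have "norm (\<xi> k z) \<le> R" by (rule R[OF m(2)])
      finally show ?thesis using t0 tc by (cases z) (simp add: W_def)
    qed
    show ?thesis
    proof (rule integral_dominated_convergence[OF gm Gm])
      show "integrable lborel (\<lambda>z. indicator W z * M)"
        using borel_integrable_compact[OF W, of "\<lambda>_. M"] by simp
      show "AE z in lborel. norm (G k z) \<le> indicator W z * M" for k
      proof (rule AE_I2)
        fix z
        show "norm (G k z) \<le> indicator W z * M"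
        proof (cases "\<xi> k z \<in> X k")
          case True
          then have "\<xi> k z \<in> C" using memX by simp
          then show ?thesis using supp[OF True] M True by (simp add: G_def)
        next
          case False
          moreover obtain x where "x \<in> C" using C interior_subset by (force simp: body_def)
          then have "0 \<le> M" using M[of x] by linarith
          ultimately show ?thesis by (simp add: G_def indicator_def)
        qed
      qed
      \<comment> \<open>The points left out are those where membership in the swept region need not
        settle for small steps: the side wall of the limiting cylinder and its two end heights 0 and
        c.\<close>
      have neg1: "negligible (frontier (D \<times> (UNIV :: real set)))"
        using D by (intro negligible_convex_frontier convex_Times) auto
      have neg2: "negligible {z :: (real^2) \<times> real. (0, 1) \<bullet> z = a}" for a
        by (rule negligible_hyperplane) (simp add: zero_prod_def)
      have "AE z in lborel. z \<notin> frontier (D \<times> (UNIV :: real set))"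
        "AE z in lborel. z \<notin> {z :: (real^2) \<times> real. (0, 1) \<bullet> z = 0}"
        "AE z in lborel. z \<notin> {z :: (real^2) \<times> real. (0, 1) \<bullet> z = c}"
        by (intro AE_lborel_negligible neg1 neg2)+
      then show "AE z in lborel. (\<lambda>k. G k z) \<longlonglongrightarrow> g z"
      proof eventually_elim
        case (elim z)
        define y \<tau> where "y = fst z" and "\<tau> = snd z"
        have \<tau>: "\<tau> \<noteq> 0" "\<tau> \<noteq> c" using elim(2,3) by (simp_all add: \<tau>_def inner_prod_def)
        have clo: "closure (D \<times> (UNIV :: real set)) = D \<times> UNIV"
          using D(1) by (simp add: closure_Times compact_imp_closed)
        have y: "y \<notin> D \<or> y \<in> interior D"
          using elim(1) by (cases z) (auto simp: frontier_def clo interior_Times y_def)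
        have "(\<lambda>k. \<rho> y + (h k * \<tau>) *\<^sub>R n) \<longlonglongrightarrow> \<rho> y + (0 * \<tau>) *\<^sub>R n"
          by (intro tendsto_intros h)
        then have lim: "(\<lambda>k. \<xi> k z) \<longlonglongrightarrow> \<rho> y" by (simp add: \<xi>_def y_def \<tau>_def)
        then have "(\<lambda>k. \<xi> k z - h k *\<^sub>R v) \<longlonglongrightarrow> \<rho> y - 0 *\<^sub>R v"
          by (intro tendsto_intros h)
        then have lim': "(\<lambda>k. \<xi> k z - h k *\<^sub>R v) \<longlonglongrightarrow> \<rho> y" by simp
        have "isCont \<phi> (\<rho> y)" using \<phi> by (simp add: continuous_on_eq_continuous_at)
        then have lim\<phi>: "(\<lambda>k. \<phi> (\<xi> k z)) \<longlonglongrightarrow> \<phi> (\<rho> y)"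
          using lim isCont_tendsto_compose by blast
        show ?case
        proof (cases "y \<in> interior D \<and> 0 < \<tau> \<and> \<tau> < c")
          case True
          then obtain r where r: "r > 0" "ball y r \<subseteq> D" by (meson mem_interior)
          \<comment> \<open>As the chart is an isometry onto the plane, a ball around y inside
            \<open>D\<close> gives a disc around \<open>\<rho> y\<close> inside both bodies.\<close>
          have disc: "\<rho> y + w \<in> A \<inter> C" if "n \<bullet> w = 0" "norm w < r" for w
          proof -
            have "\<rho> y + w \<in> range \<rho>"
              using \<rho> that plane_chart_inner[OF \<rho>] by (simp add: plane_chart_def inner_add_right)
            then obtain y' where y': "\<rho> y' = \<rho> y + w" by (metis rangeE)
            then have "dist y y' < r"
              using plane_chart_isometry[OF \<rho>, of y y'] that by (simp add: dist_norm)
            then show ?thesis using r y' by (auto simp: D_def)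
          qed
          have n0: "n \<noteq> 0" using n by auto
          obtain q where q: "q \<in> C" "b < n \<bullet> q"
            using body_beyond_plane[OF C n0 sepC] by blast
          obtain q' where q': "q' \<in> A" "- b < - n \<bullet> q'"
            using body_beyond_plane[OF A, of "- n" "- b"] n0 sepA by auto
          have "\<forall>\<^sub>F k in sequentially. \<rho> y + h k *\<^sub>R (\<tau> *\<^sub>R n) \<in> C"
            by (rule eventually_in_convex[where n=n and b=b and r=r and q=q])
              (use C q r disc True h plane_chart_inner[OF \<rho>] in \<open>auto simp: body_def nn\<close>)
          \<comment> \<open>A lies on the other side of the plane, so the normal is reversed. The
            component of \<open>\<tau> *\<^sub>R n - v\<close> along - n is c - \<tau>, which is
            positive here.\<close>
          moreover have "\<forall>\<^sub>F k in sequentially. \<rho> y + h k *\<^sub>R (\<tau> *\<^sub>R n - v) \<in> A"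
            by (rule eventually_in_convex[where n="- n" and b="- b" and r=r and q=q'])
              (use A q' r disc True h plane_chart_inner[OF \<rho>] in
                \<open>auto simp: body_def nn c_def inner_diff_right\<close>)
          ultimately have "\<forall>\<^sub>F k in sequentially. \<phi> (\<xi> k z) = G k z"
          proof eventually_elim
            case (elim k)
            then have "\<xi> k z \<in> X k" by (simp add: memX \<xi>_def y_def \<tau>_def algebra_simps)
            then show ?case by (simp add: G_def)
          qed
          moreover have "g z = \<phi> (\<rho> y)"
            using True interior_subset[of D] by (cases z) (auto simp: g_def y_def \<tau>_def)
          ultimately show ?thesis using lim\<phi> by (simp add: tendsto_cong)
        next
          case False
          have "\<forall>\<^sub>F k in sequentially. \<xi> k z \<notin> X k"
          proof -
            \<comment> \<open>Off \<open>D\<close> one of the two closed bodies misses the limit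
              point \<open>\<rho> y\<close>, and hence all points close to it. At a wrong height the
              support bound excludes every k at once.\<close>
            consider "y \<notin> D" | "\<tau> < 0" | "\<tau> > c" using False y \<tau> by force
            then show ?thesis
            proof cases
              case 1
              then consider "\<rho> y \<in> - A" | "\<rho> y \<in> - C" by (auto simp: D_def)
              then show ?thesis
              proof cases
                case 1
                then have "\<forall>\<^sub>F k in sequentially. \<xi> k z - h k *\<^sub>R v \<in> - A"
                  using topological_tendstoD[OF lim', of "- A"] open_Compl[OF body_closed[OF A]] by simp
                then show ?thesis by eventually_elim (simp add: memX)
              next
                case 2
                then have "\<forall>\<^sub>F k in sequentially. \<xi> k z \<in> - C"
                  using topological_tendstoD[OF lim, of "- C"] open_Compl[OF body_closed[OF C]] by simp
                then show ?thesis by eventually_elim (simp add: memX)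
              qed
            next
              case 2
              then have "\<xi> k z \<notin> X k" for k
                using supp[of k z] by (cases z) (auto simp: W_def \<tau>_def)
              then show ?thesis by simp
            next
              case 3
              then have "\<xi> k z \<notin> X k" for k
                using supp[of k z] by (cases z) (auto simp: W_def \<tau>_def)
              then show ?thesis by simp
            qed
          qed
          then have "\<forall>\<^sub>F k in sequentially. 0 = G k z"
            by eventually_elim (simp add: G_def)
          moreover have "g z = 0"
            using False y \<tau> by (cases z) (auto simp: g_def y_def \<tau>_def indicator_def)
          ultimately show ?thesis by (simp add: tendsto_cong)
        qed
      qed
    qed
  qed
  moreover have "integral\<^sup>L lborel g = c * (LINT y : D | lborel. \<phi> (\<rho> y))"
  proof -
    have gint: "integrable (lborel \<Otimes>\<^sub>M lborel) g"
    proof -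
      have "continuous_on (D \<times> {0..c}) (\<lambda>z. \<phi> (\<rho> (fst z)))"
        by (intro continuous_on_compose2[OF \<phi>] continuous_intros
            continuous_on_compose2[OF plane_chart_continuous[OF \<rho>, of UNIV]]) auto
      then have "integrable lborel (\<lambda>z. indicator (D \<times> {0..c}) z *\<^sub>R \<phi> (\<rho> (fst z)))"
        using D(1) by (intro borel_integrable_compact compact_Times) auto
      then show ?thesis by (simp add: g_def[abs_def] lborel_prod)
    qed
    have "integral\<^sup>L lborel g = (\<integral>y. (\<integral>\<tau>. g (y, \<tau>) \<partial>lborel) \<partial>lborel)"
      using lborel_pair.integral_fst'[OF gint] by (simp add: lborel_prod)
    also have "\<dots> = (\<integral>y. c * (indicator D y *\<^sub>R \<phi> (\<rho> y)) \<partial>lborel)"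
    proof (rule Bochner_Integration.integral_cong)
      fix y :: "real^2"
      have "(\<integral>\<tau>. g (y, \<tau>) \<partial>lborel) = (\<integral>\<tau>. indicator {0..c} \<tau> * (indicator D y * \<phi> (\<rho> y)) \<partial>lborel)"
        by (intro Bochner_Integration.integral_cong) (auto simp: g_def indicator_times)
      then show "(\<integral>\<tau>. g (y, \<tau>) \<partial>lborel) = c * (indicator D y *\<^sub>R \<phi> (\<rho> y))"
        using c by (simp add: c_def)
    qed simp
    finally show ?thesis by (simp add: set_lebesgue_integral_def)
  qed
  ultimately show ?thesis
    unfolding X_def[symmetric] D_def[symmetric] c_def[symmetric] GX by simp
qed

text \<open>If v does not point across the plane, the moved body A stays on its own side and can
  meet C only within the plane, which is null.\<close>

lemma sweep_limit:
  fixes A C :: "(real^3) set" and \<phi> :: "real^3 \<Rightarrow> real"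
  assumes A: "body A" and C: "body C" and n: "norm n = 1"
    and sepA: "\<And>x. x \<in> A \<Longrightarrow> n \<bullet> x \<le> b" and sepC: "\<And>x. x \<in> C \<Longrightarrow> b \<le> n \<bullet> x"
    and \<rho>: "plane_chart \<rho> n b" and \<phi>: "continuous_on UNIV \<phi>"
    and h: "\<And>k. h k > 0" "h \<longlonglongrightarrow> 0"
  shows "(\<lambda>k. (LINT x : ((+) (h k *\<^sub>R v) ` A) \<inter> C | lborel. \<phi> x) / h k)
    \<longlonglongrightarrow> max (n \<bullet> v) 0 * (LINT y : \<rho> -` (A \<inter> C) | lborel. \<phi> (\<rho> y))"
proof (cases "n \<bullet> v > 0")
  case True
  then show ?thesis using sweep_limit_pos[OF assms(1-7) h] by simp
next
  case False
  have "(LINT x : ((+) (h k *\<^sub>R v) ` A) \<inter> C | lborel. \<phi> x) = 0" for k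
  proof -
    have "x \<in> {x. n \<bullet> x = b}" if x: "x \<in> ((+) (h k *\<^sub>R v) ` A) \<inter> C" for x
    proof -
      obtain a where a: "a \<in> A" "x = h k *\<^sub>R v + a" using x by blast
      then have "n \<bullet> x \<le> b"
        using sepA[OF a(1)] False h(1)[of k] mult_nonneg_nonpos[of "h k" "n \<bullet> v"]
        by (simp add: inner_add_right)
      then show ?thesis using sepC x by force
    qed
    moreover have "negligible {x. n \<bullet> x = b}"
      using n by (intro negligible_hyperplane) auto
    ultimately have "AE x in lborel. indicator (((+) (h k *\<^sub>R v) ` A) \<inter> C) x *\<^sub>R \<phi> x = 0"
      using AE_lborel_negligible by (force elim!: eventually_mono simp: indicator_def)
    then show ?thesis
      unfolding set_lebesgue_integral_def by (rule integral_eq_zero_AE)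
  qed
  then show ?thesis using False by simp
qed

section \<open>Translation, tiling and difference quotients of integrals\<close>

lemma set_integral_translate:
  fixes \<phi> :: "'a::euclidean_space \<Rightarrow> real"
  assumes X: "compact X" and \<phi>: "continuous_on UNIV \<phi>"
  shows "(LINT x : (+) a ` X | lborel. \<phi> x) = (LINT x : X | lborel. \<phi> (a + x))"
proof -
  have [measurable]: "(+) a ` X \<in> sets borel" "\<phi> \<in> borel_measurable borel"
    using X \<phi> by (auto intro!: borel_compact compact_translation borel_measurable_continuous_onI)
  have "(LINT x : (+) a ` X | lborel. \<phi> x)
      = (\<integral>x. indicator ((+) a ` X) x *\<^sub>R \<phi> x \<partial>distr lborel borel ((+) a))"
    unfolding set_lebesgue_integral_def lborel_distr_plus ..
  also have "\<dots> = (\<integral>x. indicator ((+) a ` X) (a + x) *\<^sub>R \<phi> (a + x) \<partial>lborel)"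
    by (subst integral_distr) auto
  also have "\<dots> = (LINT x : X | lborel. \<phi> (a + x))"
    unfolding set_lebesgue_integral_def
    by (intro Bochner_Integration.integral_cong) (auto simp: indicator_def)
  finally show ?thesis .
qed

text \<open>Different tiles have only frontier points in common, and frontiers of bodies are null;
  off them a point of X lies in exactly one tile.\<close>

lemma tile_integral:
  fixes \<phi> :: "'a::euclidean_space \<Rightarrow> real"
  assumes J: "finite J" and D: "\<And>j. j \<in> J \<Longrightarrow> body (D j)"
    and disj: "\<And>i j. i \<in> J \<Longrightarrow> j \<in> J \<Longrightarrow> i \<noteq> j \<Longrightarrow> interior (D i) \<inter> interior (D j) = {}"
    and X: "X \<subseteq> (\<Union>j\<in>J. D j)" "compact X" and \<phi>: "continuous_on UNIV \<phi>"
  shows "(LINT x : X | lborel. \<phi> x) = (\<Sum>j\<in>J. LINT x : X \<inter> D j | lborel. \<phi> x)"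
proof -
  have XD: "compact (X \<inter> D j)" if "j \<in> J" for j
    using X D[OF that] by (auto simp: body_def)
  have int: "integrable lborel (\<lambda>x. indicator (X \<inter> D j) x *\<^sub>R \<phi> x)" if "j \<in> J" for j
    using XD[OF that] continuous_on_subset[OF \<phi>] by (intro borel_integrable_compact) auto
  have "negligible (\<Union>j\<in>J. frontier (D j))"
    using J D by (intro negligible_Union) (auto simp: body_negligible_frontier)
  then have "AE x in lborel. x \<notin> (\<Union>j\<in>J. frontier (D j))"
    by (rule AE_lborel_negligible)
  then have "AE x in lborel. indicator X x *\<^sub>R \<phi> x = (\<Sum>j\<in>J. indicator (X \<inter> D j) x *\<^sub>R \<phi> x)"
  proof eventually_elim
    case (elim x)
    have i: "x \<in> interior (D j)" if "j \<in> J" "x \<in> D j" for j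
      using elim that body_closed[OF D] by (auto simp: frontier_def)
    show ?case
    proof (cases "x \<in> X")
      case True
      then obtain j where j: "j \<in> J" "x \<in> D j" using X by blast
      have "indicator (X \<inter> D j') x *\<^sub>R \<phi> x = (if j' = j then \<phi> x else 0)" if "j' \<in> J" for j'
        using i[OF j] i[OF that] disj[OF j(1) that] True j by (auto simp: indicator_def)
      then have "(\<Sum>j\<in>J. indicator (X \<inter> D j) x *\<^sub>R \<phi> x) = (\<Sum>j'\<in>J. if j' = j then \<phi> x else 0)"
        by (intro sum.cong) auto
      then show ?thesis using True J j by simp
    qed simp
  qed
  then have "(LINT x : X | lborel. \<phi> x) = (\<integral>x. (\<Sum>j\<in>J. indicator (X \<inter> D j) x *\<^sub>R \<phi> x) \<partial>lborel)"
    unfolding set_lebesgue_integral_def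
    using borel_integrable_compact[OF X(2) continuous_on_subset[OF \<phi>]] int
    by (intro integral_cong_AE) auto
  also have "\<dots> = (\<Sum>j\<in>J. LINT x : X \<inter> D j | lborel. \<phi> x)"
    unfolding set_lebesgue_integral_def by (rule Bochner_Integration.integral_sum[OF int])
  finally show ?thesis .
qed

text \<open>Dominated convergence: by the mean value theorem the quotients are bounded by the
  maximum of the directional derivative over a ball containing all segments from points of K along
  the steps.\<close>

lemma directional_difference_limit:
  fixes p :: "'a::euclidean_space \<Rightarrow> real"
  assumes K: "compact K" and p: "\<And>x. (p has_derivative p' x) (at x)"
    and p': "continuous_on UNIV (\<lambda>x. p' x v)" and h: "\<And>k. h k > 0" "h \<longlonglongrightarrow> 0"
  shows "(\<lambda>k. ((LINT x : K | lborel. p (h k *\<^sub>R v + x)) - (LINT x : K | lborel. p x)) / h k)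
    \<longlonglongrightarrow> (LINT x : K | lborel. p' x v)"
proof -
  have pc: "continuous_on UNIV p"
    using p has_derivative_continuous_on by blast
  have pc': "continuous_on UNIV (\<lambda>x. p (h k *\<^sub>R v + x))" for k
    by (intro continuous_on_compose2[OF pc] continuous_intros) auto
  define q where "q k x = (p (h k *\<^sub>R v + x) - p x) / h k" for k x
  have qc: "continuous_on UNIV (q k)" for k
    unfolding q_def[abs_def] using h(1)[of k] by (intro continuous_intros pc pc') auto
  have deriv: "((\<lambda>s. p (x + s *\<^sub>R v)) has_real_derivative p' (x + s *\<^sub>R v) v) (at s)" for x s
  proof -
    have "((\<lambda>s. p (x + s *\<^sub>R v)) has_derivative (\<lambda>t. p' (x + s *\<^sub>R v) (t *\<^sub>R v))) (at s)"
      by (rule has_derivative_compose[OF _ p]) (auto intro!: derivative_eq_intros)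
    moreover have "p' (x + s *\<^sub>R v) (t *\<^sub>R v) = p' (x + s *\<^sub>R v) v * t" for t
      using linear_scale[OF has_derivative_linear[OF p]] by simp
    ultimately show ?thesis by (simp add: has_field_derivative_def)
  qed
  obtain R where R: "\<And>x. x \<in> K \<Longrightarrow> norm x \<le> R"
    using compact_imp_bounded[OF K] by (auto simp: bounded_iff)
  obtain H where H: "\<And>k. h k \<le> H"
    using convergent_imp_Bseq[OF convergentI[OF h(2)]] unfolding Bseq_def
    by (metis abs_le_D1 real_norm_def)
  have "compact ((\<lambda>x. p' x v) ` cball 0 (R + H * norm v))"
    by (intro compact_continuous_image continuous_on_subset[OF p']) auto
  then obtain M where "\<forall>x\<in>cball 0 (R + H * norm v). \<bar>p' x v\<bar> \<le> M"
    using compact_imp_bounded[of "(\<lambda>x. p' x v) ` cball 0 (R + H * norm v)"]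
    by (auto simp: bounded_iff)
  then have M: "norm x \<le> R + H * norm v \<Longrightarrow> \<bar>p' x v\<bar> \<le> M" for x
    by simp
  have bound: "\<bar>q k x\<bar> \<le> M" if "x \<in> K" for k x
  proof -
    obtain z where z: "0 < z" "z < h k"
      "p (x + h k *\<^sub>R v) - p (x + 0 *\<^sub>R v) = (h k - 0) * p' (x + z *\<^sub>R v) v"
      using MVT2[of 0 "h k" "\<lambda>s. p (x + s *\<^sub>R v)" "\<lambda>s. p' (x + s *\<^sub>R v) v"] deriv h(1)[of k] by auto
    then have "q k x = p' (x + z *\<^sub>R v) v"
      using h(1)[of k] by (simp add: q_def field_simps add.commute)
    moreover have "norm (x + z *\<^sub>R v) \<le> R + H * norm v"
    proof -
      have "norm (x + z *\<^sub>R v) \<le> norm x + norm (z *\<^sub>R v)" by (rule norm_triangle_ineq)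
      also have "norm (z *\<^sub>R v) \<le> H * norm v"
        using z H[of k] by (simp add: mult_right_mono)
      finally show ?thesis using R[OF that] by simp
    qed
    ultimately show ?thesis using M by simp
  qed
  have K': "K \<in> sets borel" using K by (rule borel_compact)
  have "(\<lambda>k. \<integral>x. indicator K x *\<^sub>R q k x \<partial>lborel) \<longlonglongrightarrow> (\<integral>x. indicator K x *\<^sub>R p' x v \<partial>lborel)"
  proof (rule integral_dominated_convergence)
    show "(\<lambda>x. indicator K x *\<^sub>R p' x v) \<in> borel_measurable lborel"
      using borel_integrable_compact[OF K continuous_on_subset[OF p']] by auto
    show "(\<lambda>x. indicator K x *\<^sub>R q k x) \<in> borel_measurable lborel" for k
      using borel_integrable_compact[OF K continuous_on_subset[OF qc]] by auto
    show "integrable lborel (\<lambda>x. indicator K x * M)"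
      using borel_integrable_compact[OF K, of "\<lambda>_. M"] by simp
    show "AE x in lborel. norm (indicator K x *\<^sub>R q k x) \<le> indicator K x * M" for k
      using bound by (auto simp: indicator_def)
    show "AE x in lborel. (\<lambda>k. indicator K x *\<^sub>R q k x) \<longlonglongrightarrow> indicator K x *\<^sub>R p' x v"
    proof (intro AE_I2 tendsto_intros)
      fix x
      have "((\<lambda>s. (p (x + s *\<^sub>R v) - p (x + 0 *\<^sub>R v)) / (s - 0)) \<longlongrightarrow> p' (x + 0 *\<^sub>R v) v) (at 0)"
        using deriv[of x 0] by (simp add: has_field_derivative_iff)
      moreover have "filterlim h (at 0) sequentially"
        using h by (auto simp: filterlim_at intro!: always_eventually) (metis less_irrefl)
      ultimately have "(\<lambda>k. (p (x + h k *\<^sub>R v) - p (x + 0 *\<^sub>R v)) / (h k - 0)) \<longlonglongrightarrow> p' (x + 0 *\<^sub>R v) v"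
        by (rule filterlim_compose)
      then show "(\<lambda>k. q k x) \<longlonglongrightarrow> p' x v" by (simp add: q_def add.commute)
    qed
  qed
  moreover have "(\<integral>x. indicator K x *\<^sub>R q k x \<partial>lborel)
      = ((LINT x : K | lborel. p (h k *\<^sub>R v + x)) - (LINT x : K | lborel. p x)) / h k" for k
  proof -
    have "(LINT x : K | lborel. p (h k *\<^sub>R v + x)) - (LINT x : K | lborel. p x)
        = (LINT x : K | lborel. p (h k *\<^sub>R v + x) - p x)"
      using K by (intro set_integral_diff(2)[symmetric] compact_set_integrable(2))
        (auto intro: continuous_on_subset[OF pc] continuous_on_subset[OF pc'])
    then show ?thesis by (simp add: q_def set_lebesgue_integral_def)
  qed
  ultimately show ?thesis by (simp add: set_lebesgue_integral_def)
qed

section \<open>Contact of two bodies with disjoint interiors\<close>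

lemma separating_unit_normal:
  assumes A: "body A" and C: "body C" and disj: "interior A \<inter> interior C = {}"
  obtains n b where "norm n = 1" and "\<And>x. x \<in> A \<Longrightarrow> n \<bullet> x \<le> b" and "\<And>x. x \<in> C \<Longrightarrow> b \<le> n \<bullet> x"
proof -
  obtain a c where a: "a \<noteq> 0" "\<forall>x\<in>interior A. a \<bullet> x \<le> c" "\<forall>x\<in>interior C. a \<bullet> x \<ge> c"
    using separating_hyperplane_sets[OF _ _ _ _ disj] A C by (auto simp: body_def convex_interior)
  have "closure (interior A) \<subseteq> {x. a \<bullet> x \<le> c}"
    by (rule closure_minimal) (use a in \<open>auto simp: closed_halfspace_le\<close>)
  then have 1: "a \<bullet> x \<le> c" if "x \<in> A" for x
    using that body_closure_interior[OF A] by auto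
  have "closure (interior C) \<subseteq> {x. a \<bullet> x \<ge> c}"
    by (rule closure_minimal) (use a in \<open>auto simp: closed_halfspace_ge\<close>)
  then have 2: "c \<le> a \<bullet> x" if "x \<in> C" for x
    using that body_closure_interior[OF C] by auto
  show ?thesis
    by (rule that[of "a /\<^sub>R norm a" "c / norm a"])
      (use a 1 2 in \<open>auto simp: divide_simps\<close>)
qed

text \<open>An interior point of the preimage would make F two-dimensional. A convex set without
  interior lies in its frontier, which is null.\<close>

lemma plane_chart_vimage_null:
  assumes \<rho>: "plane_chart \<rho> n b" and n: "n \<noteq> 0" and F: "compact F" "convex F" "F \<subseteq> {x. n \<bullet> x = b}"
    and dim: "aff_dim F \<noteq> 2"
  shows "negligible (\<rho> -` F)"
proof -
  have "interior (\<rho> -` F) = {}"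
  proof (rule ccontr)
    assume "interior (\<rho> -` F) \<noteq> {}"
    then have "aff_dim (\<rho> -` F) = 2" by (simp add: aff_dim_nonempty_interior)
    define L where "L y = \<rho> y - \<rho> 0" for y
    have L: "linear L" unfolding L_def
      by (rule isometry_linear_part) (rule plane_chart_isometry[OF \<rho>])
    have "inj L"
    proof (rule injI)
      fix y z assume "L y = L z"
      then show "y = z" using plane_chart_isometry[OF \<rho>, of y z] by (simp add: L_def)
    qed
    then have "aff_dim ((+) (\<rho> 0) ` L ` (\<rho> -` F)) = 2"
      using L \<open>aff_dim (\<rho> -` F) = 2\<close> by (simp add: aff_dim_translation_eq)
    moreover have "(+) (\<rho> 0) ` L ` (\<rho> -` F) \<subseteq> F" by (auto simp: L_def)
    ultimately have "2 \<le> aff_dim F" by (metis aff_dim_subset)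
    moreover have "aff_dim F \<le> 2" using aff_dim_subset[OF F(3)] n by simp
    ultimately show False using dim by simp
  qed
  then have "\<rho> -` F \<subseteq> frontier (\<rho> -` F)"
    by (simp add: frontier_def closure_subset)
  moreover have "negligible (frontier (\<rho> -` F))"
    by (rule negligible_convex_frontier[OF convex_plane_chart_vimage[OF \<rho> F(2)]])
  ultimately show ?thesis by (rule negligible_subset[rotated])
qed

lemma face_integral_lborel:
  assumes \<rho>: "plane_chart (flat_chart F) n b" and F: "compact F" and \<phi>: "continuous_on UNIV \<phi>"
  shows "face_integral F \<phi> = (LINT y : flat_chart F -` F | lborel. \<phi> (flat_chart F y))"
  unfolding face_integral_def
  by (intro set_integral_lebesgue_eq_lborel compact_plane_chart_vimage[OF \<rho> F]
      continuous_on_compose2[OF \<phi>] plane_chart_continuous[OF \<rho>]) auto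

text \<open>For a two-dimensional contact the separating normal is forced to be the outward normal
  of A and the opposite of that of C, so the sweep limit can be read in the terms of the scheme.
  Otherwise any chart of the separating plane shows that the limiting face integral is over a null
  set.\<close>

lemma separated_contact_limit:
  fixes A C :: "(real^3) set"
  assumes A: "body A" and C: "body C" and disj: "interior A \<inter> interior C = {}"
    and \<phi>: "continuous_on UNIV \<phi>" and h: "\<And>k. h k > 0" "h \<longlonglongrightarrow> 0"
  shows "aff_dim (A \<inter> C) \<noteq> 2 \<Longrightarrow>
      (\<lambda>k. (LINT x : ((+) (h k *\<^sub>R v) ` A) \<inter> C | lborel. \<phi> x) / h k) \<longlonglongrightarrow> 0" (is "_ \<Longrightarrow> ?L")
    and "aff_dim (A \<inter> C) = 2 \<Longrightarrow>
      outward_normal C (A \<inter> C) = - outward_normal A (A \<inter> C) \<and>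
      norm (outward_normal A (A \<inter> C)) = 1 \<and>
      (\<exists>b. plane_chart (flat_chart (A \<inter> C)) (outward_normal A (A \<inter> C)) b) \<and>
      (\<lambda>k. (LINT x : ((+) (h k *\<^sub>R v) ` A) \<inter> C | lborel. \<phi> x) / h k)
        \<longlonglongrightarrow> max (outward_normal A (A \<inter> C) \<bullet> v) 0 * face_integral (A \<inter> C) \<phi>"
proof -
  obtain n b where n: "norm n = 1" and sA: "\<And>x. x \<in> A \<Longrightarrow> n \<bullet> x \<le> b"
    and sC: "\<And>x. x \<in> C \<Longrightarrow> b \<le> n \<bullet> x"
    using separating_unit_normal[OF A C disj] by metis
  have F: "compact (A \<inter> C)" "convex (A \<inter> C)" "A \<inter> C \<subseteq> {x. n \<bullet> x = b}"
    using A C sA sC by (auto simp: body_def convex_Int intro: antisym)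
  show ?L if d: "aff_dim (A \<inter> C) \<noteq> 2"
  proof -
    obtain \<rho> where \<rho>: "plane_chart \<rho> n b" using plane_chart_exists[OF n] by blast
    have "n \<noteq> 0" using n by auto
    then have "AE y in lborel. y \<notin> \<rho> -` (A \<inter> C)"
      using plane_chart_vimage_null[OF \<rho> _ F d] by (intro AE_lborel_negligible)
    then have "AE y in lborel. indicator (\<rho> -` (A \<inter> C)) y *\<^sub>R \<phi> (\<rho> y) = 0"
      by eventually_elim simp
    then have "(LINT y : \<rho> -` (A \<inter> C) | lborel. \<phi> (\<rho> y)) = 0"
      unfolding set_lebesgue_integral_def by (rule integral_eq_zero_AE)
    then show ?thesis using sweep_limit[OF A C n sA sC \<rho> \<phi> h, of v] by simp
  qed
  assume d: "aff_dim (A \<inter> C) = 2"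
  have nA: "outward_normal A (A \<inter> C) = n"
    using A d n F(3) sA by (intro outward_normal_eq) (auto simp: body_def)
  have nC: "outward_normal C (A \<inter> C) = - n"
    using C d n F(3) sC by (intro outward_normal_eq) (auto simp: body_def)
  have \<rho>: "plane_chart (flat_chart (A \<inter> C)) n b" by (rule flat_chart_plane[OF n F(3) d])
  show "outward_normal C (A \<inter> C) = - outward_normal A (A \<inter> C) \<and>
      norm (outward_normal A (A \<inter> C)) = 1 \<and>
      (\<exists>b. plane_chart (flat_chart (A \<inter> C)) (outward_normal A (A \<inter> C)) b) \<and>
      (\<lambda>k. (LINT x : ((+) (h k *\<^sub>R v) ` A) \<inter> C | lborel. \<phi> x) / h k)
        \<longlonglongrightarrow> max (outward_normal A (A \<inter> C) \<bullet> v) 0 * face_integral (A \<inter> C) \<phi>"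
    using sweep_limit[OF A C n sA sC \<rho> \<phi> h, of v] face_integral_lborel[OF \<rho> F(1) \<phi>] \<rho> n nA nC
    by auto
qed

section \<open>The divergence theorem on a periodic mesh\<close>

lemma mem_cbox_vec: "(x :: real^'n) \<in> cbox (vec (- L)) (vec L) \<longleftrightarrow> (\<forall>i. \<bar>x $ i\<bar> \<le> L)"
  by (auto simp: mem_box_cart abs_le_iff minus_le_iff)

lemma mem_box_vec: "(x :: real^'n) \<in> box (vec (- L)) (vec L) \<longleftrightarrow> (\<forall>i. \<bar>x $ i\<bar> < L)"
  by (auto simp: mem_box_cart abs_less_iff minus_less_iff)

lemma closure_Omega_x:
  assumes "L > 0" shows "closure (Omega_x L) = cbox (vec (- L)) (vec L)"
proof
  show "closure (Omega_x L) \<subseteq> cbox (vec (- L)) (vec L)"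
    by (rule closure_minimal) (auto simp: Omega_x_def mem_box_cart less_imp_le)
  have "box (vec (- L)) (vec L) \<noteq> ({} :: (real^3) set)"
    using assms by (simp add: interval_ne_empty_cart)
  then have "cbox (vec (- L)) (vec L) = closure (box (vec (- L)) (vec L) :: (real^3) set)"
    by simp
  also have "\<dots> \<subseteq> closure (Omega_x L)"
    by (rule closure_mono) (auto simp: Omega_x_def mem_box_cart less_imp_le)
  finally show "cbox (vec (- L)) (vec L) \<subseteq> closure (Omega_x L)" .
qed

text \<open>For positive L these 27 shifts tile, from the basic box, the box three times as wide. It
  contains every element after a translation by at most 2 L in each coordinate.\<close>

definition neighbour_shifts :: "real \<Rightarrow> (real^3) set" where
  "neighbour_shifts L = {s. \<forall>i. s $ i \<in> {- 2 * L, 0, 2 * L}}"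

lemma finite_neighbour_shifts: "finite (neighbour_shifts L)"
proof (rule finite_subset)
  show "neighbour_shifts L \<subseteq>
      (\<lambda>(a, b, c). vector [a, b, c]) ` ({- 2 * L, 0, 2 * L} \<times> {- 2 * L, 0, 2 * L} \<times> {- 2 * L, 0, 2 * L})"
  proof
    fix s assume s: "s \<in> neighbour_shifts L"
    show "s \<in> (\<lambda>(a, b, c). vector [a, b, c]) `
        ({- 2 * L, 0, 2 * L} \<times> {- 2 * L, 0, 2 * L} \<times> {- 2 * L, 0, 2 * L})"
    proof (rule image_eqI[where x="(s$1, s$2, s$3)"])
      show "s = (case (s$1, s$2, s$3) of (a, b, c) \<Rightarrow> vector [a, b, c])"
        by (simp add: vec_eq_iff forall_3 vector_3)
    qed (intro SigmaI, use s in \<open>auto simp: neighbour_shifts_def\<close>)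
  qed
qed simp

lemma neighbour_shifts_uminus: "s \<in> neighbour_shifts L \<Longrightarrow> - s \<in> neighbour_shifts L"
proof -
  assume s: "s \<in> neighbour_shifts L"
  have "(- s) $ i \<in> {- 2 * L, 0, 2 * L}" for i
    using s by (auto simp: neighbour_shifts_def dest: spec[of _ i])
  then show ?thesis by (simp add: neighbour_shifts_def)
qed

lemma zero_neighbour_shifts: "0 \<in> neighbour_shifts L"
  by (simp add: neighbour_shifts_def)

lemma neighbour_shifts_lattice: "neighbour_shifts L \<subseteq> period_lattice L"
proof
  fix s assume s: "s \<in> neighbour_shifts L"
  have "\<exists>m::int. s $ i = 2 * L * of_int m" for i
  proof -
    consider "s $ i = - 2 * L" | "s $ i = 0" | "s $ i = 2 * L"
      using s by (auto simp: neighbour_shifts_def)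
    then show ?thesis
      by cases (auto intro: exI[of _ "- 1"] exI[of _ 0] exI[of _ 1])
  qed
  then show "s \<in> period_lattice L" by (simp add: period_lattice_def)
qed

lemma period_lattice_uminus: "s \<in> period_lattice L \<Longrightarrow> - s \<in> period_lattice L"
  unfolding period_lattice_def by (auto) (metis mult_minus_right of_int_minus)

lemma period_lattice_diff_small:
  assumes L: "L > 0" and s: "s \<in> period_lattice L" and s': "s' \<in> period_lattice L"
    and small: "\<And>i. \<bar>s $ i - s' $ i\<bar> < 2 * L"
  shows "s = s'"
proof (simp only: vec_eq_iff, intro allI)
  fix i
  obtain m m' :: int where m: "s $ i = 2 * L * of_int m" "s' $ i = 2 * L * of_int m'"
    using s s' by (auto simp: period_lattice_def) metis
  have "2 * L * \<bar>of_int (m - m')\<bar> < 2 * L"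
    using small[of i] L by (simp add: m abs_mult flip: right_diff_distrib)
  then have "\<bar>of_int (m - m') :: real\<bar> < 1" using L by simp
  then have "m = m'" by linarith
  then show "s $ i = s' $ i" by (simp add: m)
qed

lemma shifts_near:
  assumes L: "L > 0" and s: "s \<in> period_lattice L" and small: "\<And>i. \<bar>s $ i\<bar> \<le> 2 * L"
  shows "s \<in> neighbour_shifts L"
proof -
  have "s $ i \<in> {- 2 * L, 0, 2 * L}" for i
  proof -
    obtain m :: int where m: "s $ i = 2 * L * of_int m"
      using s by (auto simp: period_lattice_def)
    have "2 * L * \<bar>of_int m\<bar> \<le> 2 * L" using small[of i] L by (simp add: m abs_mult)
    then have "\<bar>of_int m :: real\<bar> \<le> 1" using L by simp
    then have "m = - 1 \<or> m = 0 \<or> m = 1" by linarith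
    then show ?thesis using m by auto
  qed
  then show ?thesis by (simp add: neighbour_shifts_def)
qed

context
  fixes L :: real and T :: "(real^3) set set"
  assumes L: "L > 0" and mesh: "mesh T (Omega_x L)"
begin

lemma periodic_mesh_subset: "K \<in> T \<Longrightarrow> x \<in> K \<Longrightarrow> \<bar>x $ i\<bar> \<le> L"
  using mesh closure_Omega_x[OF L] mem_cbox_vec[of x L] unfolding mesh_def by blast

lemma periodic_mesh_interior:
  assumes "K \<in> T" "x \<in> interior K" shows "\<bar>x $ i\<bar> < L"
proof -
  have "K \<subseteq> cbox (vec (- L)) (vec L)"
    using periodic_mesh_subset[OF assms(1)] by (auto simp: mem_cbox_vec)
  then have "interior K \<subseteq> box (vec (- L)) (vec L)" using interior_mono interior_cbox by blast
  then show ?thesis using assms(2) mem_box_vec by blast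
qed

text \<open>Interior points of elements lie strictly inside the box, so a common point of two
  translates bounds each coordinate of the difference of the shifts strictly by the period. Lattice
  shifts this close are equal, and disjointness within one copy of the mesh remains.\<close>

lemma periodic_disjoint:
  assumes K: "K \<in> T" "K' \<in> T" and s: "s \<in> period_lattice L" "s' \<in> period_lattice L"
    and ne: "(K, s) \<noteq> (K', s')"
  shows "interior ((+) s ` K) \<inter> interior ((+) s' ` K') = {}"
proof (rule ccontr)
  assume "\<not> ?thesis"
  then obtain x y where x: "x \<in> interior K" "y \<in> interior K'" "s + x = s' + y"
    by (auto simp: interior_translation)
  have "s = s'"
  proof (rule period_lattice_diff_small[OF L s])
    fix i
    have "s $ i + x $ i = s' $ i + y $ i" using x(3) by (metis vector_add_component)
    then show "\<bar>s $ i - s' $ i\<bar> < 2 * L"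
      using periodic_mesh_interior[OF K(1) x(1), of i] periodic_mesh_interior[OF K(2) x(2), of i]
      by linarith
  qed
  moreover from this have "x = y" using x(3) by simp
  then have "K = K'" using x K mesh by (auto simp: mesh_def pairwise_def)
  ultimately show False using ne by simp
qed

lemma periodic_cover:
  assumes x: "\<And>i. \<bar>x $ i\<bar> \<le> 3 * L"
  shows "x \<in> (\<Union>(K, s)\<in>T \<times> neighbour_shifts L. (+) s ` K)"
proof -
  \<comment> \<open>In each coordinate, the multiple of the period that brings x back into the basic
    box.\<close>
  define s :: "real^3" where
    "s = (\<chi> i. if x $ i < - L then - 2 * L else if x $ i > L then 2 * L else 0)"
  have s: "s \<in> neighbour_shifts L" by (simp add: neighbour_shifts_def s_def)
  have "\<bar>(x - s) $ i\<bar> \<le> L" for i using x[of i] L by (auto simp: s_def)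
  then have "x - s \<in> cbox (vec (- L)) (vec L)" by (simp add: mem_cbox_vec)
  then have "x - s \<in> \<Union>T"
    using mesh closure_Omega_x[OF L] by (simp add: mesh_def)
  then obtain K where K: "K \<in> T" "x - s \<in> K" by blast
  then have "x \<in> (+) s ` K" by (metis diff_add_cancel add.commute imageI)
  with K s show ?thesis by auto
qed

text \<open>Edge labels range over the infinite lattice, but a nonempty face forces its two elements
  to lie in adjacent copies of the box. Hence there are only finitely many edges, all of which the
  finite tiling sees.\<close>

lemma labelled_edges_near:
  assumes "(K, K', s) \<in> labelled_edges T (period_lattice L)"
  shows "s \<in> neighbour_shifts L"
proof (rule shifts_near[OF L])
  show "s \<in> period_lattice L" using assms by (simp add: labelled_edges_def)
  have "edge_face (K, K', s) \<noteq> {}" using assms by (auto simp: labelled_edges_def)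
  then obtain x y where x: "x \<in> K" "y \<in> K'" "x = s + y" by auto
  moreover have "K \<in> T" "K' \<in> T" using assms by (auto simp: labelled_edges_def)
  ultimately show "\<bar>s $ i\<bar> \<le> 2 * L" for i
    using periodic_mesh_subset[of K x i] periodic_mesh_subset[of K' y i] by simp
qed

end

section \<open>Reversal of edges, and overlaps of translated elements\<close>

fun rev_edge :: "edge \<Rightarrow> edge" where
  "rev_edge (K, K', s) = (K', K, - s)"

lemma rev_rev_edge [simp]: "rev_edge (rev_edge e) = e"
  by (cases e) simp

lemma edge_face_rev: "edge_face (K', K, - s) = (+) (- s) ` edge_face (K, K', s)"
  by (auto simp: image_iff algebra_simps) (metis add.commute add_diff_cancel_left' diff_add_cancel)+

lemma labelled_edges_rev:
  "e \<in> labelled_edges T (period_lattice L) \<Longrightarrow> rev_edge e \<in> labelled_edges T (period_lattice L)"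
proof (cases e)
  case (fields K K' s)
  assume e: "e \<in> labelled_edges T (period_lattice L)"
  have "aff_dim (edge_face (K', K, - s)) = aff_dim (edge_face (K, K', s))"
    by (simp only: edge_face_rev aff_dim_translation_eq)
  then show ?thesis
    using e by (auto simp: fields labelled_edges_def period_lattice_uminus simp del: edge_face.simps)
qed

text \<open>Lets a sum over all labelled edges be written as a sum over \<open>\<E>\<close> in which
  each edge is paired with its reverse.\<close>

lemma labelled_edges_partition:
  assumes "edge_set T (period_lattice L) \<E>"
  shows "labelled_edges T (period_lattice L) = \<E> \<union> rev_edge ` \<E>" "\<E> \<inter> rev_edge ` \<E> = {}"
proof -
  have sub: "\<E> \<subseteq> labelled_edges T (period_lattice L)" using assms by (simp add: edge_set_def)
  have ex: "(e \<in> \<E>) \<noteq> (rev_edge e \<in> \<E>)" if "e \<in> labelled_edges T (period_lattice L)" for e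
    using assms that unfolding edge_set_def by (cases e) auto
  show "labelled_edges T (period_lattice L) = \<E> \<union> rev_edge ` \<E>"
  proof (intro set_eqI iffI)
    fix e assume "e \<in> labelled_edges T (period_lattice L)"
    then show "e \<in> \<E> \<union> rev_edge ` \<E>" using ex by (metis UnCI imageI rev_rev_edge)
  qed (use sub labelled_edges_rev in auto)
  show "\<E> \<inter> rev_edge ` \<E> = {}" using ex sub by auto
qed

text \<open>The family \<open>p\<close> gives each element its own smooth function on all of space,
  so the jump across an edge makes sense also on an overlap near the face and not only on the face
  itself.\<close>

fun edge_diff :: "((real^3) set \<Rightarrow> real^3 \<Rightarrow> real) \<Rightarrow> edge \<Rightarrow> real^3 \<Rightarrow> real" where
  "edge_diff p (K, K', s) x = p K x - p K' (x - s)"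

fun overlap :: "((real^3) set \<Rightarrow> real^3 \<Rightarrow> real) \<Rightarrow> real^3 \<Rightarrow> edge \<Rightarrow> real" where
  "overlap p w (K, K', s) =
    (LINT x : ((+) w ` K) \<inter> ((+) s ` K') | lborel. edge_diff p (K, K', s) x)"

lemma continuous_on_edge_diff:
  assumes "\<And>K. continuous_on UNIV (p K)" shows "continuous_on UNIV (edge_diff p e)"
proof (cases e)
  case (fields K K' s)
  have "edge_diff p e = (\<lambda>x. p K x - p K' (x - s))" by (simp add: fields fun_eq_iff)
  then show ?thesis
    by (auto intro!: continuous_intros assms continuous_on_compose2[OF assms])
qed

context
  fixes L :: real and T :: "(real^3) set set"
  assumes L: "L > 0" and mesh: "mesh T (Omega_x L)"
begin

text \<open>Both the translated elements \<open>K + w\<close> and the original ones are cut along the periodic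
  tiling; what does not cancel is supported on the overlaps of different elements.\<close>

lemma periodic_translation_identity:
  assumes p: "\<And>K. continuous_on UNIV (p K)" and w: "\<And>i. \<bar>w $ i\<bar> \<le> 2 * L"
  shows "(\<Sum>K\<in>T. (LINT x : K | lborel. p K (w + x)) - (LINT x : K | lborel. p K x))
    = (\<Sum>e\<in>T \<times> T \<times> neighbour_shifts L. overlap p w e)"
proof -
  let ?S = "neighbour_shifts L"
  have fin: "finite (T \<times> ?S)" using mesh finite_neighbour_shifts by (simp add: mesh_def)
  have body: "body K" if "K \<in> T" for K using mesh_body[OF mesh that] .
  have cpt: "compact K" if "K \<in> T" for K using body[OF that] by (simp add: body_def)
  have tile: "(LINT x : X | lborel. \<phi> x) = (\<Sum>(K, s)\<in>T \<times> ?S. LINT x : X \<inter> ((+) s ` K) | lborel. \<phi> x)"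
    if X: "compact X" "\<And>x i. x \<in> X \<Longrightarrow> \<bar>x $ i\<bar> \<le> 3 * L" and \<phi>: "continuous_on UNIV \<phi>"
    for X and \<phi> :: "real^3 \<Rightarrow> real"
  proof -
    have "(LINT x : X | lborel. \<phi> x)
        = (\<Sum>j\<in>T \<times> ?S. LINT x : X \<inter> (case j of (K, s) \<Rightarrow> (+) s ` K) | lborel. \<phi> x)"
    proof (rule tile_integral[OF fin _ _ _ X(1) \<phi>])
      show "body (case j of (K, s) \<Rightarrow> (+) s ` K)" if "j \<in> T \<times> ?S" for j
        using that body by (auto simp: body_translation)
      show "interior (case i of (K, s) \<Rightarrow> (+) s ` K) \<inter> interior (case j of (K, s) \<Rightarrow> (+) s ` K) = {}"
        if "i \<in> T \<times> ?S" "j \<in> T \<times> ?S" "i \<noteq> j" for i j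
      proof -
        obtain K s K' s' where ij: "i = (K, s)" "j = (K', s')" by (cases i, cases j)
        show ?thesis
          unfolding ij prod.case
          by (rule periodic_disjoint[OF L mesh]) (use that ij neighbour_shifts_lattice[of L] in auto)
      qed
      show "X \<subseteq> (\<Union>j\<in>T \<times> ?S. case j of (K, s) \<Rightarrow> (+) s ` K)"
        using periodic_cover[OF L mesh X(2)] by blast
    qed
    then show ?thesis by (simp add: case_prod_unfold)
  qed
  have bnd: "\<bar>(w + x) $ i\<bar> \<le> 3 * L" "\<bar>(x - w) $ i\<bar> \<le> 3 * L" if "K \<in> T" "x \<in> K" for x i K
    using w[of i] periodic_mesh_subset[OF L mesh that, of i] by auto
  have c1: "continuous_on UNIV (\<lambda>x. p K (a + x))" for K a
    by (intro continuous_on_compose2[OF p] continuous_intros) auto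
  have c2: "continuous_on UNIV (\<lambda>x. p K (x - a))" for K a
    by (intro continuous_on_compose2[OF p] continuous_intros) auto
  have first: "(LINT x : K | lborel. p K (w + x))
      = (\<Sum>(K', s)\<in>T \<times> ?S. LINT x : ((+) w ` K) \<inter> ((+) s ` K') | lborel. p K x)" if K: "K \<in> T" for K
  proof -
    have "(LINT x : K | lborel. p K (w + x)) = (LINT x : (+) w ` K | lborel. p K x)"
      by (rule set_integral_translate[symmetric, OF cpt[OF K] p])
    also have "\<dots> = (\<Sum>(K', s)\<in>T \<times> ?S. LINT x : ((+) w ` K) \<inter> ((+) s ` K') | lborel. p K x)"
      by (rule tile) (use K cpt bnd p in \<open>auto intro: compact_translation\<close>)
    finally show ?thesis .
  qed
  have second: "(LINT x : K' | lborel. p K' x)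
      = (\<Sum>(K, s)\<in>T \<times> ?S. LINT x : ((+) w ` K) \<inter> ((+) s ` K') | lborel. p K' (x - s))"
    if K': "K' \<in> T" for K'
  proof -
    \<comment> \<open>Cutting K' along the translated tiling is the same as cutting K' - w along the
      fixed one, so \<open>tile\<close> serves for this sum too.\<close>
    let ?Y = "(+) (- w) ` K'"
    have Y: "compact ?Y" using cpt[OF K'] by (rule compact_translation)
    have "(LINT x : K' | lborel. p K' x) = (LINT x : (+) w ` ?Y | lborel. p K' x)"
      by (simp add: image_image)
    also have "\<dots> = (LINT x : ?Y | lborel. p K' (w + x))"
      by (rule set_integral_translate[OF Y p])
    also have "\<dots> = (\<Sum>(K, s)\<in>T \<times> ?S. LINT x : ?Y \<inter> ((+) s ` K) | lborel. p K' (w + x))"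
      by (rule tile[OF Y _ c1]) (use bnd[OF K'] in auto)
    also have "\<dots> = (\<Sum>(K, s)\<in>T \<times> ?S. LINT x : ((+) w ` K) \<inter> ((+) (- s) ` K') | lborel. p K' (x - (- s)))"
    proof (intro sum.cong refl, clarify)
      fix K s assume K: "K \<in> T"
      \<comment> \<open>Moving by \<open>w - s\<close> brings the piece into the form occurring in
        \<open>overlap\<close>, but with the shift - s. Symmetry of the shift set under negation
        then corrects the sign.\<close>
      have "(+) w ` K \<inter> (+) (- s) ` K' = (+) (w - s) ` (?Y \<inter> (+) s ` K)"
        by (simp add: image_Int[OF inj_on_add] image_image Int_commute)
      moreover have "(LINT x : (+) (w - s) ` (?Y \<inter> (+) s ` K) | lborel. p K' (x - (- s)))
          = (LINT x : ?Y \<inter> (+) s ` K | lborel. p K' (w - s + x - (- s)))"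
        by (rule set_integral_translate[OF _ c2]) (use Y K cpt in \<open>auto intro: compact_translation\<close>)
      ultimately show "(LINT x : ?Y \<inter> (+) s ` K | lborel. p K' (w + x))
          = (LINT x : ((+) w ` K) \<inter> ((+) (- s) ` K') | lborel. p K' (x - (- s)))"
        by (simp add: algebra_simps)
    qed
    also have "\<dots> = (\<Sum>(K, s)\<in>T \<times> ?S. LINT x : ((+) w ` K) \<inter> ((+) s ` K') | lborel. p K' (x - s))"
      by (rule sum.reindex_bij_witness[of _ "\<lambda>(K, s). (K, - s)" "\<lambda>(K, s). (K, - s)"])
        (auto simp: neighbour_shifts_uminus)
    finally show ?thesis .
  qed
  have split: "overlap p w (K, K', s) = (LINT x : ((+) w ` K) \<inter> ((+) s ` K') | lborel. p K x)
      - (LINT x : ((+) w ` K) \<inter> ((+) s ` K') | lborel. p K' (x - s))"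
    if "K \<in> T" "K' \<in> T" for K K' s
    unfolding overlap.simps edge_diff.simps
    using that cpt
    by (intro set_integral_diff(2) compact_set_integrable(2) continuous_on_subset[OF p]
        continuous_on_subset[OF c2] compact_Int) (auto intro: compact_translation)
  have "(\<Sum>K\<in>T. LINT x : K | lborel. p K (w + x))
      = (\<Sum>(K, K', s)\<in>T \<times> T \<times> ?S. LINT x : ((+) w ` K) \<inter> ((+) s ` K') | lborel. p K x)"
    using first by (simp add: sum.cartesian_product')
  moreover have "(\<Sum>K'\<in>T. LINT x : K' | lborel. p K' x)
      = (\<Sum>(K', K, s)\<in>T \<times> T \<times> ?S. LINT x : ((+) w ` K) \<inter> ((+) s ` K') | lborel. p K' (x - s))"
    using second by (simp add: sum.cartesian_product')
  moreover have "\<dots> = (\<Sum>(K, K', s)\<in>T \<times> T \<times> ?S. LINT x : ((+) w ` K) \<inter> ((+) s ` K') | lborel. p K' (x - s))"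
    by (rule sum.reindex_bij_witness[of _ "\<lambda>(K, K', s). (K', K, s)" "\<lambda>(K, K', s). (K', K, s)"]) auto
  ultimately have "(\<Sum>K\<in>T. (LINT x : K | lborel. p K (w + x)) - (LINT x : K | lborel. p K x))
      = (\<Sum>(K, K', s)\<in>T \<times> T \<times> ?S. (LINT x : ((+) w ` K) \<inter> ((+) s ` K') | lborel. p K x)
        - (LINT x : ((+) w ` K) \<inter> ((+) s ` K') | lborel. p K' (x - s)))"
    by (simp add: sum_subtractf case_prod_unfold)
  also have "\<dots> = (\<Sum>e\<in>T \<times> T \<times> ?S. overlap p w e)"
    by (intro sum.cong refl) (clarify, simp only: split)
  finally show ?thesis .
qed

text \<open>A triple can fail to be an edge in two ways. If an element is compared with itself
  unshifted, the integrand is identically zero; if the contact is not two-dimensional, the overlap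
  integral is of smaller order than the step.\<close>

lemma overlap_limit_degenerate:
  assumes p: "\<And>K. continuous_on UNIV (p K)" and h: "\<And>k. h k > 0" "h \<longlonglongrightarrow> 0"
    and e: "e \<in> T \<times> T \<times> neighbour_shifts L" "e \<notin> labelled_edges T (period_lattice L)"
  shows "(\<lambda>k. overlap p (h k *\<^sub>R v) e / h k) \<longlonglongrightarrow> 0"
proof (cases e)
  case (fields K K' s)
  then have K: "K \<in> T" "K' \<in> T" and s: "s \<in> neighbour_shifts L" using e by auto
  have s': "s \<in> period_lattice L" using s neighbour_shifts_lattice by blast
  show ?thesis
  proof (cases "K = K' \<and> s = 0")
    case True
    then show ?thesis by (simp add: fields set_lebesgue_integral_def)
  next
    case False
    have "interior ((+) 0 ` K) \<inter> interior ((+) s ` K') = {}"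
      by (rule periodic_disjoint[OF L mesh K _ s'])
        (use False zero_neighbour_shifts neighbour_shifts_lattice in auto)
    then have "interior K \<inter> interior ((+) s ` K') = {}" by simp
    moreover have "aff_dim (K \<inter> (+) s ` K') \<noteq> 2"
      using e(2) False K s' by (auto simp: fields labelled_edges_def)
    ultimately show ?thesis
      using separated_contact_limit(1)[OF mesh_body[OF mesh K(1)] body_translation[OF mesh_body[OF mesh K(2)]]
          _ continuous_on_edge_diff[OF p] h]
      by (simp add: fields del: edge_diff.simps)
  qed
qed

lemma labelled_edge_normals:
  assumes e: "e \<in> labelled_edges T (period_lattice L)"
  shows "norm (normal_plus e) = 1" "normal_minus e = - normal_plus e"
    "\<exists>b. plane_chart (flat_chart (edge_face e)) (normal_plus e) b" "compact (edge_face e)"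
proof -
  obtain K K' s where fields: "e = (K, K', s)" by (cases e)
  have K: "K \<in> T" "K' \<in> T" and s: "s \<in> period_lattice L" and ne: "K \<noteq> K' \<or> s \<noteq> 0"
    and d: "aff_dim (K \<inter> (+) s ` K') = 2"
    using e by (auto simp: fields labelled_edges_def)
  have "interior ((+) 0 ` K) \<inter> interior ((+) s ` K') = {}"
    by (rule periodic_disjoint[OF L mesh K _ s])
      (use ne zero_neighbour_shifts neighbour_shifts_lattice in auto)
  then have "interior K \<inter> interior ((+) s ` K') = {}" by simp
  \<comment> \<open>Instantiated with a constant function and the steps 1/(k+1), in order to read
    off the facts about normals and chart.\<close>
  note lim = separated_contact_limit(2)[OF mesh_body[OF mesh K(1)] body_translation[OF mesh_body[OF mesh K(2)]]
    this continuous_on_const _ LIMSEQ_inverse_real_of_nat d, of 0 0]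
  show "norm (normal_plus e) = 1" "normal_minus e = - normal_plus e"
    "\<exists>b. plane_chart (flat_chart (edge_face e)) (normal_plus e) b"
    using lim by (auto simp: fields)
  show "compact (edge_face e)"
    using mesh_body[OF mesh] K by (auto simp: fields body_def intro: compact_translation)
qed

text \<open>Each orientation alone gives a one-sided factor. Reversing the edge negates both the
  normal and the difference, and max a 0 - max (- a) 0 = a.\<close>

lemma overlap_limit_edge:
  assumes p: "\<And>K. continuous_on UNIV (p K)" and h: "\<And>k. h k > 0" "h \<longlonglongrightarrow> 0"
    and e: "e \<in> labelled_edges T (period_lattice L)"
  shows "(\<lambda>k. (overlap p (h k *\<^sub>R v) e + overlap p (h k *\<^sub>R v) (rev_edge e)) / h k)
    \<longlonglongrightarrow> (normal_plus e \<bullet> v) * face_integral (edge_face e) (edge_diff p e)"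
proof -
  obtain K K' s where fields: "e = (K, K', s)" by (cases e)
  have K: "K \<in> T" "K' \<in> T" and s: "s \<in> period_lattice L" and ne: "K \<noteq> K' \<or> s \<noteq> 0"
    and d: "aff_dim (K \<inter> (+) s ` K') = 2"
    using e by (auto simp: fields labelled_edges_def)
  have "interior ((+) 0 ` K) \<inter> interior ((+) s ` K') = {}"
    by (rule periodic_disjoint[OF L mesh K _ s])
      (use ne zero_neighbour_shifts neighbour_shifts_lattice in auto)
  then have disj: "interior K \<inter> interior ((+) s ` K') = {}" "interior ((+) s ` K') \<inter> interior K = {}"
    by auto
  have b: "body K" "body ((+) s ` K')"
    using mesh_body[OF mesh] K by (auto intro: body_translation)
  define F where "F = K \<inter> (+) s ` K'"
  define \<phi> where "\<phi> = edge_diff p e"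
  have \<phi>: "continuous_on UNIV \<phi>" unfolding \<phi>_def by (rule continuous_on_edge_diff[OF p])
  have lim1: "(\<lambda>k. overlap p (h k *\<^sub>R v) e / h k)
      \<longlonglongrightarrow> max (normal_plus e \<bullet> v) 0 * face_integral F \<phi>"
    using separated_contact_limit(2)[OF b disj(1) \<phi> h d, of v]
    by (simp add: fields \<phi>_def F_def del: edge_diff.simps)
  \<comment> \<open>A shift by s brings the overlap of the reversed edge to the face of the original
    one, where its integrand is the negative of \<open>\<phi>\<close>.\<close>
  have rev: "overlap p w (rev_edge e) = (LINT x : ((+) w ` (+) s ` K') \<inter> K | lborel. - \<phi> x)" for w
  proof -
    have "(+) w ` (+) s ` K' \<inter> K = (+) s ` (((+) w ` K') \<inter> ((+) (- s) ` K))"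
      by (simp add: image_Int[OF inj_on_add] image_image add.left_commute)
    moreover have "(LINT x : (+) s ` (((+) w ` K') \<inter> ((+) (- s) ` K)) | lborel. - \<phi> x)
        = (LINT x : ((+) w ` K') \<inter> ((+) (- s) ` K) | lborel. - \<phi> (s + x))"
      by (intro set_integral_translate compact_Int compact_translation continuous_on_minus \<phi>)
        (use K mesh_body[OF mesh] in \<open>auto simp: body_def\<close>)
    moreover have "edge_diff p (K', K, - s) = (\<lambda>x. - \<phi> (s + x))"
      by (simp add: fun_eq_iff \<phi>_def fields add.commute)
    ultimately show ?thesis by (simp add: fields del: edge_diff.simps)
  qed
  have neg: "continuous_on UNIV (\<lambda>x. - \<phi> x)" by (intro continuous_intros \<phi>)
  have comm: "(+) s ` K' \<inter> K = F" by (auto simp: F_def)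
  have "face_integral F (\<lambda>x. - \<phi> x) = - face_integral F \<phi>"
    by (simp add: face_integral_def set_lebesgue_integral_def)
  then have lim2: "(\<lambda>k. overlap p (h k *\<^sub>R v) (rev_edge e) / h k)
      \<longlonglongrightarrow> - (max (- normal_plus e \<bullet> v) 0 * face_integral F \<phi>)"
    using separated_contact_limit(2)[OF b(2,1) disj(2) neg h, of v] d labelled_edge_normals(2)[OF e]
    by (simp add: rev comm F_def[symmetric]) (simp add: fields F_def del: edge_diff.simps)
  have "max (normal_plus e \<bullet> v) 0 * I + - (max (- normal_plus e \<bullet> v) 0 * I) = (normal_plus e \<bullet> v) * I" for I
    by (auto simp: max_def algebra_simps)
  then show ?thesis
    using tendsto_add[OF lim1 lim2] by (simp add: add_divide_distrib F_def[symmetric] fields \<phi>_def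
        del: edge_diff.simps)
qed

text \<open>Periodicity leaves no outer boundary, so contacts between elements account for every
  boundary contribution. One direction v is treated at a time because translation produces
  directional derivatives; a divergence is obtained by summing over the axes.\<close>

theorem discrete_divergence:
  assumes \<E>: "edge_set T (period_lattice L) \<E>"
    and p: "\<And>K x. (p K has_derivative p' K x) (at x)"
    and p': "\<And>K. continuous_on UNIV (\<lambda>x. p' K x v)"
  shows "(\<Sum>K\<in>T. LINT x : K | lborel. p' K x v)
    = (\<Sum>e\<in>\<E>. (normal_plus e \<bullet> v) * face_integral (edge_face e) (edge_diff p e))"
proof -
  let ?P = "T \<times> T \<times> neighbour_shifts L"
  let ?\<Lambda> = "labelled_edges T (period_lattice L)"
  have pc: "continuous_on UNIV (p K)" for K using p has_derivative_continuous_on by blast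
  have finT: "finite T" using mesh by (simp add: mesh_def)
  have finP: "finite ?P" using finT finite_neighbour_shifts by simp
  have sub: "?\<Lambda> \<subseteq> ?P"
    using labelled_edges_near[OF L mesh] by (auto simp: labelled_edges_def)
  note part = labelled_edges_partition[OF \<E>]
  have fin\<E>: "finite \<E>" using part(1) sub finP finite_subset by (metis Un_upper1)
  \<comment> \<open>Makes every step h v of length at most L, within the range of the translation
    identity. The added 1 keeps the denominator positive when v = 0.\<close>
  define \<epsilon> where "\<epsilon> = L / (norm v + 1)"
  define h where "h k = \<epsilon> * inverse (real (Suc k))" for k
  have \<epsilon>: "\<epsilon> > 0" using L by (simp add: \<epsilon>_def add_nonneg_pos)
  have h: "h k > 0" for k using \<epsilon> by (simp add: h_def)
  have "(\<lambda>k. \<epsilon> * inverse (real (Suc k))) \<longlonglongrightarrow> \<epsilon> * 0"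
    by (intro tendsto_intros LIMSEQ_inverse_real_of_nat)
  then have hl: "h \<longlonglongrightarrow> 0" by (simp add: h_def[abs_def])
  have small: "\<bar>(h k *\<^sub>R v) $ i\<bar> \<le> 2 * L" for k i
  proof -
    have "h k \<le> \<epsilon>" using \<epsilon> by (simp add: h_def field_simps)
    have "\<bar>(h k *\<^sub>R v) $ i\<bar> \<le> norm (h k *\<^sub>R v)" by (rule component_le_norm_cart)
    also have "\<dots> \<le> \<epsilon> * norm v" using h[of k] \<open>h k \<le> \<epsilon>\<close> by (simp add: mult_right_mono)
    also have "\<epsilon> * norm v \<le> \<epsilon> * (norm v + 1)" using \<epsilon> by simp
    also have "norm v + 1 \<noteq> 0" using norm_ge_zero[of v] by linarith
    then have "\<epsilon> * (norm v + 1) = L" by (simp add: \<epsilon>_def)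
    finally show ?thesis using L by simp
  qed
  define A where "A k = (\<Sum>K\<in>T. (LINT x : K | lborel. p K (h k *\<^sub>R v + x)) - (LINT x : K | lborel. p K x)) / h k" for k
  have lim: "A \<longlonglongrightarrow> (\<Sum>K\<in>T. LINT x : K | lborel. p' K x v)"
    unfolding A_def sum_divide_distrib
    by (intro tendsto_sum directional_difference_limit p p' h hl)
      (use mesh_body[OF mesh] in \<open>auto simp: body_def\<close>)
  \<comment> \<open>The index set splits into non-edges, whose terms vanish in the limit, and edges
    grouped with their reverses, for which only the grouped terms have the linear limit.\<close>
  have Ak: "A k = (\<Sum>e\<in>?P - ?\<Lambda>. overlap p (h k *\<^sub>R v) e / h k)
      + (\<Sum>e\<in>\<E>. (overlap p (h k *\<^sub>R v) e + overlap p (h k *\<^sub>R v) (rev_edge e)) / h k)" for k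
  proof -
    have Ak: "A k = (\<Sum>e\<in>?P. overlap p (h k *\<^sub>R v) e / h k)"
      using periodic_translation_identity[OF pc small] by (simp add: A_def sum_divide_distrib)
    also have "\<dots> = (\<Sum>e\<in>?P - ?\<Lambda>. overlap p (h k *\<^sub>R v) e / h k) + (\<Sum>e\<in>?\<Lambda>. overlap p (h k *\<^sub>R v) e / h k)"
      by (rule sum.subset_diff[OF sub finP])
    also have "(\<Sum>e\<in>?\<Lambda>. overlap p (h k *\<^sub>R v) e / h k)
        = (\<Sum>e\<in>\<E>. overlap p (h k *\<^sub>R v) e / h k) + (\<Sum>e\<in>rev_edge ` \<E>. overlap p (h k *\<^sub>R v) e / h k)"
      unfolding part(1) using fin\<E> part(2) by (intro sum.union_disjoint) auto
    also have "(\<Sum>e\<in>rev_edge ` \<E>. overlap p (h k *\<^sub>R v) e / h k)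
        = (\<Sum>e\<in>\<E>. overlap p (h k *\<^sub>R v) (rev_edge e) / h k)"
      by (subst sum.reindex) (auto simp: inj_on_def dest: arg_cong[of _ _ rev_edge])
    finally show ?thesis by (simp add: sum.distrib add_divide_distrib)
  qed
  have "(\<lambda>k. (\<Sum>e\<in>?P - ?\<Lambda>. overlap p (h k *\<^sub>R v) e / h k)
      + (\<Sum>e\<in>\<E>. (overlap p (h k *\<^sub>R v) e + overlap p (h k *\<^sub>R v) (rev_edge e)) / h k))
    \<longlonglongrightarrow> (\<Sum>e\<in>?P - ?\<Lambda>. 0) + (\<Sum>e\<in>\<E>. (normal_plus e \<bullet> v) * face_integral (edge_face e) (edge_diff p e))"
    by (intro tendsto_add tendsto_sum overlap_limit_degenerate overlap_limit_edge pc h hl)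
      (use part(1) in auto)
  then have "A \<longlonglongrightarrow> (\<Sum>e\<in>?P - ?\<Lambda>. 0) + (\<Sum>e\<in>\<E>. (normal_plus e \<bullet> v) * face_integral (edge_face e) (edge_diff p e))"
    by (rule Lim_transform_eventually) (simp add: Ak)
  from LIMSEQ_unique[OF lim this] show ?thesis by simp
qed

end

section \<open>Maxwell part\<close>

lemma U_h_poly:
  assumes "U \<in> U_h L T r"
  obtains P P' where "\<And>K i. K \<in> T \<Longrightarrow> (\<lambda>x. P K x $ i) \<in> poly_space r"
    and "\<And>K x. K \<in> T \<Longrightarrow> x \<in> interior K \<Longrightarrow> U x = P K x"
    and "\<And>K x. (P K has_derivative P' K x) (at x)" and "\<And>K v. continuous_on UNIV (\<lambda>x. P' K x v)"
proof -
  have "\<forall>K\<in>T. \<forall>i. \<exists>p\<in>poly_space r. \<forall>z\<in>interior K. U z $ i = p z"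
    using assms unfolding U_h_def dg_space_def by blast
  then obtain p where p: "\<And>K i. K \<in> T \<Longrightarrow> p K i \<in> poly_space r"
    "\<And>K i z. K \<in> T \<Longrightarrow> z \<in> interior K \<Longrightarrow> U z $ i = p K i z"
    by metis
  \<comment> \<open>Outside the mesh the polynomials are set to zero, so that differentiability and
    continuity hold for every set K, as \<open>discrete_divergence\<close> demands.\<close>
  define q where "q K i = (if K \<in> T then p K i else (\<lambda>_. 0))" for K i
  have q: "real_polynomial_function (q K i)" for K i
    using p(1) poly_space_real_polynomial_function
    by (auto simp: q_def intro: real_polynomial_function.intros(2))
  have "\<forall>K i. \<exists>q'. (\<forall>x. (q K i has_derivative q' x) (at x)) \<and>
      (\<forall>v. real_polynomial_function (\<lambda>x. q' x v))"
    using real_polynomial_function_derivative[OF q] by blast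
  then obtain q' where q': "\<And>K i x. (q K i has_derivative q' K i x) (at x)"
    "\<And>K i v. real_polynomial_function (\<lambda>x. q' K i x v)"
    by metis
  show ?thesis
  proof (rule that[of "\<lambda>K x. \<chi> i. q K i x" "\<lambda>K x v. \<chi> i. q' K i x v"])
    show "((\<lambda>x. \<chi> i. q K i x) has_derivative (\<lambda>v. \<chi> i. q' K i x v)) (at x)" for K x
      by (subst has_derivative_componentwise_within) (auto simp: Basis_vec_def inner_axis q')
    show "continuous_on UNIV (\<lambda>x. \<chi> i. q' K i x v)" for K v
      by (intro continuous_on_vec_lambda continuous_on_real_polynomial_function q')
  qed (use q p in \<open>auto simp: q_def vec_eq_iff\<close>)
qed

text \<open>The curl read off from a total derivative \<open>f\<close>, whose value at the j-th axis
  is the partial derivative in that direction. It is continuous in the base point, while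
  \<open>curl\<close> of a discrete function is controlled only inside elements.\<close>

definition curl_of :: "(real^3 \<Rightarrow> real^3) \<Rightarrow> real^3" where
  "curl_of f = vector [f (axis 2 1) $ 3 - f (axis 3 1) $ 2, f (axis 3 1) $ 1 - f (axis 1 1) $ 3,
    f (axis 1 1) $ 2 - f (axis 2 1) $ 1]"

lemma curl_eq:
  assumes P: "(P has_derivative P') (at x)" and x: "x \<in> interior K"
    and eq: "\<And>y. y \<in> interior K \<Longrightarrow> U y = P y"
  shows "curl U x = curl_of P'"
proof -
  have "(U has_derivative P') (at x)"
    by (rule has_derivative_transform_within_open[OF P open_interior x]) (simp add: eq)
  then have "frechet_derivative U (at x) = P'" by (simp add: frechet_derivative_at[symmetric])
  then show ?thesis
    by (simp add: curl_def curl_of_def jacobian_def matrix_def Let_def)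
qed

lemma continuous_on_curl_of:
  assumes "\<And>v. continuous_on UNIV (\<lambda>x. P' x v)"
  shows "continuous_on UNIV (\<lambda>x. curl_of (P' x))"
proof -
  have *: "(\<lambda>x. curl_of (P' x)) = (\<lambda>x. \<chi> i. curl_of (P' x) $ i)" by simp
  have "continuous_on UNIV (\<lambda>x. curl_of (P' x) $ i)" for i
  proof -
    have c: "continuous_on UNIV (\<lambda>x. P' x v $ j)" for v j
      by (intro continuous_intros assms)
    show ?thesis
      using exhaust_3[of i] by (elim disjE) (simp_all add: curl_of_def vector_3 continuous_on_diff c)
  qed
  then show ?thesis by (subst *) (rule continuous_on_vec_lambda)
qed

lemma bounded_bilinear_cross3: "bounded_bilinear cross3"
  using bilinear_cross bilinear_conv_bounded_bilinear by blast

lemma set_integral_sum: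
  fixes f :: "'i \<Rightarrow> 'a \<Rightarrow> 'b::{banach, second_countable_topology}"
  assumes "\<And>i. i \<in> I \<Longrightarrow> set_integrable M A (f i)"
  shows "set_lebesgue_integral M A (\<lambda>x. \<Sum>i\<in>I. f i x) = (\<Sum>i\<in>I. set_lebesgue_integral M A (f i))"
  using assms unfolding set_lebesgue_integral_def set_integrable_def
  by (simp add: scaleR_sum_right Bochner_Integration.integral_sum)

text \<open>\<open>div (E \<times> B) = B \<bullet> curl E - E \<bullet> curl B\<close>\<close>

lemma div_cross3:
  "(\<Sum>j\<in>UNIV. (cross3 E (B' (axis j 1)) + cross3 (E' (axis j 1)) B) $ j)
    = B \<bullet> curl_of E' - E \<bullet> curl_of B'"
  by (simp add: sum_3 cross3_def curl_of_def inner_vec_def vector_3 algebra_simps)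

text \<open>The central and both alternating fluxes satisfy a discrete product rule for jumps.\<close>

lemma maxwell_flux_identity:
  fixes n :: "real^3"
  assumes "Et = (case flux of Central \<Rightarrow> (1/2) *\<^sub>R (Ep + Em) | Alternating_Eplus_Bminus \<Rightarrow> Ep
      | Alternating_Eminus_Bplus \<Rightarrow> Em)"
    and "Bt = (case flux of Central \<Rightarrow> (1/2) *\<^sub>R (Bp + Bm) | Alternating_Eplus_Bminus \<Rightarrow> Bm
      | Alternating_Eminus_Bplus \<Rightarrow> Bp)"
  shows "Et \<bullet> (cross3 Bp n + cross3 Bm (- n)) - Bt \<bullet> (cross3 Ep n + cross3 Em (- n))
    = n \<bullet> (cross3 Ep Bp - cross3 Em Bm)"
  unfolding assms
  by (cases flux) (simp_all add: cross3_def inner_vec_def sum_3 vector_3 field_simps)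

lemma face_integral_cong:
  assumes "\<And>x. x \<in> F \<Longrightarrow> f x = g x" shows "face_integral F f = face_integral F g"
  unfolding face_integral_def set_lebesgue_integral_def
  by (intro Bochner_Integration.integral_cong) (auto simp: indicator_def assms)

lemma face_set_integrable:
  assumes \<rho>: "plane_chart (flat_chart F) n b" and F: "compact F" and f: "continuous_on UNIV f"
  shows "set_integrable lebesgue (flat_chart F -` F) (\<lambda>y. f (flat_chart F y) :: real)"
  by (intro compact_set_integrable compact_plane_chart_vimage[OF \<rho> F]
      continuous_on_compose2[OF f] plane_chart_continuous[OF \<rho>]) auto

context
  fixes L :: real and T :: "(real^3) set set" and \<E> :: "edge set"
  assumes L: "L > 0" and mesh: "mesh T (Omega_x L)" and \<E>: "edge_set T (period_lattice L) \<E>"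
begin

text \<open>By the product rule for jumps, the flux terms combine to the normal component of the
  jump of E \<times> B. It is expanded along the axes to match the directional form of
  \<open>discrete_divergence\<close>.\<close>

lemma maxwell_edge:
  assumes e: "e \<in> \<E>" and PE: "\<And>K. continuous_on UNIV (PE K)" and PB: "\<And>K. continuous_on UNIV (PB K)"
    and E: "\<And>K x. K \<in> T \<Longrightarrow> x \<in> interior K \<Longrightarrow> E x = PE K x"
    and B: "\<And>K x. K \<in> T \<Longrightarrow> x \<in> interior K \<Longrightarrow> B x = PB K x"
  shows "face_integral (edge_face e) (\<lambda>x. flux_E flux e E x \<bullet> tangential_jump e B x)
      - face_integral (edge_face e) (\<lambda>x. flux_B flux e B x \<bullet> tangential_jump e E x)
    = (\<Sum>j\<in>UNIV. (normal_plus e \<bullet> axis j 1) *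
        face_integral (edge_face e) (edge_diff (\<lambda>K x. cross3 (PE K x) (PB K x) $ j) e))"
proof -
  obtain K K' s where fields: "e = (K, K', s)" by (cases e)
  have e': "e \<in> labelled_edges T (period_lattice L)" using e \<E> by (auto simp: edge_set_def)
  then have K: "K \<in> T" "K' \<in> T" by (auto simp: fields labelled_edges_def)
  have b: "body K" "body K'" using mesh_body[OF mesh] K by auto
  define n where "n = normal_plus e"
  define F where "F = edge_face e"
  have nm: "normal_minus e = - n" using labelled_edge_normals(2)[OF L mesh e'] by (simp add: n_def)
  obtain b where \<rho>: "plane_chart (flat_chart F) n b"
    using labelled_edge_normals(3)[OF L mesh e'] by (auto simp: n_def F_def)
  have F: "compact F" using labelled_edge_normals(4)[OF L mesh e'] by (simp add: F_def)
  define Em where "Em x = PE K' (x - s)" for x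
  define Bm where "Bm x = PB K' (x - s)" for x
  have c: "continuous_on UNIV Em" "continuous_on UNIV Bm"
    unfolding Em_def[abs_def] Bm_def[abs_def]
    by (auto intro!: continuous_intros continuous_on_compose2[OF PE] continuous_on_compose2[OF PB])
  define Et where "Et x = (case flux of Central \<Rightarrow> (1/2) *\<^sub>R (PE K x + Em x)
    | Alternating_Eplus_Bminus \<Rightarrow> PE K x | Alternating_Eminus_Bplus \<Rightarrow> Em x)" for x
  define Bt where "Bt x = (case flux of Central \<Rightarrow> (1/2) *\<^sub>R (PB K x + Bm x)
    | Alternating_Eplus_Bminus \<Rightarrow> Bm x | Alternating_Eminus_Bplus \<Rightarrow> PB K x)" for x
  have ct: "continuous_on UNIV Et" "continuous_on UNIV Bt"
    unfolding Et_def[abs_def] Bt_def[abs_def]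
    by (cases flux; auto intro!: continuous_intros c PE PB)+
  have tr: "trace_plus e E x = PE K x" "trace_plus e B x = PB K x"
    "trace_minus e E x = Em x" "trace_minus e B x = Bm x" if "x \<in> F" for x
  proof -
    have x: "x \<in> K" "x - s \<in> K'" using that by (auto simp: F_def fields)
    show "trace_plus e E x = PE K x" "trace_plus e B x = PB K x"
      "trace_minus e E x = Em x" "trace_minus e B x = Bm x"
      unfolding fields trace_plus.simps trace_minus.simps Em_def Bm_def
      by (intro elem_trace_eq b x PE PB E B K; assumption)+
  qed
  have fE: "flux_E flux e E x \<bullet> tangential_jump e B x
      = Et x \<bullet> (cross3 (PB K x) n + cross3 (Bm x) (- n))" if "x \<in> F" for x
    using tr[OF that] by (cases flux)
      (simp_all add: average_def tangential_jump_def Et_def nm n_def[symmetric])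
  have fB: "flux_B flux e B x \<bullet> tangential_jump e E x
      = Bt x \<bullet> (cross3 (PE K x) n + cross3 (Em x) (- n))" if "x \<in> F" for x
    using tr[OF that] by (cases flux)
      (simp_all add: average_def tangential_jump_def Bt_def nm n_def[symmetric])
  define p where "p j K x = cross3 (PE K x) (PB K x) $ j" for j K x
  have pc: "continuous_on UNIV (p j K)" for j K
    unfolding p_def[abs_def] by (intro continuous_intros continuous_on_cross PE PB)
  have "face_integral F (\<lambda>x. flux_E flux e E x \<bullet> tangential_jump e B x)
      - face_integral F (\<lambda>x. flux_B flux e B x \<bullet> tangential_jump e E x)
      = face_integral F (\<lambda>x. Et x \<bullet> (cross3 (PB K x) n + cross3 (Bm x) (- n)))
      - face_integral F (\<lambda>x. Bt x \<bullet> (cross3 (PE K x) n + cross3 (Em x) (- n)))"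
    using fE fB by (intro arg_cong2[where f="(-)"] face_integral_cong) auto
  also have "\<dots> = face_integral F (\<lambda>x. Et x \<bullet> (cross3 (PB K x) n + cross3 (Bm x) (- n))
      - Bt x \<bullet> (cross3 (PE K x) n + cross3 (Em x) (- n)))"
    unfolding face_integral_def
    by (intro set_integral_diff(2)[symmetric] face_set_integrable[OF \<rho> F] continuous_intros continuous_on_cross ct c PE PB)
  also have "\<dots> = face_integral F (\<lambda>x. n \<bullet> (cross3 (PE K x) (PB K x) - cross3 (Em x) (Bm x)))"
    by (rule face_integral_cong) (rule maxwell_flux_identity[OF Et_def Bt_def])
  also have "\<dots> = face_integral F (\<lambda>x. \<Sum>j\<in>UNIV. (n \<bullet> axis j 1) * edge_diff (p j) e x)"
    by (rule face_integral_cong)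
      (simp add: fields p_def Em_def Bm_def inner_vec_def[of n] inner_axis)
  also have "\<dots> = (\<Sum>j\<in>UNIV. face_integral F (\<lambda>x. (n \<bullet> axis j 1) * edge_diff (p j) e x))"
    unfolding face_integral_def
    by (intro set_integral_sum face_set_integrable[OF \<rho> F] continuous_intros
        continuous_on_edge_diff pc)
  also have "\<dots> = (\<Sum>j\<in>UNIV. (n \<bullet> axis j 1) * face_integral F (edge_diff (p j) e))"
    by (simp add: face_integral_def)
  finally show ?thesis by (simp add: n_def F_def p_def[abs_def])
qed

lemma maxwell_energy:
  assumes EU: "E \<in> U_h L T r" and BU: "B \<in> U_h L T r"
  shows "b_h flux T \<E> Et Bt E B E B
    = mesh_integral T (\<lambda>x. Et x \<bullet> E x) + mesh_integral T (\<lambda>x. Bt x \<bullet> B x)"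
proof -
  obtain PE PE' where E: "\<And>K x. K \<in> T \<Longrightarrow> x \<in> interior K \<Longrightarrow> E x = PE K x"
    and PE': "\<And>K x. (PE K has_derivative PE' K x) (at x)" "\<And>K v. continuous_on UNIV (\<lambda>x. PE' K x v)"
    using U_h_poly[OF EU] by metis
  obtain PB PB' where B: "\<And>K x. K \<in> T \<Longrightarrow> x \<in> interior K \<Longrightarrow> B x = PB K x"
    and PB': "\<And>K x. (PB K has_derivative PB' K x) (at x)" "\<And>K v. continuous_on UNIV (\<lambda>x. PB' K x v)"
    using U_h_poly[OF BU] by metis
  have PE: "continuous_on UNIV (PE K)" and PB: "continuous_on UNIV (PB K)" for K
    using PE'(1) PB'(1) has_derivative_continuous_on by blast+
  \<comment> \<open>The j-th component of the Poynting field E \<times> B, to which the divergence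
    theorem is applied in the direction of the j-th axis.\<close>
  define p where "p j K x = cross3 (PE K x) (PB K x) $ j" for j K x
  define p' where "p' j K x v = (cross3 (PE K x) (PB' K x v) + cross3 (PE' K x v) (PB K x)) $ j" for j K x v
  have body: "body K" if "K \<in> T" for K using mesh_body[OF mesh that] .
  have cpt: "compact K" if "K \<in> T" for K using body[OF that] by (simp add: body_def)
  have "((\<lambda>x. cross3 (PE K x) (PB K x)) has_derivative
      (\<lambda>v. cross3 (PE K x) (PB' K x v) + cross3 (PE' K x v) (PB K x))) (at x)" for K x
    by (rule bounded_bilinear.FDERIV[OF bounded_bilinear_cross3 PE'(1) PB'(1)])
  then have pd: "(p j K has_derivative p' j K x) (at x)" for j K x
    unfolding p_def[abs_def] p'_def[abs_def]
    by (rule bounded_linear.has_derivative[OF bounded_linear_vec_nth])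
  have p'c: "continuous_on UNIV (\<lambda>x. p' j K x v)" for j K v
    unfolding p'_def by (intro continuous_intros continuous_on_cross PE PB PE'(2) PB'(2))
  have cE: "continuous_on UNIV (\<lambda>x. PB K x \<bullet> curl_of (PE' K x))"
    and cB: "continuous_on UNIV (\<lambda>x. PE K x \<bullet> curl_of (PB' K x))" for K
    by (intro continuous_intros continuous_on_curl_of PE PB PE'(2) PB'(2))+
  have mE: "mesh_integral T (\<lambda>x. B x \<bullet> curl E x) = (\<Sum>K\<in>T. LINT x : K | lborel. PB K x \<bullet> curl_of (PE' K x))"
    unfolding mesh_integral_def
  proof (rule sum.cong)
    fix K assume K: "K \<in> T"
    have "(LINT x : K | lebesgue. B x \<bullet> curl E x) = (LINT x : K | lebesgue. PB K x \<bullet> curl_of (PE' K x))"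
      by (rule body_integral_cong[OF body[OF K]]) (simp add: B[OF K] curl_eq[OF PE'(1) _ E[OF K]])
    then show "(LINT x : K | lebesgue. B x \<bullet> curl E x) = (LINT x : K | lborel. PB K x \<bullet> curl_of (PE' K x))"
      using set_integral_lebesgue_eq_lborel[OF cpt[OF K] continuous_on_subset[OF cE]] by simp
  qed simp
  have mB: "mesh_integral T (\<lambda>x. E x \<bullet> curl B x) = (\<Sum>K\<in>T. LINT x : K | lborel. PE K x \<bullet> curl_of (PB' K x))"
    unfolding mesh_integral_def
  proof (rule sum.cong)
    fix K assume K: "K \<in> T"
    have "(LINT x : K | lebesgue. E x \<bullet> curl B x) = (LINT x : K | lebesgue. PE K x \<bullet> curl_of (PB' K x))"
      by (rule body_integral_cong[OF body[OF K]]) (simp add: E[OF K] curl_eq[OF PB'(1) _ B[OF K]])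
    then show "(LINT x : K | lebesgue. E x \<bullet> curl B x) = (LINT x : K | lborel. PE K x \<bullet> curl_of (PB' K x))"
      using set_integral_lebesgue_eq_lborel[OF cpt[OF K] continuous_on_subset[OF cB]] by simp
  qed simp
  have "mesh_integral T (\<lambda>x. B x \<bullet> curl E x) - mesh_integral T (\<lambda>x. E x \<bullet> curl B x)
      = (\<Sum>K\<in>T. LINT x : K | lborel. (\<Sum>j\<in>UNIV. p' j K x (axis j 1)))"
    unfolding mE mB sum_subtractf[symmetric]
  proof (rule sum.cong)
    fix K assume K: "K \<in> T"
    show "(LINT x : K | lborel. PB K x \<bullet> curl_of (PE' K x)) - (LINT x : K | lborel. PE K x \<bullet> curl_of (PB' K x))
        = (LINT x : K | lborel. (\<Sum>j\<in>UNIV. p' j K x (axis j 1)))"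
      unfolding p'_def div_cross3
      by (intro set_integral_diff(2)[symmetric] compact_set_integrable(2) cpt K
          continuous_on_subset[OF cE] continuous_on_subset[OF cB]) auto
  qed simp
  also have "\<dots> = (\<Sum>K\<in>T. \<Sum>j\<in>UNIV. LINT x : K | lborel. p' j K x (axis j 1))"
    by (intro sum.cong refl set_integral_sum compact_set_integrable(2) cpt
        continuous_on_subset[OF p'c]) auto
  also have "\<dots> = (\<Sum>j\<in>UNIV. \<Sum>K\<in>T. LINT x : K | lborel. p' j K x (axis j 1))"
    by (rule sum.swap)
  also have "\<dots> = (\<Sum>j\<in>UNIV. \<Sum>e\<in>\<E>. (normal_plus e \<bullet> axis j 1) * face_integral (edge_face e) (edge_diff (p j) e))"
    by (intro sum.cong refl discrete_divergence[OF L mesh \<E>] pd p'c)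
  also have "\<dots> = (\<Sum>e\<in>\<E>. \<Sum>j\<in>UNIV. (normal_plus e \<bullet> axis j 1) * face_integral (edge_face e) (edge_diff (p j) e))"
    by (rule sum.swap)
  also have "\<dots> = (\<Sum>e\<in>\<E>. face_integral (edge_face e) (\<lambda>x. flux_E flux e E x \<bullet> tangential_jump e B x)
      - face_integral (edge_face e) (\<lambda>x. flux_B flux e B x \<bullet> tangential_jump e E x))"
    unfolding p_def[abs_def] by (intro sum.cong refl maxwell_edge[symmetric] PE PB E B)
  finally show ?thesis
    unfolding b_h_def by (simp add: sum_subtractf)
qed

end

section \<open>Vlasov part\<close>

lemma grad_eq: "GDERIV g x :> D \<Longrightarrow> grad g x = D"
  unfolding grad_def
proof (rule the_equality)
  fix D' assume "GDERIV g x :> D" "GDERIV g x :> D'"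
  then have "(\<lambda>h. h \<bullet> D) = (\<lambda>h. h \<bullet> D')"
    unfolding gderiv_def by (rule has_derivative_unique)
  then show "D' = D" by (metis inner_commute vector_eq_ldot)
qed

lemma grad_const: "grad (\<lambda>y. c) x = 0"
  by (rule grad_eq) (rule GDERIV_const)

lemma grad_norm_square: "grad (\<lambda>y. (norm y)\<^sup>2) x = 2 *\<^sub>R x"
proof (rule grad_eq)
  have "GDERIV (\<lambda>y. y \<bullet> y) x :> 2 *\<^sub>R x"
    unfolding gderiv_def
    by (auto intro!: derivative_eq_intros simp: inner_commute)
  then show "GDERIV (\<lambda>y. (norm y)\<^sup>2) x :> 2 *\<^sub>R x" by (simp add: power2_norm_eq_inner)
qed

lemma contact_normals:
  fixes A C :: "(real^3) set"
  assumes "body A" "body C" "interior A \<inter> interior C = {}" "aff_dim (A \<inter> C) = 2"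
  shows "outward_normal C (A \<inter> C) = - outward_normal A (A \<inter> C)"
  using separated_contact_limit(2)[OF assms(1-3) continuous_on_const _ LIMSEQ_inverse_real_of_nat assms(4), of 0 0]
  by simp

text \<open>On the outer boundary there is no second body to separate from. Instead the facet itself
  is separated from the interior of K, and the inequality extends to K by closure.\<close>

lemma facet_normal:
  fixes K :: "(real^3) set"
  assumes K: "body K" and F: "F facet_of K"
  shows "norm (outward_normal K F) = 1"
proof -
  have "aff_dim K = 3" using K by (simp add: body_def aff_dim_nonempty_interior)
  then have dim: "aff_dim F = 2" and face: "F face_of K" and ne: "F \<noteq> {}"
    using F by (auto simp: facet_of_def)
  have sub: "F \<subseteq> K" using face by (rule face_of_imp_subset)
  have "F \<noteq> K" using \<open>aff_dim K = 3\<close> dim by auto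
  then have disj: "interior K \<inter> F = {}"
    using face_of_disjoint_interior[OF face] by blast
  obtain a c where a: "a \<noteq> 0" "\<forall>x\<in>interior K. a \<bullet> x \<le> c" "\<forall>x\<in>F. a \<bullet> x \<ge> c"
    using separating_hyperplane_sets[OF _ _ _ ne disj] K face_of_imp_convex[OF face]
    by (auto simp: body_def convex_interior)
  have "closure (interior K) \<subseteq> {x. a \<bullet> x \<le> c}"
    by (rule closure_minimal) (use a in \<open>auto simp: closed_halfspace_le\<close>)
  then have le: "a \<bullet> x \<le> c" if "x \<in> K" for x
    using that body_closure_interior[OF K] by auto
  have "outward_normal K F = a /\<^sub>R norm a"
  proof (rule outward_normal_eq[OF _ sub dim])
    fix x y assume x: "x \<in> F" "y \<in> K"
    then have "a \<bullet> y \<le> a \<bullet> x" using le[OF x(2)] a(3) by force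
    then show "(a /\<^sub>R norm a) \<bullet> y \<le> (a /\<^sub>R norm a) \<bullet> x" by (simp add: divide_right_mono mult_left_mono)
  qed (use K a in \<open>auto simp: body_def\<close>)
  then show ?thesis using a(1) by simp
qed

text \<open>Equal traces meet opposite normals. The condition \<open>g (x - s) = g x\<close> covers
  two uses: constants across periodic edges in physical space, and the squared norm across velocity
  edges, where s = 0.\<close>

lemma jump_continuous:
  assumes e: "e = (K, K', s)" and K: "body K" "body K'" and disj: "interior K \<inter> interior ((+) s ` K') = {}"
    and d: "aff_dim (edge_face e) = 2" and g: "continuous_on UNIV g" and x: "x \<in> edge_face e"
    and periodic: "g (x - s) = g x"
  shows "jump e g x = 0"
proof -
  have n: "normal_minus e = - normal_plus e"
    using contact_normals[OF K(1) body_translation[OF K(2)] disj] d by (simp add: e)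
  have x': "x \<in> K" "x - s \<in> K'" using x by (auto simp: e)
  have "trace_plus e g x = g x" "trace_minus e g x = g (x - s)"
    unfolding e trace_plus.simps trace_minus.simps by (intro elem_trace_eq K x' g refl)+
  then show ?thesis using n periodic by (simp add: jump_def)
qed

section \<open>Integrals over product elements and admissibility of the test function\<close>

lemma product_mesh_integral:
  assumes "\<And>K. K \<in> Tx \<Longrightarrow> body K" "\<And>K. K \<in> T\<xi> \<Longrightarrow> body K"
  shows "mesh_integral (product_mesh Tx T\<xi>) h
    = (\<Sum>Kx\<in>Tx. \<Sum>K\<xi>\<in>T\<xi>. set_lebesgue_integral lebesgue (Kx \<times> K\<xi>) h)"
proof -
  have ne: "K \<noteq> {}" if "K \<in> Tx \<or> K \<in> T\<xi>" for K
    using assms that interior_subset by (fastforce simp: body_def)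
  have "product_mesh Tx T\<xi> = (\<lambda>(Kx, K\<xi>). Kx \<times> K\<xi>) ` (Tx \<times> T\<xi>)"
    by (auto simp: product_mesh_def)
  \<comment> \<open>Elements are nonempty, so a product determines its factors and no summand is
    counted twice or lost.\<close>
  moreover have "inj_on (\<lambda>(Kx, K\<xi>). Kx \<times> K\<xi>) (Tx \<times> T\<xi>)"
    using ne by (auto simp: inj_on_def times_eq_iff)
  ultimately show ?thesis
    unfolding mesh_integral_def
    by (simp add: sum.reindex sum.cartesian_product comp_def case_prod_unfold)
qed

text \<open>Fubini in mixed form: the outer integral is over \<open>lebesgue\<close>, to be compared
  with the mesh integral of the work term; the inner one is over \<open>lborel\<close>, as the
  product measure provides it.\<close>

lemma compact_Times_integral:
  fixes h :: "'a::euclidean_space \<times> 'b::euclidean_space \<Rightarrow> real"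
  assumes A: "compact A" and C: "compact C" and h: "continuous_on UNIV h"
  shows "(LINT z : A \<times> C | lebesgue. h z) = (LINT x : A | lebesgue. LINT \<xi> : C | lborel. h (x, \<xi>))"
    and "set_integrable lebesgue A (\<lambda>x. LINT \<xi> : C | lborel. h (x, \<xi>))"
proof -
  let ?H = "\<lambda>z. indicator (A \<times> C) z *\<^sub>R h z"
  have "integrable lborel ?H"
    using A C by (intro borel_integrable_compact compact_Times continuous_on_subset[OF h]) auto
  then have int: "integrable (lborel \<Otimes>\<^sub>M lborel) ?H" by (simp add: lborel_prod)
  have eq: "(\<integral>\<xi>. ?H (x, \<xi>) \<partial>lborel) = indicator A x *\<^sub>R (LINT \<xi> : C | lborel. h (x, \<xi>))" for x
    by (simp add: set_lebesgue_integral_def indicator_times mult.assoc)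
  have i1: "integrable lborel (\<lambda>x. indicator A x *\<^sub>R (LINT \<xi> : C | lborel. h (x, \<xi>)))"
    using lborel_pair.integrable_fst'[OF int] by (simp only: eq)
  then show "set_integrable lebesgue A (\<lambda>x. LINT \<xi> : C | lborel. h (x, \<xi>))"
    unfolding set_integrable_def using integrable_completion borel_measurable_integrable by blast
  have "(LINT z : A \<times> C | lebesgue. h z) = (LINT z : A \<times> C | lborel. h z)"
    using A C by (intro set_integral_lebesgue_eq_lborel compact_Times continuous_on_subset[OF h]) auto
  also have "\<dots> = (\<integral>x. (\<integral>\<xi>. ?H (x, \<xi>) \<partial>lborel) \<partial>lborel)"
    unfolding set_lebesgue_integral_def using lborel_pair.integral_fst'[OF int] by (simp add: lborel_prod)
  also have "\<dots> = (LINT x : A | lborel. LINT \<xi> : C | lborel. h (x, \<xi>))"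
    by (simp only: eq set_lebesgue_integral_def[of lborel A])
  also have "\<dots> = (LINT x : A | lebesgue. LINT \<xi> : C | lborel. h (x, \<xi>))"
    unfolding set_lebesgue_integral_def[of _ A]
    by (rule integral_completion[symmetric]) (use i1 in auto)
  finally show "(LINT z : A \<times> C | lebesgue. h z) = (LINT x : A | lebesgue. LINT \<xi> : C | lborel. h (x, \<xi>))" .
qed

lemma norm_square_in_G_h:
  assumes k: "k \<ge> 2"
  shows "(\<lambda>z. (norm (snd z))\<^sup>2) \<in> G_h Lx L\<xi> Tx T\<xi> k"
proof -
  let ?g = "\<lambda>z :: (real^3) \<times> (real^3). (norm (snd z))\<^sup>2"
  let ?\<Omega> = "Omega_x Lx \<times> Omega_xi L\<xi>"
  let ?C = "cbox (vec (- Lx)) (vec Lx) \<times> cbox (vec (- L\<xi>)) (vec L\<xi>) :: ((real^3) \<times> (real^3)) set"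
  have c: "continuous_on S ?g" "continuous_on S (\<lambda>z. (?g z)\<^sup>2)" for S
    by (intro continuous_intros)+
  \<comment> \<open>The periodic box is half-open, neither open nor closed, so its measurability is
    obtained from half-spaces.\<close>
  have "Omega_x Lx = (\<Inter>i. {x. - Lx < x $ i} \<inter> {x. x $ i \<le> Lx})"
    by (auto simp: Omega_x_def)
  moreover have "(\<Inter>i. {x :: real^3. - Lx < x $ i} \<inter> {x. x $ i \<le> Lx}) \<in> sets borel"
    by (intro sets.finite_INT sets.Int)
      (auto intro!: borel_open borel_closed open_halfspace_component_gt_cart closed_halfspace_component_le_cart)
  ultimately have O: "Omega_x Lx \<in> sets borel" by simp
  have "fst -` Omega_x Lx \<in> sets (borel :: ((real^3) \<times> (real^3)) measure)"
    by (rule measurable_sets_borel[OF _ O]) (intro borel_measurable_continuous_onI continuous_intros)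
  moreover have "snd -` Omega_xi L\<xi> \<in> sets (borel :: ((real^3) \<times> (real^3)) measure)"
    by (rule measurable_sets_borel) (auto intro!: borel_measurable_continuous_onI continuous_intros simp: Omega_xi_def)
  ultimately have "fst -` Omega_x Lx \<inter> snd -` Omega_xi L\<xi> \<in> sets (borel :: ((real^3) \<times> (real^3)) measure)"
    by (rule sets.Int)
  moreover have "?\<Omega> = fst -` Omega_x Lx \<inter> snd -` Omega_xi L\<xi>" by auto
  ultimately have \<Omega>: "?\<Omega> \<in> sets lebesgue" by simp
  have "set_integrable lebesgue ?C (\<lambda>z. (?g z)\<^sup>2)"
    by (intro compact_set_integrable(1) compact_Times c) auto
  then have "set_integrable lebesgue ?\<Omega> (\<lambda>z. (?g z)\<^sup>2)"
    by (rule set_integrable_subset[OF _ \<Omega>])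
      (auto simp: Omega_x_def Omega_xi_def mem_box_cart less_imp_le)
  then have "integrable (lebesgue_on ?\<Omega>) (\<lambda>z. (?g z)\<^sup>2)"
    using \<Omega> by (simp add: integrable_restrict_space set_integrable_def)
  moreover have "?g \<in> borel_measurable (lebesgue_on ?\<Omega>)"
    by (intro measurable_restrict_space1 measurable_completion) (simp add: borel_measurable_continuous_onI c)
  ultimately have "square_integrable_on ?\<Omega> ?g" by (simp add: square_integrable_on_def)
  then show ?thesis
    unfolding G_h_def dg_space_def
    by (intro CollectI conjI ballI bexI[OF _ norm_snd_square_in_poly_space[OF k]]) auto
qed

text \<open>With a = l . n the average contributes a/2 and the upwind term |a|/2, and their sum is
  max a 0. Thus only outflow is counted in \<open>Theta_h3\<close>.\<close>

lemma upwind_boundary_flux: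
  fixes l n :: "real^3"
  assumes "norm n = 1"
  shows "((1/2) *\<^sub>R (q *\<^sub>R l) + (\<bar>l \<bullet> n\<bar> / 2) *\<^sub>R (q *\<^sub>R n)) \<bullet> (g *\<^sub>R n) = q * g * max (l \<bullet> n) 0"
  using assms by (simp add: norm_eq_1 inner_add_left max_def abs_if algebra_simps)

theorem vlasov_energy:
  assumes Lx: "Lx > 0" and mx: "mesh Tx (Omega_x Lx)" and m\<xi>: "mesh T\<xi> (Omega_xi L\<xi>)"
    and ex: "edge_set Tx (period_lattice Lx) \<E>x" and e\<xi>: "edge_set T\<xi> {0} \<E>\<xi>"
    and f: "f \<in> G_h Lx L\<xi> Tx T\<xi> k" and EU: "E \<in> U_h Lx Tx r"
  shows "a_h L\<xi> Tx T\<xi> \<E>x \<E>\<xi> ft f E B (\<lambda>z. (norm (snd z))\<^sup>2)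
    = mesh_integral (product_mesh Tx T\<xi>) (\<lambda>z. ft z * (norm (snd z))\<^sup>2)
      - 2 * mesh_integral Tx (\<lambda>x. current T\<xi> f x \<bullet> E x)
      + Theta_h3 L\<xi> Tx T\<xi> f E B"
proof -
  have bx: "body K" if "K \<in> Tx" for K using mesh_body[OF mx that] .
  have b\<xi>: "body K" if "K \<in> T\<xi>" for K using mesh_body[OF m\<xi> that] .
  have cpt: "compact K" if "K \<in> Tx \<or> K \<in> T\<xi>" for K using bx b\<xi> that by (auto simp: body_def)
  have "\<forall>Kx\<in>Tx. \<forall>K\<xi>\<in>T\<xi>. \<exists>p\<in>poly_space k. \<forall>z\<in>interior (Kx \<times> K\<xi>). f z = p z"
    using f unfolding G_h_def dg_space_def product_mesh_def by blast
  then obtain p where p: "\<And>Kx K\<xi>. Kx \<in> Tx \<Longrightarrow> K\<xi> \<in> T\<xi> \<Longrightarrow> p Kx K\<xi> \<in> poly_space k"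
    and fp: "\<And>Kx K\<xi> x \<xi>. Kx \<in> Tx \<Longrightarrow> K\<xi> \<in> T\<xi> \<Longrightarrow> x \<in> interior Kx \<Longrightarrow> \<xi> \<in> interior K\<xi> \<Longrightarrow>
      f (x, \<xi>) = p Kx K\<xi> (x, \<xi>)"
    unfolding interior_Times by (metis mem_Sigma_iff)
  have pc: "continuous_on UNIV (p Kx K\<xi>)" if "Kx \<in> Tx" "K\<xi> \<in> T\<xi>" for Kx K\<xi>
    using p[OF that] poly_space_real_polynomial_function continuous_on_real_polynomial_function by blast
  have pc2: "continuous_on UNIV (\<lambda>\<xi>. p Kx K\<xi> (x, \<xi>))" if "Kx \<in> Tx" "K\<xi> \<in> T\<xi>" for Kx K\<xi> x
    by (intro continuous_on_compose2[OF pc[OF that]] continuous_intros) auto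
  obtain PE PE' where E: "\<And>K x. K \<in> Tx \<Longrightarrow> x \<in> interior K \<Longrightarrow> E x = PE K x"
    and PE': "\<And>K x. (PE K has_derivative PE' K x) (at x)"
    using U_h_poly[OF EU] by metis
  have PE: "continuous_on UNIV (PE K)" for K using PE' has_derivative_continuous_on by blast
  have zero: "face_integral F (\<lambda>_. 0) = 0" for F
    by (simp add: face_integral_def set_lebesgue_integral_def)

  \<comment> \<open>The numbers of these facts follow the terms of \<open>a_h\<close>: 3 is the flux
    through physical edges, 4 the Lorentz volume term, 5 and 6 the inner and the boundary velocity
    edges.\<close>
  have 3: "(\<Sum>e\<in>\<E>x. face_integral (edge_face e) (\<lambda>x. flux_x e f x \<xi> \<bullet> jump e (\<lambda>y. c) x)) = 0" for \<xi> c
  proof (rule sum.neutral, rule ballI)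
    fix e assume "e \<in> \<E>x"
    then have e': "e \<in> labelled_edges Tx (period_lattice Lx)" using ex by (auto simp: edge_set_def)
    obtain K K' s where e: "e = (K, K', s)" by (cases e)
    have K: "K \<in> Tx" "K' \<in> Tx" and s: "s \<in> period_lattice Lx" and ne: "K \<noteq> K' \<or> s \<noteq> 0"
      and d: "aff_dim (edge_face e) = 2"
      using e' by (auto simp: e labelled_edges_def)
    have "interior ((+) 0 ` K) \<inter> interior ((+) s ` K') = {}"
      by (rule periodic_disjoint[OF Lx mx K _ s])
        (use ne zero_neighbour_shifts neighbour_shifts_lattice in auto)
    then have disj: "interior K \<inter> interior ((+) s ` K') = {}" by simp
    have "face_integral (edge_face e) (\<lambda>x. flux_x e f x \<xi> \<bullet> jump e (\<lambda>y. c) x)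
        = face_integral (edge_face e) (\<lambda>_. 0)"
      by (rule face_integral_cong) (simp add: jump_continuous[OF e bx[OF K(1)] bx[OF K(2)] disj d])
    then show "face_integral (edge_face e) (\<lambda>x. flux_x e f x \<xi> \<bullet> jump e (\<lambda>y. c) x) = 0"
      by (simp add: zero)
  qed

  have 5: "(\<Sum>e\<in>\<E>\<xi>. face_integral (edge_face e)
      (\<lambda>\<xi>. flux_xi e f E B x \<xi> \<bullet> jump e (\<lambda>\<eta>. (norm \<eta>)\<^sup>2) \<xi>)) = 0" for x
  proof (rule sum.neutral, rule ballI)
    fix e assume "e \<in> \<E>\<xi>"
    then have e': "e \<in> labelled_edges T\<xi> {0}" using e\<xi> by (auto simp: edge_set_def)
    obtain K K' s where e: "e = (K, K', s)" by (cases e)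
    have K: "K \<in> T\<xi>" "K' \<in> T\<xi>" and s: "s = 0" and ne: "K \<noteq> K'" and d: "aff_dim (edge_face e) = 2"
      using e' by (auto simp: e labelled_edges_def)
    have disj: "interior K \<inter> interior ((+) s ` K') = {}"
      using m\<xi> K ne by (auto simp: s mesh_def pairwise_def)
    have g: "continuous_on UNIV (\<lambda>\<eta> :: real^3. (norm \<eta>)\<^sup>2)" by (intro continuous_intros)
    have "face_integral (edge_face e) (\<lambda>\<xi>. flux_xi e f E B x \<xi> \<bullet> jump e (\<lambda>\<eta>. (norm \<eta>)\<^sup>2) \<xi>)
        = face_integral (edge_face e) (\<lambda>_. 0)"
      by (rule face_integral_cong)
        (simp add: jump_continuous[OF e b\<xi>[OF K(1)] b\<xi>[OF K(2)] disj d g] s)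
    then show "face_integral (edge_face e)
        (\<lambda>\<xi>. flux_xi e f E B x \<xi> \<bullet> jump e (\<lambda>\<eta>. (norm \<eta>)\<^sup>2) \<xi>) = 0"
      by (simp add: zero)
  qed

  have 6: "mesh_integral Tx (\<lambda>x. \<Sum>e\<in>boundary_edges T\<xi> (Omega_xi L\<xi>). face_integral (snd e)
      (\<lambda>\<xi>. boundary_flux_xi e f E B x \<xi> \<bullet> boundary_jump e (\<lambda>\<eta>. (norm \<eta>)\<^sup>2) \<xi>))
    = Theta_h3 L\<xi> Tx T\<xi> f E B"
    unfolding Theta_h3_def
  \<comment> \<open>It suffices to consider x inside an element. There f is polynomial in the
    interior of each velocity element, which determines its traces.\<close>
  proof (rule mesh_integral_cong[OF bx])
    fix Kx x assume Kx: "Kx \<in> Tx" and x: "x \<in> interior Kx"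
    show "(\<Sum>e\<in>boundary_edges T\<xi> (Omega_xi L\<xi>). face_integral (snd e)
        (\<lambda>\<xi>. boundary_flux_xi e f E B x \<xi> \<bullet> boundary_jump e (\<lambda>\<eta>. (norm \<eta>)\<^sup>2) \<xi>))
      = (\<Sum>(K, F)\<in>boundary_edges T\<xi> (Omega_xi L\<xi>). face_integral F
        (\<lambda>\<xi>. elem_trace K (\<lambda>\<eta>. f (x, \<eta>)) \<xi> * (norm \<xi>)\<^sup>2
          * max (lorentz E B x \<xi> \<bullet> outward_normal K F) 0))"
    proof (rule sum.cong[OF refl], clarify)
      fix K F assume "(K, F) \<in> boundary_edges T\<xi> (Omega_xi L\<xi>)"
      then have K: "K \<in> T\<xi>" and F: "F facet_of K" by (auto simp: boundary_edges_def)
      note b = b\<xi>[OF K]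
      \<comment> \<open>Here x is fixed, so \<open>E x\<close> and \<open>B x\<close> are constant
        vectors and the Lorentz field is affine in the velocity.\<close>
      have lc: "continuous_on UNIV (lorentz E B x)"
        unfolding lorentz_def[abs_def] by (intro continuous_intros continuous_on_cross)
      show "face_integral (snd (K, F))
          (\<lambda>\<xi>. boundary_flux_xi (K, F) f E B x \<xi> \<bullet> boundary_jump (K, F) (\<lambda>\<eta>. (norm \<eta>)\<^sup>2) \<xi>)
        = face_integral F (\<lambda>\<xi>. elem_trace K (\<lambda>\<eta>. f (x, \<eta>)) \<xi> * (norm \<xi>)\<^sup>2
          * max (lorentz E B x \<xi> \<bullet> outward_normal K F) 0)"
        unfolding snd_conv
      proof (rule face_integral_cong)
        fix \<xi> assume "\<xi> \<in> F"
        then have \<xi>: "\<xi> \<in> K" using F facet_of_imp_subset by blast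
        have t1: "elem_trace K (\<lambda>\<eta>. f (x, \<eta>)) \<xi> = p Kx K (x, \<xi>)"
          by (rule elem_trace_eq[OF b \<xi> _ pc2[OF Kx K]]) (rule fp[OF Kx K x])
        have t2: "elem_trace K (\<lambda>\<eta>. f (x, \<eta>) *\<^sub>R lorentz E B x \<eta>) \<xi> = p Kx K (x, \<xi>) *\<^sub>R lorentz E B x \<xi>"
          by (rule elem_trace_eq[OF b \<xi>]) (auto simp: fp[OF Kx K x] intro!: continuous_intros pc2[OF Kx K] lc)
        have t3: "elem_trace K (\<lambda>\<eta>. (norm \<eta>)\<^sup>2) \<xi> = (norm \<xi>)\<^sup>2"
          by (rule elem_trace_eq[OF b \<xi> refl]) (intro continuous_intros)
        show "boundary_flux_xi (K, F) f E B x \<xi> \<bullet> boundary_jump (K, F) (\<lambda>\<eta>. (norm \<eta>)\<^sup>2) \<xi>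
          = elem_trace K (\<lambda>\<eta>. f (x, \<eta>)) \<xi> * (norm \<xi>)\<^sup>2 * max (lorentz E B x \<xi> \<bullet> outward_normal K F) 0"
          unfolding boundary_flux_xi.simps boundary_average.simps boundary_jump.simps t1 t2 t3
          by (rule upwind_boundary_flux[OF facet_normal[OF b F]])
      qed
    qed
  qed

  have PM: "mesh_integral (product_mesh Tx T\<xi>) w
      = (\<Sum>Kx\<in>Tx. \<Sum>K\<xi>\<in>T\<xi>. set_lebesgue_integral lebesgue (Kx \<times> K\<xi>) w)" for w :: "_ \<Rightarrow> real"
    by (rule product_mesh_integral) (use bx b\<xi> in auto)
  \<comment> \<open>The density of the work f \<xi> . E with the polynomial representatives
    inserted, which makes it continuous on the whole product space.\<close>
  define h where "h Kx K\<xi> z = p Kx K\<xi> z * (snd z \<bullet> PE Kx (fst z))" for Kx K\<xi> and z :: "(real^3) \<times> (real^3)"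
  have hc: "continuous_on UNIV (h Kx K\<xi>)" if "Kx \<in> Tx" "K\<xi> \<in> T\<xi>" for Kx K\<xi>
    unfolding h_def[abs_def]
    by (intro continuous_intros pc that continuous_on_compose2[OF PE]) auto
  have "mesh_integral (product_mesh Tx T\<xi>)
      (\<lambda>(x, \<xi>). f (x, \<xi>) * (lorentz E B x \<xi> \<bullet> grad (\<lambda>\<eta>. (norm \<eta>)\<^sup>2) \<xi>))
    = (\<Sum>Kx\<in>Tx. \<Sum>K\<xi>\<in>T\<xi>. 2 * (LINT x : Kx | lebesgue. LINT \<xi> : K\<xi> | lborel. h Kx K\<xi> (x, \<xi>)))"
    unfolding PM
  proof (intro sum.cong refl)
    fix Kx K\<xi> assume K: "Kx \<in> Tx" "K\<xi> \<in> T\<xi>"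
    have "(LINT z : Kx \<times> K\<xi> | lebesgue.
        (\<lambda>(x, \<xi>). f (x, \<xi>) * (lorentz E B x \<xi> \<bullet> grad (\<lambda>\<eta>. (norm \<eta>)\<^sup>2) \<xi>)) z)
      = (LINT z : Kx \<times> K\<xi> | lebesgue. 2 * h Kx K\<xi> z)"
    proof (rule body_integral_cong[OF body_Times[OF bx[OF K(1)] b\<xi>[OF K(2)]]])
      fix z assume "z \<in> interior (Kx \<times> K\<xi>)"
      then obtain x \<xi> where z: "z = (x, \<xi>)" "x \<in> interior Kx" "\<xi> \<in> interior K\<xi>"
        by (auto simp: interior_Times)
      show "(\<lambda>(x, \<xi>). f (x, \<xi>) * (lorentz E B x \<xi> \<bullet> grad (\<lambda>\<eta>. (norm \<eta>)\<^sup>2) \<xi>)) z = 2 * h Kx K\<xi> z"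
        by (simp add: z(1) grad_norm_square h_def fp[OF K z(2,3)] lorentz_def inner_add_left inner_add_right
            dot_cross_self E[OF K(1) z(2)] inner_commute)
    qed
    also have "\<dots> = 2 * (LINT z : Kx \<times> K\<xi> | lebesgue. h Kx K\<xi> z)" by simp
    also have "(LINT z : Kx \<times> K\<xi> | lebesgue. h Kx K\<xi> z)
        = (LINT x : Kx | lebesgue. LINT \<xi> : K\<xi> | lborel. h Kx K\<xi> (x, \<xi>))"
      using K cpt by (intro compact_Times_integral(1) hc) auto
    finally show "(LINT z : Kx \<times> K\<xi> | lebesgue.
        (\<lambda>(x, \<xi>). f (x, \<xi>) * (lorentz E B x \<xi> \<bullet> grad (\<lambda>\<eta>. (norm \<eta>)\<^sup>2) \<xi>)) z)
      = 2 * (LINT x : Kx | lebesgue. LINT \<xi> : K\<xi> | lborel. h Kx K\<xi> (x, \<xi>))" .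
  qed
  also have "\<dots> = 2 * (\<Sum>Kx\<in>Tx. \<Sum>K\<xi>\<in>T\<xi>. LINT x : Kx | lebesgue. LINT \<xi> : K\<xi> | lborel. h Kx K\<xi> (x, \<xi>))"
    by (simp add: sum_distrib_left)
  also have "(\<Sum>Kx\<in>Tx. \<Sum>K\<xi>\<in>T\<xi>. LINT x : Kx | lebesgue. LINT \<xi> : K\<xi> | lborel. h Kx K\<xi> (x, \<xi>))
      = mesh_integral Tx (\<lambda>x. current T\<xi> f x \<bullet> E x)"
    unfolding mesh_integral_def[of Tx]
  proof (rule sum.cong[OF refl])
    fix Kx assume Kx: "Kx \<in> Tx"
    have "(LINT x : Kx | lebesgue. current T\<xi> f x \<bullet> E x)
        = (LINT x : Kx | lebesgue. \<Sum>K\<xi>\<in>T\<xi>. LINT \<xi> : K\<xi> | lborel. h Kx K\<xi> (x, \<xi>))"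
    proof (rule body_integral_cong[OF bx[OF Kx]])
      fix x assume x: "x \<in> interior Kx"
      \<comment> \<open>For fixed x the field is a constant vector, so its inner product with the
        current moves under the velocity integral.\<close>
      have "(LINT \<xi> : K\<xi> | lebesgue. f (x, \<xi>) *\<^sub>R \<xi>) \<bullet> PE Kx x = (LINT \<xi> : K\<xi> | lborel. h Kx K\<xi> (x, \<xi>))"
        if K: "K\<xi> \<in> T\<xi>" for K\<xi>
      proof -
        have c: "continuous_on S (\<lambda>\<xi>. p Kx K\<xi> (x, \<xi>) *\<^sub>R \<xi>)" for S
          by (intro continuous_intros continuous_on_subset[OF pc2[OF Kx K]]) auto
        have i: "integrable lborel (\<lambda>\<xi>. indicator K\<xi> \<xi> *\<^sub>R (p Kx K\<xi> (x, \<xi>) *\<^sub>R \<xi>))"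
          by (rule borel_integrable_compact[OF _ c]) (use K cpt in auto)
        have "(LINT \<xi> : K\<xi> | lebesgue. f (x, \<xi>) *\<^sub>R \<xi>) = (LINT \<xi> : K\<xi> | lebesgue. p Kx K\<xi> (x, \<xi>) *\<^sub>R \<xi>)"
          by (rule body_integral_cong[OF b\<xi>[OF K]]) (simp add: fp[OF Kx K x])
        also have "\<dots> = (LINT \<xi> : K\<xi> | lborel. p Kx K\<xi> (x, \<xi>) *\<^sub>R \<xi>)"
          using K cpt by (intro set_integral_lebesgue_eq_lborel c) auto
        finally have "(LINT \<xi> : K\<xi> | lebesgue. f (x, \<xi>) *\<^sub>R \<xi>) \<bullet> PE Kx x
            = (\<integral>\<xi>. (indicator K\<xi> \<xi> *\<^sub>R (p Kx K\<xi> (x, \<xi>) *\<^sub>R \<xi>)) \<bullet> PE Kx x \<partial>lborel)"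
          unfolding set_lebesgue_integral_def
          by (simp only: integral_inner_left[OF i])
        then show ?thesis
          by (simp add: set_lebesgue_integral_def h_def mult.assoc)
      qed
      then show "current T\<xi> f x \<bullet> E x = (\<Sum>K\<xi>\<in>T\<xi>. LINT \<xi> : K\<xi> | lborel. h Kx K\<xi> (x, \<xi>))"
        by (simp add: current_def mesh_integral_def E[OF Kx x] inner_sum_left)
    qed
    also have "\<dots> = (\<Sum>K\<xi>\<in>T\<xi>. LINT x : Kx | lebesgue. LINT \<xi> : K\<xi> | lborel. h Kx K\<xi> (x, \<xi>))"
      using Kx cpt by (intro set_integral_sum compact_Times_integral(2) hc) auto
    finally show "(\<Sum>K\<xi>\<in>T\<xi>. LINT x : Kx | lebesgue. LINT \<xi> : K\<xi> | lborel. h Kx K\<xi> (x, \<xi>))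
        = (LINT x : Kx | lebesgue. current T\<xi> f x \<bullet> E x)" ..
  qed
  finally have 4: "mesh_integral (product_mesh Tx T\<xi>)
      (\<lambda>(x, \<xi>). f (x, \<xi>) * (lorentz E B x \<xi> \<bullet> grad (\<lambda>\<eta>. (norm \<eta>)\<^sup>2) \<xi>))
    = 2 * mesh_integral Tx (\<lambda>x. current T\<xi> f x \<bullet> E x)" .
  have mesh_zero: "mesh_integral T (\<lambda>_. 0 :: real) = 0" for T :: "'c::euclidean_space set set"
    by (simp add: mesh_integral_def set_lebesgue_integral_def)
  show ?thesis
    unfolding a_h_def using 4 6
    by (simp add: 3 5 grad_const mesh_zero case_prod_unfold)
qed

section \<open>Time derivatives and the energy identity\<close>

lemma time_deriv_has_vector_derivative:
  assumes "(\<lambda>s. u s z) differentiable (at t within I)"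
  shows "((\<lambda>s. u s z) has_vector_derivative time_deriv I u t z) (at t within I)"
  using assms unfolding time_deriv_def by (simp add: vector_derivative_works)

text \<open>Derivatives within I are unique only at limit points of I. A nondegenerate interval
  consists of such points, its end points included.\<close>

lemma interval_islimpt:
  fixes t :: real
  assumes I: "is_interval I" "interior I \<noteq> {}" and t: "t \<in> I"
  shows "at t within I \<noteq> bot"
proof -
  have "t \<in> closure (interior I)"
    using t closure_subset convex_closure_interior[OF is_interval_convex[OF I(1)] I(2)] by blast
  then have "t islimpt interior I"
    by (cases "t \<in> interior I") (auto simp: closure_def interior_limit_point interior_interior open_interior)
  then have "t islimpt I" using interior_subset islimpt_subset by blast
  then show ?thesis by (simp add: trivial_limit_within)
qed

context
  fixes I :: "real set" and t :: real
  assumes t: "t \<in> I" and nt: "at t within I \<noteq> bot"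
begin

text \<open>The weights do not depend on time, so differentiating the interpolation formula shows
  that a time derivative known only pointwise is again determined by its values at the
  nodes.\<close>

lemma time_deriv_interpolation:
  fixes u :: "real \<Rightarrow> 'a \<Rightarrow> 'b::real_normed_vector"
  assumes u: "\<And>s. s \<in> I \<Longrightarrow> u s x = (\<Sum>i<n. \<psi> i x *\<^sub>R u s (z i))"
    and d: "\<And>i. i < n \<Longrightarrow> (\<lambda>s. u s (z i)) differentiable (at t within I)"
  shows "time_deriv I u t x = (\<Sum>i<n. \<psi> i x *\<^sub>R time_deriv I u t (z i))"
proof -
  have "((\<lambda>s. \<Sum>i<n. \<psi> i x *\<^sub>R u s (z i)) has_vector_derivative
      (\<Sum>i<n. \<psi> i x *\<^sub>R time_deriv I u t (z i))) (at t within I)"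
    by (intro has_vector_derivative_sum bounded_linear.has_vector_derivative[OF bounded_linear_scaleR_right]
        time_deriv_has_vector_derivative d) auto
  then have "((\<lambda>s. u s x) has_vector_derivative (\<Sum>i<n. \<psi> i x *\<^sub>R time_deriv I u t (z i))) (at t within I)"
    by (rule has_vector_derivative_transform[OF t, rotated]) (simp add: u)
  then show ?thesis
    unfolding time_deriv_def by (rule vector_derivative_within[OF nt])
qed

text \<open>No exchange of derivative and integral is involved: interpolation turns the moment into
  a finite sum of node values with constant weights \<open>C i\<close>, and the same weights
  reassemble the integral of the time derivative.\<close>

lemma linear_moment_derivative:
  fixes f :: "real \<Rightarrow> 'a::euclidean_space \<Rightarrow> real"
  assumes K: "body K" and f: "\<And>s. s \<in> I \<Longrightarrow> \<exists>p\<in>poly_space m. \<forall>x\<in>interior K. f s x = p x"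
    and d: "\<And>x. x \<in> interior K \<Longrightarrow> (\<lambda>s. f s x) differentiable (at t within I)"
    and w: "continuous_on UNIV w"
  shows "((\<lambda>s. LINT x : K | lebesgue. f s x * w x) has_real_derivative
    (LINT x : K | lebesgue. time_deriv I f t x * w x)) (at t within I)"
proof -
  obtain n and z :: "nat \<Rightarrow> 'a" and \<psi> where z: "\<And>i. i < n \<Longrightarrow> z i \<in> interior K"
    and \<psi>: "\<And>i. i < n \<Longrightarrow> real_polynomial_function (\<psi> i)"
    and ip: "\<And>p x. p \<in> poly_space m \<Longrightarrow> x \<in> interior K \<Longrightarrow> p x = (\<Sum>i<n. p (z i) * \<psi> i x)"
    by (rule poly_space_interpolation[of "interior K" m], rule that)
  have fi: "f s x = (\<Sum>i<n. \<psi> i x *\<^sub>R f s (z i))" if "s \<in> I" "x \<in> interior K" for s x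
  proof -
    obtain p where p: "p \<in> poly_space m" "\<forall>x\<in>interior K. f s x = p x" using f \<open>s \<in> I\<close> by blast
    then have "f s x = (\<Sum>i<n. p (z i) * \<psi> i x)" using ip that by simp
    also have "\<dots> = (\<Sum>i<n. \<psi> i x *\<^sub>R f s (z i))"
      using p z by (intro sum.cong) (auto simp: mult.commute)
    finally show ?thesis .
  qed
  have ft: "time_deriv I f t x = (\<Sum>i<n. \<psi> i x *\<^sub>R time_deriv I f t (z i))" if "x \<in> interior K" for x
    by (rule time_deriv_interpolation) (use fi that d z in auto)
  have cpt: "compact K" using K by (simp add: body_def)
  have c: "continuous_on UNIV (\<lambda>x. a * (\<psi> i x * w x))" if "i < n" for i a
    using continuous_on_real_polynomial_function[OF \<psi>[OF that]] by (intro continuous_intros w)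
  define C where "C i = (LINT x : K | lebesgue. \<psi> i x * w x)" for i
  have int: "(LINT x : K | lebesgue. g x * w x) = (\<Sum>i<n. a i * C i)"
    if g: "\<And>x. x \<in> interior K \<Longrightarrow> g x = (\<Sum>i<n. \<psi> i x *\<^sub>R a i)" for g and a :: "nat \<Rightarrow> real"
  proof -
    have "(LINT x : K | lebesgue. g x * w x) = (LINT x : K | lebesgue. \<Sum>i<n. a i * (\<psi> i x * w x))"
      by (rule body_integral_cong[OF K]) (simp add: g sum_distrib_left mult_ac)
    also have "\<dots> = (\<Sum>i<n. LINT x : K | lebesgue. a i * (\<psi> i x * w x))"
      by (intro set_integral_sum compact_set_integrable(1) cpt continuous_on_subset[OF c]) auto
    finally show ?thesis by (simp add: C_def)
  qed
  have "((\<lambda>s. \<Sum>i<n. f s (z i) * C i) has_real_derivative (\<Sum>i<n. time_deriv I f t (z i) * C i)) (at t within I)"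
  proof (intro DERIV_sum DERIV_cmult_right)
    fix i assume "i \<in> {..<n}"
    then show "((\<lambda>s. f s (z i)) has_real_derivative time_deriv I f t (z i)) (at t within I)"
      using time_deriv_has_vector_derivative[of f "z i" t I] d[OF z]
      by (simp add: has_real_derivative_iff_has_vector_derivative)
  qed
  then have "((\<lambda>s. \<Sum>i<n. f s (z i) * C i) has_real_derivative
      (LINT x : K | lebesgue. time_deriv I f t x * w x)) (at t within I)"
    using int[OF ft] by simp
  then show ?thesis
    by (rule has_field_derivative_transform_within[OF _ zero_less_one t]) (simp add: int[OF fi])
qed

text \<open>As in the linear case, now with a quadratic form in the node values; its matrix holds
  the integrals of products of the interpolation functions.\<close>

lemma quadratic_moment_derivative:
  fixes u :: "real \<Rightarrow> real^3 \<Rightarrow> real^3"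
  assumes K: "body K" and u: "\<And>s. s \<in> I \<Longrightarrow> \<exists>P. (\<forall>i. (\<lambda>x. P x $ i) \<in> poly_space m) \<and> (\<forall>x\<in>interior K. u s x = P x)"
    and d: "\<And>x. x \<in> interior K \<Longrightarrow> (\<lambda>s. u s x) differentiable (at t within I)"
  shows "((\<lambda>s. LINT x : K | lebesgue. (norm (u s x))\<^sup>2) has_real_derivative
    2 * (LINT x : K | lebesgue. time_deriv I u t x \<bullet> u t x)) (at t within I)"
proof -
  obtain n and z :: "nat \<Rightarrow> real^3" and \<psi> where z: "\<And>i. i < n \<Longrightarrow> z i \<in> interior K"
    and \<psi>: "\<And>i. i < n \<Longrightarrow> real_polynomial_function (\<psi> i)"
    and ip: "\<And>p x. p \<in> poly_space m \<Longrightarrow> x \<in> interior K \<Longrightarrow> p x = (\<Sum>i<n. p (z i) * \<psi> i x)"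
    by (rule poly_space_interpolation[of "interior K" m], rule that)
  have ui: "u s x = (\<Sum>i<n. \<psi> i x *\<^sub>R u s (z i))" if "s \<in> I" "x \<in> interior K" for s x
  proof -
    obtain P where P: "\<And>i. (\<lambda>x. P x $ i) \<in> poly_space m" "\<And>x. x \<in> interior K \<Longrightarrow> u s x = P x"
      using u[OF \<open>s \<in> I\<close>] by blast
    have "P x $ j = (\<Sum>i<n. \<psi> i x *\<^sub>R P (z i)) $ j" for j
      using ip[OF P(1)[of j] that(2)] by (simp add: mult.commute)
    then have "P x = (\<Sum>i<n. \<psi> i x *\<^sub>R P (z i))" by (simp add: vec_eq_iff)
    moreover have "(\<Sum>i<n. \<psi> i x *\<^sub>R P (z i)) = (\<Sum>i<n. \<psi> i x *\<^sub>R u s (z i))"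
      using P(2) z by (intro sum.cong) auto
    ultimately show ?thesis using P(2) that by simp
  qed
  have ut: "time_deriv I u t x = (\<Sum>i<n. \<psi> i x *\<^sub>R time_deriv I u t (z i))" if "x \<in> interior K" for x
    by (rule time_deriv_interpolation) (use ui that d z in auto)
  have cpt: "compact K" using K by (simp add: body_def)
  have c: "continuous_on UNIV (\<lambda>x. a * (\<psi> i x * \<psi> j x))" if "i < n" "j < n" for i j a
    using continuous_on_real_polynomial_function[OF \<psi>[OF that(1)]]
      continuous_on_real_polynomial_function[OF \<psi>[OF that(2)]] by (intro continuous_intros)
  define C where "C i j = (LINT x : K | lebesgue. \<psi> i x * \<psi> j x)" for i j
  \<comment> \<open>Symmetry lets both halves of the product rule coincide after exchanging i and j,
    which produces the factor 2.\<close>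
  have sym: "C i j = C j i" for i j by (simp add: C_def mult.commute)
  have int: "(LINT x : K | lebesgue. g x \<bullet> h x) = (\<Sum>i<n. \<Sum>j<n. (a i \<bullet> b j) * C i j)"
    if g: "\<And>x. x \<in> interior K \<Longrightarrow> g x = (\<Sum>i<n. \<psi> i x *\<^sub>R a i)"
      and h: "\<And>x. x \<in> interior K \<Longrightarrow> h x = (\<Sum>i<n. \<psi> i x *\<^sub>R b i)"
    for g h and a b :: "nat \<Rightarrow> real^3"
  proof -
    have "(LINT x : K | lebesgue. g x \<bullet> h x)
        = (LINT x : K | lebesgue. \<Sum>i<n. \<Sum>j<n. (a i \<bullet> b j) * (\<psi> i x * \<psi> j x))"
    proof (rule body_integral_cong[OF K])
      fix x assume x: "x \<in> interior K"
      show "g x \<bullet> h x = (\<Sum>i<n. \<Sum>j<n. (a i \<bullet> b j) * (\<psi> i x * \<psi> j x))"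
        unfolding g[OF x] h[OF x] inner_sum_left
        unfolding inner_sum_right by (simp add: mult_ac)
    qed
    also have "\<dots> = (\<Sum>i<n. LINT x : K | lebesgue. \<Sum>j<n. (a i \<bullet> b j) * (\<psi> i x * \<psi> j x))"
      by (intro set_integral_sum compact_set_integrable(1) cpt continuous_on_sum continuous_on_subset[OF c]) auto
    also have "\<dots> = (\<Sum>i<n. \<Sum>j<n. LINT x : K | lebesgue. (a i \<bullet> b j) * (\<psi> i x * \<psi> j x))"
      by (intro sum.cong refl set_integral_sum compact_set_integrable(1) cpt continuous_on_subset[OF c]) auto
    finally show ?thesis by (simp add: C_def)
  qed
  let ?u = "\<lambda>i. u t (z i)" and ?ut = "\<lambda>i. time_deriv I u t (z i)"
  have "((\<lambda>s. \<Sum>i<n. \<Sum>j<n. (u s (z i) \<bullet> u s (z j)) * C i j) has_real_derivative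
      (\<Sum>i<n. \<Sum>j<n. (?u i \<bullet> ?ut j + ?ut i \<bullet> ?u j) * C i j)) (at t within I)"
  proof (intro DERIV_sum DERIV_cmult_right)
    fix i j assume "i \<in> {..<n}" "j \<in> {..<n}"
    then show "((\<lambda>s. u s (z i) \<bullet> u s (z j)) has_real_derivative
        (?u i \<bullet> ?ut j + ?ut i \<bullet> ?u j)) (at t within I)"
      unfolding has_real_derivative_iff_has_vector_derivative
      by (intro bounded_bilinear.has_vector_derivative[OF bounded_bilinear_inner]
          time_deriv_has_vector_derivative d z) auto
  qed
  moreover have "(\<Sum>i<n. \<Sum>j<n. (?u i \<bullet> ?ut j + ?ut i \<bullet> ?u j) * C i j)
      = 2 * (\<Sum>i<n. \<Sum>j<n. (?ut i \<bullet> ?u j) * C i j)"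
  proof -
    have "(\<Sum>i<n. \<Sum>j<n. (?u i \<bullet> ?ut j) * C i j) = (\<Sum>j<n. \<Sum>i<n. (?u i \<bullet> ?ut j) * C i j)"
      by (rule sum.swap)
    also have "\<dots> = (\<Sum>i<n. \<Sum>j<n. (?ut i \<bullet> ?u j) * C i j)"
    proof (intro sum.cong refl)
      show "(?u j \<bullet> ?ut i) * C j i = (?ut i \<bullet> ?u j) * C i j" for i j
        using sym[of j i] by (simp add: inner_commute)
    qed
    finally show ?thesis by (simp add: distrib_right sum.distrib)
  qed
  ultimately have "((\<lambda>s. \<Sum>i<n. \<Sum>j<n. (u s (z i) \<bullet> u s (z j)) * C i j) has_real_derivative
      2 * (LINT x : K | lebesgue. time_deriv I u t x \<bullet> u t x)) (at t within I)"
    using int[OF ut ui[OF t]] by simp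
  then show ?thesis
    by (rule has_field_derivative_transform_within[OF _ zero_less_one t])
      (simp add: power2_norm_eq_inner int[OF ui ui])
qed

end

text \<open>The energy integrates both squares together, while each field is differentiated by
  itself. Splitting the Bochner integral needs integrability, which the polynomial representatives
  provide.\<close>

lemma mesh_integral_norm_square_add:
  assumes T: "\<And>K. K \<in> T \<Longrightarrow> body K" and EU: "E \<in> U_h L T r" and BU: "B \<in> U_h L T r"
  shows "mesh_integral T (\<lambda>x. (norm (E x))\<^sup>2 + (norm (B x))\<^sup>2)
    = mesh_integral T (\<lambda>x. (norm (E x))\<^sup>2) + mesh_integral T (\<lambda>x. (norm (B x))\<^sup>2)"
proof -
  have "set_integrable lebesgue K (\<lambda>x. (norm (U x))\<^sup>2)" if K: "K \<in> T" and U: "U \<in> U_h L T r" for K U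
  proof -
    obtain P P' where P: "\<And>K x. K \<in> T \<Longrightarrow> x \<in> interior K \<Longrightarrow> U x = P K x"
      "\<And>K x. (P K has_derivative P' K x) (at x)"
      using U_h_poly[OF U] by metis
    have "continuous_on UNIV (P K)" using P(2) has_derivative_continuous_on by blast
    then show ?thesis
      by (intro set_integrable_body_cong[OF T[OF K], of _ "\<lambda>x. (norm (P K x))\<^sup>2"] continuous_intros)
        (simp add: P(1)[OF K])
  qed
  then show ?thesis
    using EU BU unfolding mesh_integral_def sum.distrib[symmetric]
    by (intro sum.cong refl set_integral_add(2)) auto
qed

theorem corollary3p3:
  fixes Lx L\<xi> :: real
    and Tx T\<xi> :: "(real^3) set set"
    and \<E>x \<E>\<xi> :: "edge set"
    and k r :: nat
    and flux :: maxwell_flux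
    and I :: "real set"
    and f :: "real \<Rightarrow> (real^3) \<times> (real^3) \<Rightarrow> real"
    and E B :: "real \<Rightarrow> real^3 \<Rightarrow> real^3"
  assumes "Lx > 0" and "L\<xi> > 0"
    and "mesh Tx (Omega_x Lx)" and "mesh T\<xi> (Omega_xi L\<xi>)"
    and "edge_set Tx (period_lattice Lx) \<E>x" and "edge_set T\<xi> {0} \<E>\<xi>"
    and "k \<ge> 2" and "r \<ge> 0"
    and "is_interval I" and "interior I \<noteq> {}"
    and "dg_solution Lx L\<xi> Tx T\<xi> \<E>x \<E>\<xi> k r flux I f E B"
  shows "\<forall>t\<in>I. \<exists>D.
    ((\<lambda>s. energy Tx T\<xi> (f s) (E s) (B s)) has_real_derivative D) (at t within I)
    \<and> D + Theta_h3 L\<xi> Tx T\<xi> (f t) (E t) (B t) = 0"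
proof
  fix t assume t: "t \<in> I"
  have nt: "at t within I \<noteq> bot" by (rule interval_islimpt[OF assms(9,10) t])
  have bx: "body K" if "K \<in> Tx" for K using mesh_body[OF assms(3) that] .
  have bp: "body K" if "K \<in> product_mesh Tx T\<xi>" for K
    using that mesh_body[OF assms(3)] mesh_body[OF assms(4)] by (auto simp: product_mesh_def body_Times)
  have sol: "\<And>t. t \<in> I \<Longrightarrow> f t \<in> G_h Lx L\<xi> Tx T\<xi> k" "\<And>t. t \<in> I \<Longrightarrow> E t \<in> U_h Lx Tx r"
    "\<And>t. t \<in> I \<Longrightarrow> B t \<in> U_h Lx Tx r"
    "\<And>g. g \<in> G_h Lx L\<xi> Tx T\<xi> k \<Longrightarrow>
      a_h L\<xi> Tx T\<xi> \<E>x \<E>\<xi> (time_deriv I f t) (f t) (E t) (B t) g = 0"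
    "\<And>U V. U \<in> U_h Lx Tx r \<Longrightarrow> V \<in> U_h Lx Tx r \<Longrightarrow>
      b_h flux Tx \<E>x (time_deriv I E t) (time_deriv I B t) (E t) (B t) U V
        = l_h Tx (current T\<xi> (f t)) U"
    and diff: "time_differentiable I (product_mesh Tx T\<xi>) f" "time_differentiable I Tx E"
      "time_differentiable I Tx B"
    using assms(11) t unfolding dg_solution_def by auto
  define Df where "Df = mesh_integral (product_mesh Tx T\<xi>) (\<lambda>z. time_deriv I f t z * (norm (snd z))\<^sup>2)"
  define DE where "DE = mesh_integral Tx (\<lambda>x. time_deriv I E t x \<bullet> E t x)"
  define DB where "DB = mesh_integral Tx (\<lambda>x. time_deriv I B t x \<bullet> B t x)"
  define JE where "JE = mesh_integral Tx (\<lambda>x. current T\<xi> (f t) x \<bullet> E t x)"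
  have vlasov: "Df - 2 * JE + Theta_h3 L\<xi> Tx T\<xi> (f t) (E t) (B t) = 0"
    using vlasov_energy[OF assms(1,3,4,5,6) sol(1)[OF t] sol(2)[OF t], of "time_deriv I f t" "B t"]
      sol(4)[OF norm_square_in_G_h[OF assms(7)]] by (simp add: Df_def JE_def)
  have maxwell: "DE + DB = - JE"
    using maxwell_energy[OF assms(1,3,5) sol(2)[OF t] sol(3)[OF t], of flux "time_deriv I E t" "time_deriv I B t"]
      sol(5)[OF sol(2)[OF t] sol(3)[OF t]] by (simp add: l_h_def DE_def DB_def JE_def)
  have 1: "((\<lambda>s. mesh_integral (product_mesh Tx T\<xi>) (\<lambda>z. f s z * (norm (snd z))\<^sup>2))
      has_real_derivative Df) (at t within I)"
    unfolding mesh_integral_def Df_def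
  proof (rule DERIV_sum)
    fix K assume K: "K \<in> product_mesh Tx T\<xi>"
    show "((\<lambda>s. LINT z : K | lebesgue. f s z * (norm (snd z))\<^sup>2) has_real_derivative
        (LINT z : K | lebesgue. time_deriv I f t z * (norm (snd z))\<^sup>2)) (at t within I)"
    proof (rule linear_moment_derivative[where m=k, OF t nt bp[OF K]])
      show "\<exists>p\<in>poly_space k. \<forall>x\<in>interior K. f s x = p x" if "s \<in> I" for s
        using sol(1)[OF that] K unfolding G_h_def dg_space_def by blast
      show "(\<lambda>s. f s x) differentiable at t within I" if "x \<in> interior K" for x
        using diff(1) K that t unfolding time_differentiable_def by blast
    qed (intro continuous_intros)
  qed
  have U: "((\<lambda>s. mesh_integral Tx (\<lambda>x. (norm (u s x))\<^sup>2)) has_real_derivative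
      2 * mesh_integral Tx (\<lambda>x. time_deriv I u t x \<bullet> u t x)) (at t within I)"
    if u: "\<And>s. s \<in> I \<Longrightarrow> u s \<in> U_h Lx Tx r" and du: "time_differentiable I Tx u"
    for u :: "real \<Rightarrow> real^3 \<Rightarrow> real^3"
    unfolding mesh_integral_def sum_distrib_left
  proof (rule DERIV_sum)
    fix K assume K: "K \<in> Tx"
    show "((\<lambda>s. LINT x : K | lebesgue. (norm (u s x))\<^sup>2) has_real_derivative
        2 * (LINT x : K | lebesgue. time_deriv I u t x \<bullet> u t x)) (at t within I)"
    proof (rule quadratic_moment_derivative[where m=r, OF t nt bx[OF K]])
      show "\<exists>P. (\<forall>i. (\<lambda>x. P x $ i) \<in> poly_space r) \<and> (\<forall>x\<in>interior K. u s x = P x)"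
        if "s \<in> I" for s
        using U_h_poly[OF u[OF that]] K by metis
      show "(\<lambda>s. u s x) differentiable at t within I" if "x \<in> interior K" for x
        using du K that t unfolding time_differentiable_def by blast
    qed
  qed
  have "((\<lambda>s. mesh_integral (product_mesh Tx T\<xi>) (\<lambda>z. f s z * (norm (snd z))\<^sup>2)
      + (mesh_integral Tx (\<lambda>x. (norm (E s x))\<^sup>2) + mesh_integral Tx (\<lambda>x. (norm (B s x))\<^sup>2)))
    has_real_derivative Df + (2 * DE + 2 * DB)) (at t within I)"
    unfolding DE_def DB_def by (intro DERIV_add 1 U sol(2,3) diff(2,3))
  then have "((\<lambda>s. energy Tx T\<xi> (f s) (E s) (B s)) has_real_derivative Df + (2 * DE + 2 * DB)) (at t within I)"
    by (rule has_field_derivative_transform_within[OF _ zero_less_one t])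
      (simp add: energy_def case_prod_unfold mesh_integral_norm_square_add[OF bx sol(2,3)])
  \<comment> \<open>The work term \<open>JE\<close> cancels: the Vlasov part carries it twice
    because of the gradient 2 \<xi>, and the Maxwell part twice, with the opposite sign, from
    differentiating squares.\<close>
  moreover have "Df + (2 * DE + 2 * DB) + Theta_h3 L\<xi> Tx T\<xi> (f t) (E t) (B t) = 0"
    using vlasov maxwell by linarith
  ultimately show "\<exists>D. ((\<lambda>s. energy Tx T\<xi> (f s) (E s) (B s)) has_real_derivative D) (at t within I)
    \<and> D + Theta_h3 L\<xi> Tx T\<xi> (f t) (E t) (B t) = 0"
    by blast
qed

end
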